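(* Let $Q$ be a finite connected acyclic quiver and let $C_1,C_2$ be component clusters connected by a mutation. Then for every pair $(\alpha,\alpha')$ with $\alpha\in C_1\setminus C_2$ and $\alpha'\in C_2\setminus C_1$ there is a component cluster $C_3$ with $C_1\cap C_2\subseteq C_3$ such that all generalized Schur roots occurring in the generic decomposition of $\alpha+\alpha'$ belong to $C_3$.
   Context: $k$ is an algebraically closed field of characteristic $0$, $Q$ has vertex set $Q_0=\{1,\dots,n\}$, $e_i$ the standard basis of $\mathbb{Z}^n$. For $a,b\in\mathbb{N}^n$, $\operatorname{ext}(a,b)$ is the generic (minimal) value of $\dim\operatorname{Ext}^1_{kQ}(M,N)$ over representations of dimension vectors $a,b$. A (positive) Schur root is a nonzero $d$ for which some representation of dimension vector $d$ has endomorphism ring $k$. Generalized Schur roots: positive Schur roots together with $-e_i$, $i\in Q_0$. Ext-orthogonality: positive Schur roots $a,b$ are ext-orthogonal if $\operatorname{ext}(a,b)=\operatorname{ext}(b,a)=0$; $-e_i$ and positive $d$ are ext-orthogonal iff $d_i=0$; negative Schur roots are pairwise ext-orthogonal. A component cluster is a maximal set of pairwise distinct, pairwise ext-orthogonal generalized Schur roots. Two component clusters $C_1,C_2$ are connected by a mutation if $|C_1\cap C_2|=\min(|C_1|,|C_2|)-1$. Generic decomposition: every $d\in\mathbb{Z}^n$ has a unique decomposition $d=d_1\oplus\cdots\oplus d_s$ (sum with multiplicities) into generalized Schur roots that are pairwise ext-orthogonal (for distinct positive summands, $\operatorname{ext}(d_i,d_j)=0$ for $i\neq j$); for $d\in\mathbb{N}^n$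 it is Kac's generic decomposition. *)

theory Defs
  imports Main "HOL-Library.Function_Algebras" "HOL-Library.Multiset"
    "HOL-Computational_Algebra.Polynomial"
begin

text \<open>Quivers: vertex set {0..<n} (the paper's 1..n shifted by one); arrows are
  a list of pairs (source, target), so multiple arrows are allowed.
  Dimension vectors in Z^n are functions nat => int vanishing outside {0..<n}.\<close>

type_synonym quiver = "(nat \<times> nat) list"

definition quiver_ok :: "nat \<Rightarrow> quiver \<Rightarrow> bool" where
  "quiver_ok n Q \<longleftrightarrow> (\<forall>(s,t)\<in>set Q. s < n \<and> t < n)"

definition connected_quiver :: "nat \<Rightarrow> quiver \<Rightarrow> bool" where
  "connected_quiver n Q \<longleftrightarrow> 0 < n \<and>
     (\<forall>i<n. \<forall>j<n. (i, j) \<in> (set Q \<union> (set Q)\<inverse>)\<^sup>*)"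

definition acyclic_quiver :: "quiver \<Rightarrow> bool" where
  "acyclic_quiver Q \<longleftrightarrow> acyclic (set Q)"

definition alg_closed_field :: "'k::field itself \<Rightarrow> bool" where
  "alg_closed_field _ \<longleftrightarrow> (\<forall>p::'k poly. 0 < degree p \<longrightarrow> (\<exists>x. poly p x = 0))"

text \<open>A representation of dimension vector d (d :: nat => nat): for every arrow
  number a, a matrix M a of size d(target) x d(source), stored as
  (a, row, column) => entry, zero outside its range.\<close>

type_synonym 'k rep = "nat \<Rightarrow> nat \<Rightarrow> nat \<Rightarrow> 'k"

definition is_rep :: "quiver \<Rightarrow> (nat \<Rightarrow> nat) \<Rightarrow> 'k::field rep \<Rightarrow> bool" where
  "is_rep Q d M \<longleftrightarrow> (\<forall>a r c. M a r c \<noteq> 0 \<longrightarrow>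
      a < length Q \<and> r < d (snd (Q!a)) \<and> c < d (fst (Q!a)))"

text \<open>Scalar multiplication on the coordinate space of matrix families.\<close>
definition scl :: "'k::field \<Rightarrow> (nat \<Rightarrow> nat \<Rightarrow> nat \<Rightarrow> 'k) \<Rightarrow> (nat \<Rightarrow> nat \<Rightarrow> nat \<Rightarrow> 'k)" where
  "scl x f = (\<lambda>i r c. x * f i r c)"

definition kdim :: "(nat \<Rightarrow> nat \<Rightarrow> nat \<Rightarrow> 'k::field) set \<Rightarrow> nat" where
  "kdim V = vector_space.dim scl V"

text \<open>The space of families (phi_i : M_i -> N_i)_{i in Q0}, phi_i a d'(i) x d(i) matrix.\<close>
definition vertex_maps :: "nat \<Rightarrow> (nat \<Rightarrow> nat) \<Rightarrow> (nat \<Rightarrow> nat) \<Rightarrow> (nat \<Rightarrow> nat \<Rightarrow> nat \<Rightarrow> 'k::field) set" where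
  "vertex_maps n d e = {\<phi>. \<forall>i r c. \<phi> i r c \<noteq> 0 \<longrightarrow> i < n \<and> r < e i \<and> c < d i}"

text \<open>Ringel's map delta(phi)_a = N_a phi_{s a} - phi_{t a} M_a.\<close>
definition delta :: "quiver \<Rightarrow> (nat \<Rightarrow> nat) \<Rightarrow> (nat \<Rightarrow> nat) \<Rightarrow> 'k::field rep \<Rightarrow> 'k rep
     \<Rightarrow> (nat \<Rightarrow> nat \<Rightarrow> nat \<Rightarrow> 'k) \<Rightarrow> (nat \<Rightarrow> nat \<Rightarrow> nat \<Rightarrow> 'k)" where
  "delta Q d e M N \<phi> = (\<lambda>a r c.
     if a < length Q \<and> r < e (snd (Q!a)) \<and> c < d (fst (Q!a)) then
       (\<Sum>j<e (fst (Q!a)). N a r j * \<phi> (fst (Q!a)) j c)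
       - (\<Sum>j<d (snd (Q!a)). \<phi> (snd (Q!a)) r j * M a j c)
     else 0)"

text \<open>dim Hom(M,N) = dim ker delta; dim Ext^1(M,N) = dim coker delta (standard
  exact sequence for the hereditary algebra kQ).\<close>
definition dim_hom :: "nat \<Rightarrow> quiver \<Rightarrow> (nat \<Rightarrow> nat) \<Rightarrow> (nat \<Rightarrow> nat) \<Rightarrow> 'k::field rep \<Rightarrow> 'k rep \<Rightarrow> nat" where
  "dim_hom n Q d e M N = kdim {\<phi> \<in> vertex_maps n d e. delta Q d e M N \<phi> = 0}"

definition dim_ext :: "nat \<Rightarrow> quiver \<Rightarrow> (nat \<Rightarrow> nat) \<Rightarrow> (nat \<Rightarrow> nat) \<Rightarrow> 'k::field rep \<Rightarrow> 'k rep \<Rightarrow> nat" where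
  "dim_ext n Q d e M N =
     (\<Sum>a<length Q. d (fst (Q!a)) * e (snd (Q!a))) - kdim (delta Q d e M N ` vertex_maps n d e)"

text \<open>Generic (= minimal) value of dim Ext^1 over representations of given dimension vectors.\<close>
definition ext :: "'k::field itself \<Rightarrow> nat \<Rightarrow> quiver \<Rightarrow> (nat \<Rightarrow> nat) \<Rightarrow> (nat \<Rightarrow> nat) \<Rightarrow> nat" where
  "ext K n Q a b = (LEAST x. \<exists>(M::'k rep) N. is_rep Q a M \<and> is_rep Q b N \<and> x = dim_ext n Q a b M N)"

definition dimvec :: "nat \<Rightarrow> (nat \<Rightarrow> int) \<Rightarrow> bool" where
  "dimvec n d \<longleftrightarrow> (\<forall>i. i \<ge> n \<longrightarrow> d i = 0)"

definition unitvec :: "nat \<Rightarrow> nat \<Rightarrow> int" where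
  "unitvec i = (\<lambda>j. if j = i then 1 else 0)"

definition schur_root :: "'k::field itself \<Rightarrow> nat \<Rightarrow> quiver \<Rightarrow> (nat \<Rightarrow> int) \<Rightarrow> bool" where
  "schur_root K n Q d \<longleftrightarrow> dimvec n d \<and> (\<forall>i. 0 \<le> d i) \<and> d \<noteq> 0 \<and>
     (\<exists>M::'k rep. is_rep Q (\<lambda>i. nat (d i)) M \<and>
        dim_hom n Q (\<lambda>i. nat (d i)) (\<lambda>i. nat (d i)) M M = 1)"

definition neg_root :: "nat \<Rightarrow> (nat \<Rightarrow> int) \<Rightarrow> bool" where
  "neg_root n d \<longleftrightarrow> (\<exists>i<n. d = - unitvec i)"

definition gen_schur_root :: "'k::field itself \<Rightarrow> nat \<Rightarrow> quiver \<Rightarrow> (nat \<Rightarrow> int) \<Rightarrow> bool" where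
  "gen_schur_root K n Q d \<longleftrightarrow> schur_root K n Q d \<or> neg_root n d"

text \<open>Ext-orthogonality of generalized Schur roots (also defined for a = b,
  where for a positive root it means ext(a,a) = 0).\<close>
definition ext_orth :: "'k::field itself \<Rightarrow> nat \<Rightarrow> quiver \<Rightarrow> (nat \<Rightarrow> int) \<Rightarrow> (nat \<Rightarrow> int) \<Rightarrow> bool" where
  "ext_orth K n Q a b \<longleftrightarrow>
     (if schur_root K n Q a \<and> schur_root K n Q b then
        ext K n Q (\<lambda>i. nat (a i)) (\<lambda>i. nat (b i)) = 0 \<and> ext K n Q (\<lambda>i. nat (b i)) (\<lambda>i. nat (a i)) = 0
      else if neg_root n a \<and> schur_root K n Q b then (\<forall>i<n. a = - unitvec i \<longrightarrow> b i = 0)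
      else if schur_root K n Q a \<and> neg_root n b then (\<forall>i<n. b = - unitvec i \<longrightarrow> a i = 0)
      else neg_root n a \<and> neg_root n b)"

definition orth_set :: "'k::field itself \<Rightarrow> nat \<Rightarrow> quiver \<Rightarrow> (nat \<Rightarrow> int) set \<Rightarrow> bool" where
  "orth_set K n Q C \<longleftrightarrow> (\<forall>a\<in>C. gen_schur_root K n Q a) \<and>
     (\<forall>a\<in>C. \<forall>b\<in>C. a \<noteq> b \<longrightarrow> ext_orth K n Q a b)"

definition component_cluster :: "'k::field itself \<Rightarrow> nat \<Rightarrow> quiver \<Rightarrow> (nat \<Rightarrow> int) set \<Rightarrow> bool" where
  "component_cluster K n Q C \<longleftrightarrow> orth_set K n Q C \<and>
     (\<forall>C'. C \<subseteq> C' \<and> orth_set K n Q C' \<longrightarrow> C' = C)"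

definition mutation_connected :: "(nat \<Rightarrow> int) set \<Rightarrow> (nat \<Rightarrow> int) set \<Rightarrow> bool" where
  "mutation_connected C1 C2 \<longleftrightarrow>
     int (card (C1 \<inter> C2)) = min (int (card C1)) (int (card C2)) - 1"

text \<open>A generic decomposition of d: a multiset of generalized Schur roots summing
  to d, whose members at different positions are ext-orthogonal.\<close>
definition generic_decomp :: "'k::field itself \<Rightarrow> nat \<Rightarrow> quiver \<Rightarrow> (nat \<Rightarrow> int) \<Rightarrow> (nat \<Rightarrow> int) multiset \<Rightarrow> bool" where
  "generic_decomp K n Q d D \<longleftrightarrow> (\<forall>a\<in>#D. gen_schur_root K n Q a) \<and> sum_mset D = d \<and>
     (\<forall>a\<in>#D. \<forall>b\<in>#(D - {#a#}). ext_orth K n Q a b)"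

end

theory Submission
  imports Defs "Jordan_Normal_Form.Determinant" "HOL-Computational_Algebra.Formal_Laurent_Series"
    "HOL-Computational_Algebra.Polynomial_FPS" "HOL-Computational_Algebra.Fraction_Field"
begin

text \<open>The roots shared by both clusters, together with the summands of all generic decompositions
  of \<open>d = \<alpha> + \<alpha>'\<close>, are pairwise ext-orthogonal; any maximal orthogonal set containing them is \<open>C3\<close>.
  If \<open>d = x\<^sub>1 + \<dots> + x\<^sub>s\<close> with \<open>ext(x\<^sub>i, x\<^sub>j) = 0\<close> for \<open>i \<noteq> j\<close>, a line from a direct sum of generic
  representations of dimensions \<open>x\<^sub>i\<close> to an arbitrary one of dimension \<open>d\<close> becomes block diagonal over
  \<open>k[[t]]\<close>, so \<open>ext(b, d) = 0\<close> implies \<open>ext(b, x\<^sub>i) = 0\<close>. This settles everything except two summands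
  \<open>x\<close>, \<open>y\<close> of different decompositions of \<open>d\<close> with \<open>ext(x, x)\<close> and \<open>ext(y, y)\<close> nonzero. Then
  \<open>\<langle>x, x\<rangle> < 0\<close>, and \<open>x\<close> occurs in the other decomposition: on the line joining both direct sums, an
  ideal of the endomorphism ring over \<open>k(t)\<close> defined by traces detects \<open>x\<close> at either end.\<close>

text \<open>Uniqueness of generic decompositions is not presupposed, so the summands of all
  decompositions of d enter \<open>C3\<close> together and have to be compared across
  decompositions. No topology is used: a condition counts as open if on every line starting where it
  holds it fails for finitely many parameters only. The conditions in use are rank conditions on
  matrices with polynomial entries, so the reason is always that a nonzero polynomial has finitely
  many roots. For a summand x with ext(x, x) nonzero the detour over ext(x, d) = 0 is blocked. What
  helps is that <x, x> < 0 makes ext nonzero between any two roots on the ray of x: each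
  decomposition has at most one summand there, and a trace vector proportional to x singles it out.
  Idempotents exist only after expansion in power series at one end of the line; the two ends
  communicate through endomorphisms over k[t], obtained from an idempotent by a k(t)-linear
  functional, which respects linear equations but not products. If one of \<alpha>, \<alpha>' is
  -e_i, then d is the other one lowered by one at i, a vertex where the positive shared roots
  vanish.\<close>

section \<open>Matrices over finite index sets\<close>

text \<open>Vectors are rows acting on the left, so \<open>T\<close> describes a map from functions
  on \<open>I\<close> to functions on \<open>J\<close>; values off \<open>I\<close> and
  \<open>J\<close> never matter.\<close>

definition inj_mat :: "'i set \<Rightarrow> 'j set \<Rightarrow> ('i \<Rightarrow> 'j \<Rightarrow> 'a::comm_ring_1) \<Rightarrow> bool" where
  "inj_mat I J T \<longleftrightarrow> (\<forall>f. (\<forall>j\<in>J. (\<Sum>i\<in>I. f i * T i j) = 0) \<longrightarrow> (\<forall>i\<in>I. f i = 0))"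

definition surj_mat :: "'i set \<Rightarrow> 'j set \<Rightarrow> ('i \<Rightarrow> 'j \<Rightarrow> 'a::comm_ring_1) \<Rightarrow> bool" where
  "surj_mat I J T \<longleftrightarrow> (\<forall>g. \<exists>f. \<forall>j\<in>J. (\<Sum>i\<in>I. f i * T i j) = g j)"

text \<open>\<open>S\<close> is the adjugate and \<open>d\<close> the determinant, carried over from
  an enumeration of \<open>J\<close>. The last conjunct is all that is remembered of the
  determinant: it is how \<open>d\<close> is later seen not to vanish at a given point.\<close>

lemma adjugate_on:
  fixes A :: "'i \<Rightarrow> 'i \<Rightarrow> 'a::comm_ring_1"
  assumes "finite J"
  shows "\<exists>S d. (\<forall>i\<in>J. \<forall>l\<in>J. (\<Sum>j\<in>J. A i j * S j l) = (if i = l then d else 0)) \<and>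
    (\<forall>i\<in>J. \<forall>l\<in>J. (\<Sum>j\<in>J. S i j * A j l) = (if i = l then d else 0)) \<and>
    (\<forall>h :: 'a \<Rightarrow> 'b::comm_ring_1. comm_ring_hom h \<longrightarrow>
       (\<forall>i\<in>J. \<forall>l\<in>J. h (A i l) = (if i = l then 1 else 0)) \<longrightarrow> h d = 1)"
proof -
  obtain e where e: "bij_betw e {0..<card J} J"
    using assms ex_bij_betw_nat_finite by blast
  define m where "m = card J"
  have e: "bij_betw e {0..<m} J" using e m_def by simp
  define e' where "e' = inv_into {0..<m} e"
  have e1: "\<And>i. i \<in> J \<Longrightarrow> e' i < m" "\<And>i. i \<in> J \<Longrightarrow> e (e' i) = i"
    using e unfolding e'_def
    by (metis atLeast0LessThan bij_betw_apply bij_betw_inv_into lessThan_iff)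
       (metis bij_betw_inv_into_right e)
  define M where "M = mat m m (\<lambda>(i,j). A (e i) (e j))"
  have M: "M \<in> carrier_mat m m" unfolding M_def by simp
  define S where "S = (\<lambda>i j. adj_mat M $$ (e' i, e' j))"
  note adj = adj_mat[OF M]
  have reidx: "(\<Sum>j\<in>J. f j) = (\<Sum>j = 0..<m. f (e j))" for f :: "'i \<Rightarrow> 'a"
    using sum.reindex_bij_betw[OF e, of f] by simp
  have e'e: "e' (e j) = j" if "j < m" for j
    unfolding e'_def using that e by (simp add: bij_betw_inv_into_left)
  show ?thesis
  proof (intro exI[of _ S] exI[of _ "det M"] conjI ballI allI impI)
    fix i l assume il: "i \<in> J" "l \<in> J"
    have eq: "e' i = e' l \<longleftrightarrow> i = l" using e1 il by metis
    have "(\<Sum>j\<in>J. A i j * S j l) = (\<Sum>j = 0..<m. M $$ (e' i, j) * adj_mat M $$ (j, e' l))"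
      unfolding reidx S_def using il e1 e'e by (intro sum.cong) (auto simp: M_def)
    also have "\<dots> = (M * adj_mat M) $$ (e' i, e' l)"
      using M adj(1) e1 il by (auto simp: scalar_prod_def)
    also have "\<dots> = (if i = l then det M else 0)"
      unfolding adj(2) using e1 il eq by auto
    finally show "(\<Sum>j\<in>J. A i j * S j l) = (if i = l then det M else 0)" .
  next
    fix i l assume il: "i \<in> J" "l \<in> J"
    have eq: "e' i = e' l \<longleftrightarrow> i = l" using e1 il by metis
    have "(\<Sum>j\<in>J. S i j * A j l) = (\<Sum>j = 0..<m. adj_mat M $$ (e' i, j) * M $$ (j, e' l))"
      unfolding reidx S_def using il e1 e'e by (intro sum.cong) (auto simp: M_def)
    also have "\<dots> = (adj_mat M * M) $$ (e' i, e' l)"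
      using M adj(1) e1 il by (auto simp: scalar_prod_def)
    also have "\<dots> = (if i = l then det M else 0)"
      unfolding adj(3) using e1 il eq by auto
    finally show "(\<Sum>j\<in>J. S i j * A j l) = (if i = l then det M else 0)" .
  next
    fix h :: "'a \<Rightarrow> 'b::comm_ring_1"
    assume h: "comm_ring_hom h"
      and one: "\<forall>i\<in>J. \<forall>l\<in>J. h (A i l) = (if i = l then 1 else 0)"
    interpret comm_ring_hom h by fact
    have inj: "e i = e j \<longleftrightarrow> i = j" if "i < m" "j < m" for i j
      using e that by (metis e'e)
    have "map_mat h M = 1\<^sub>m m"
      unfolding M_def using e one inj by (intro eq_matI) (auto simp: bij_betw_def)
    then show "h (det M) = 1" by (metis hom_det det_one)
  qed
qed

text \<open>The identity writes each of the \<open>card I\<close> unit vectors as a combination of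
  the \<open>card J\<close> rows of \<open>Q\<close>, so independence bounds their number.\<close>

lemma card_le_if_mat_identity:
  fixes P :: "'i \<Rightarrow> 'j \<Rightarrow> 'k::field"
  assumes fin: "finite I" "finite J"
    and id: "\<And>i l. i \<in> I \<Longrightarrow> l \<in> I \<Longrightarrow> (\<Sum>j\<in>J. P i j * Q j l) = (if i = l then 1 else 0)"
  shows "card I \<le> card J"
proof -
  define sc where "sc = (\<lambda>(c::'k) (f::'i \<Rightarrow> 'k). (\<lambda>i. c * f i))"
  interpret vs: vector_space sc
    by unfold_locales (auto simp: sc_def fun_eq_iff algebra_simps)
  define u where "u = (\<lambda>i l. if l = i \<and> i \<in> I then (1::'k) else 0)"
  define q where "q = (\<lambda>j l. if l \<in> I then Q j l else 0)"
  have inj: "inj_on u I" unfolding inj_on_def u_def by (metis zero_neq_one)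
  have app: "(\<Sum>a\<in>A. f a) x = (\<Sum>a\<in>A. f a x)" for A :: "'c set" and f :: "'c \<Rightarrow> 'i \<Rightarrow> 'k" and x
    by (induct A rule: infinite_finite_induct) auto
  have ind: "vs.independent (u ` I)"
  proof (rule vs.independent_if_scalars_zero)
    fix f x assume z: "(\<Sum>x\<in>u ` I. sc (f x) x) = 0" and x: "x \<in> u ` I"
    then obtain i where i: "i \<in> I" "x = u i" by blast
    have "(\<Sum>x\<in>u ` I. sc (f x) x) i = (\<Sum>l\<in>I. sc (f (u l)) (u l) i)"
      unfolding sum.reindex[OF inj] app by simp
    also have "\<dots> = (\<Sum>l\<in>I. if l = i then f (u i) else 0)"
      using i by (intro sum.cong) (auto simp: sc_def u_def)
    also have "\<dots> = f x" using i fin by simp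
    finally show "f x = 0" using z by simp
  qed (use fin in auto)
  have "u ` I \<subseteq> vs.span (q ` J)"
  proof
    fix x assume "x \<in> u ` I"
    then obtain i where i: "i \<in> I" "x = u i" by blast
    have "x = (\<Sum>j\<in>J. sc (P i j) (q j))"
    proof
      fix l
      show "x l = (\<Sum>j\<in>J. sc (P i j) (q j)) l"
        unfolding app using id[of i l] i by (cases "l \<in> I") (auto simp: u_def q_def sc_def)
    qed
    then show "x \<in> vs.span (q ` J)"
      by (simp add: vs.span_sum vs.span_scale vs.span_base)
  qed
  from vs.independent_span_bound[OF _ ind this]
  have "card (u ` I) \<le> card (q ` J)" using fin by simp
  also have "\<dots> \<le> card J" using fin card_image_le by blast
  finally show ?thesis using card_image[OF inj] by simp
qed

lemma surj_mat_right_inverse: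
  assumes "surj_mat I J T"
  obtains S where "\<And>l j. j \<in> J \<Longrightarrow> (\<Sum>i\<in>I. S l i * T i j) = (if l = j then 1 else 0)"
proof -
  have "\<forall>l. \<exists>f. \<forall>j\<in>J. (\<Sum>i\<in>I. f i * T i j) = (if l = j then 1 else 0)"
    using assms unfolding surj_mat_def by (intro allI) (erule allE)
  then show ?thesis using that by metis
qed

lemma surj_mat_if_quasi_inverse:
  fixes T :: "'i \<Rightarrow> 'j \<Rightarrow> 'k::field"
  assumes "finite J" "p \<noteq> 0"
    and S: "\<And>l j. l \<in> J \<Longrightarrow> j \<in> J \<Longrightarrow> (\<Sum>i\<in>I. S l i * T i j) = (if l = j then p else 0)"
  shows "surj_mat I J T"
  unfolding surj_mat_def
proof
  fix g :: "'j \<Rightarrow> 'k"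
  show "\<exists>f. \<forall>j\<in>J. (\<Sum>i\<in>I. f i * T i j) = g j"
  proof (intro exI ballI)
    fix j assume j: "j \<in> J"
    have "(\<Sum>i\<in>I. (\<Sum>l\<in>J. g l / p * S l i) * T i j) = (\<Sum>l\<in>J. g l / p * (\<Sum>i\<in>I. S l i * T i j))"
      unfolding sum_distrib_left sum_distrib_right by (subst sum.swap) (simp add: mult.assoc)
    also have "\<dots> = (\<Sum>l\<in>J. if l = j then g j else 0)"
      using j assms by (intro sum.cong) auto
    finally show "(\<Sum>i\<in>I. (\<Sum>l\<in>J. g l / p * S l i) * T i j) = g j"
      using j assms by simp
  qed
qed

lemma surj_mat_card:
  fixes T :: "'i \<Rightarrow> 'j \<Rightarrow> 'k::field"
  assumes "finite I" "finite J" "surj_mat I J T"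
  shows "card J \<le> card I"
proof -
  obtain S where "\<And>l j. j \<in> J \<Longrightarrow> (\<Sum>i\<in>I. S l i * T i j) = (if l = j then 1 else 0)"
    using surj_mat_right_inverse assms(3) by blast
  then show ?thesis using card_le_if_mat_identity[of J I S T] assms by simp
qed

text \<open>The map is taken on all functions and is injective only on those vanishing off
  \<open>I\<close>; a linear left inverse on that subspace, evaluated at the unit vectors of
  \<open>J\<close>, gives the rows of the inverse matrix.\<close>

lemma inj_mat_left_inverse:
  fixes T :: "'i \<Rightarrow> 'j \<Rightarrow> 'k::field"
  assumes fin: "finite I" "finite J" and inj: "inj_mat I J T"
  obtains S where "\<And>i l. i \<in> I \<Longrightarrow> l \<in> I \<Longrightarrow> (\<Sum>j\<in>J. T i j * S j l) = (if i = l then 1 else 0)"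
proof -
  define sI where "sI = (\<lambda>(c::'k) (f::'i \<Rightarrow> 'k). (\<lambda>i. c * f i))"
  define sJ where "sJ = (\<lambda>(c::'k) (f::'j \<Rightarrow> 'k). (\<lambda>i. c * f i))"
  interpret vI: vector_space sI
    by unfold_locales (auto simp: sI_def fun_eq_iff algebra_simps)
  interpret vJ: vector_space sJ
    by unfold_locales (auto simp: sJ_def fun_eq_iff algebra_simps)
  interpret vp: vector_space_pair sI sJ by unfold_locales
  define F where "F = (\<lambda>f j. if j \<in> J then \<Sum>i\<in>I. f i * T i j else 0)"
  have F: "Vector_Spaces.linear sI sJ F"
    unfolding Vector_Spaces.linear_def module_hom_def module_hom_axioms_def
    by (intro conjI allI vI.vector_space_axioms vJ.vector_space_axioms vI.module_axioms vJ.module_axioms)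
       (auto simp: F_def sI_def sJ_def fun_eq_iff sum.distrib algebra_simps sum_distrib_left)
  define V where "V = {f::'i \<Rightarrow> 'k. \<forall>i. i \<notin> I \<longrightarrow> f i = 0}"
  have V: "vI.subspace V" unfolding vI.subspace_def V_def by (simp add: sI_def)
  have "inj_on F V"
  proof (subst vp.linear_inj_on_iff_eq_0[OF F V], intro ballI impI)
    fix f assume f: "f \<in> V" "F f = 0"
    have "\<forall>j\<in>J. (\<Sum>i\<in>I. f i * T i j) = 0"
      using fun_cong[OF f(2)] unfolding F_def by (metis zero_fun_apply)
    then have "\<forall>i\<in>I. f i = 0" using inj unfolding inj_mat_def by blast
    then show "f = 0" using f(1) unfolding V_def by (auto simp: fun_eq_iff)
  qed
  from vp.linear_exists_left_inverse_on[OF F V this]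
  obtain g where g: "Vector_Spaces.linear sJ sI g" "\<And>v. v \<in> V \<Longrightarrow> g (F v) = v" by blast
  interpret g: Vector_Spaces.linear sJ sI g by fact
  define u where "u = (\<lambda>(j::'j) l. if l = j then (1::'k) else 0)"
  define w where "w = (\<lambda>(i::'i) l. if l = i then (1::'k) else 0)"
  have app: "(\<Sum>a\<in>A. f a) x = (\<Sum>a\<in>A. f a x)" for A :: "'c set" and f :: "'c \<Rightarrow> 'd \<Rightarrow> 'k" and x
    by (induct A rule: infinite_finite_induct) auto
  show ?thesis
  proof (rule that[of "\<lambda>j l. g (u j) l"])
    fix i l assume il: "i \<in> I" "l \<in> I"
    have "F (w i) = (\<Sum>j\<in>J. sJ (T i j) (u j))"
    proof
      fix j
      have "(\<Sum>j'\<in>J. sJ (T i j') (u j')) j = (\<Sum>j'\<in>J. if j' = j then T i j else 0)"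
        unfolding app by (intro sum.cong) (auto simp: sJ_def u_def)
      also have "\<dots> = (if j \<in> J then T i j else 0)" using fin by simp
      also have "\<dots> = F (w i) j"
      proof -
        have "(\<Sum>i'\<in>I. w i i' * T i' j) = (\<Sum>i'\<in>I. if i' = i then T i j else 0)"
          by (intro sum.cong) (auto simp: w_def)
        then show ?thesis using il fin by (simp add: F_def)
      qed
      finally show "F (w i) j = (\<Sum>j\<in>J. sJ (T i j) (u j)) j" by simp
    qed
    moreover have "w i \<in> V" using il by (auto simp: V_def w_def)
    ultimately have "w i = (\<Sum>j\<in>J. sI (T i j) (g (u j)))"
      using g(2)[of "w i"] by (simp add: g.sum g.scale)
    then have "w i l = (\<Sum>j\<in>J. T i j * g (u j) l)" by (simp add: app sI_def)
    then show "(\<Sum>j\<in>J. T i j * g (u j) l) = (if i = l then 1 else 0)"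
      by (simp add: w_def eq_commute)
  qed
qed

text \<open>A vector \<open>g\<close> outside the image can be adjoined to \<open>T\<close> as a
  further row \<open>None\<close> without losing injectivity, and then the number of rows would
  exceed \<open>card J\<close>.\<close>

lemma inj_mat_surj_mat:
  fixes T :: "'i \<Rightarrow> 'j \<Rightarrow> 'k::field"
  assumes fin: "finite I" "finite J" and inj: "inj_mat I J T" and card: "card J \<le> card I"
  shows "surj_mat I J T"
proof (rule ccontr)
  assume "\<not> surj_mat I J T"
  then obtain g where g: "\<And>f. \<exists>j\<in>J. (\<Sum>i\<in>I. f i * T i j) \<noteq> g j"
    unfolding surj_mat_def by blast
  define T' where "T' = (\<lambda>i j. case i of None \<Rightarrow> g j | Some i \<Rightarrow> T i j)"
  have fin': "finite (insert None (Some ` I))" using fin by simp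
  have sm: "(\<Sum>i\<in>insert None (Some ` I). f i * T' i j) = f None * g j + (\<Sum>i\<in>I. f (Some i) * T i j)"
    for f j using fin by (simp add: T'_def sum.reindex)
  have "inj_mat (insert None (Some ` I)) J T'"
    unfolding inj_mat_def
  proof (intro allI impI)
    fix f assume z: "\<forall>j\<in>J. (\<Sum>i\<in>insert None (Some ` I). f i * T' i j) = 0"
    have N: "f None = 0"
    proof (rule ccontr)
      assume nz: "f None \<noteq> 0"
      have "\<forall>j\<in>J. (\<Sum>i\<in>I. (- f (Some i) / f None) * T i j) = g j"
      proof
        fix j assume "j \<in> J"
        then have "f None * g j = - (\<Sum>i\<in>I. f (Some i) * T i j)"
          using z unfolding sm by (simp add: eq_neg_iff_add_eq_0)
        moreover have "(\<Sum>i\<in>I. (- f (Some i) / f None) * T i j) = - (\<Sum>i\<in>I. f (Some i) * T i j) / f None"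
          by (simp add: sum_negf sum_divide_distrib)
        ultimately show "(\<Sum>i\<in>I. (- f (Some i) / f None) * T i j) = g j"
          using nz by (metis nonzero_mult_div_cancel_left)
      qed
      then show False using g by metis
    qed
    then have "\<forall>j\<in>J. (\<Sum>i\<in>I. f (Some i) * T i j) = 0" using z unfolding sm by simp
    then have "\<forall>i\<in>I. f (Some i) = 0"
      using inj[unfolded inj_mat_def, rule_format, of "\<lambda>i. f (Some i)"] by blast
    then show "\<forall>i\<in>insert None (Some ` I). f i = 0" using N by auto
  qed
  from inj_mat_left_inverse[OF fin' fin(2) this] obtain S where
    "\<And>i l. i \<in> insert None (Some ` I) \<Longrightarrow> l \<in> insert None (Some ` I) \<Longrightarrow>
       (\<Sum>j\<in>J. T' i j * S j l) = (if i = l then 1 else 0)" by blast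
  from card_le_if_mat_identity[OF fin' fin(2) this]
  have "card (insert None (Some ` I)) \<le> card J" .
  then show False using card fin by (simp add: card_image)
qed

section \<open>Rank conditions for matrices over k[t] and k[[t]]\<close>

lemma comm_ring_hom_poly_eval: "comm_ring_hom (\<lambda>p::'a::comm_ring_1 poly. poly p t)"
  by unfold_locales auto

lemma comm_ring_hom_fps_nth_0: "comm_ring_hom (\<lambda>p::'a::comm_ring_1 fps. fps_nth p 0)"
  by unfold_locales auto

text \<open>A right inverse \<open>B\<close> of the specialised matrix has constant entries;
  \<open>B\<close> times \<open>T\<close> is a square polynomial matrix equal to the identity at
  \<open>t\<close>, so its determinant \<open>p\<close> has value 1 there and its adjugate times
  \<open>B\<close> is the quasi-inverse.\<close>

lemma surj_mat_quasi_inverse_poly: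
  fixes T :: "'i \<Rightarrow> 'j \<Rightarrow> 'k::field poly"
  assumes fin: "finite J" and surj: "surj_mat I J (\<lambda>i j. poly (T i j) t)"
  shows "\<exists>S p. poly p t = 1 \<and>
    (\<forall>l\<in>J. \<forall>j\<in>J. (\<Sum>i\<in>I. S l i * T i j) = (if l = j then p else 0))"
proof -
  obtain B where B: "\<And>l j. j \<in> J \<Longrightarrow> (\<Sum>i\<in>I. B l i * poly (T i j) t) = (if l = j then 1 else 0)"
    using surj_mat_right_inverse[OF surj] by blast
  define A where "A = (\<lambda>l j. \<Sum>i\<in>I. [:B l i:] * T i j)"
  obtain S p where Sp: "(\<forall>i\<in>J. \<forall>l\<in>J. (\<Sum>j\<in>J. A i j * S j l) = (if i = l then p else 0)) \<and>
    (\<forall>i\<in>J. \<forall>l\<in>J. (\<Sum>j\<in>J. S i j * A j l) = (if i = l then p else 0)) \<and>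
    (\<forall>h :: 'k poly \<Rightarrow> 'k. comm_ring_hom h \<longrightarrow>
       (\<forall>i\<in>J. \<forall>l\<in>J. h (A i l) = (if i = l then 1 else 0)) \<longrightarrow> h p = 1)"
    using adjugate_on[OF fin, of A] by blast
  have "poly p t = 1"
    by (rule Sp[THEN conjunct2, THEN conjunct2, rule_format, OF comm_ring_hom_poly_eval])
       (use B in \<open>auto simp: A_def poly_sum mult.commute\<close>)
  moreover have "(\<Sum>i\<in>I. (\<Sum>m\<in>J. S l m * [:B m i:]) * T i j) = (if l = j then p else 0)"
    if "l \<in> J" "j \<in> J" for l j
  proof -
    have "(\<Sum>i\<in>I. (\<Sum>m\<in>J. S l m * [:B m i:]) * T i j) = (\<Sum>m\<in>J. S l m * A m j)"
      unfolding A_def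
      unfolding sum_distrib_left sum_distrib_right by (subst sum.swap) (simp add: mult.assoc)
    then show ?thesis using Sp that by simp
  qed
  ultimately show ?thesis
    by (intro exI[of _ "\<lambda>l i. \<Sum>m\<in>J. S l m * [:B m i:]"] exI[of _ p]) simp
qed

text \<open>Wherever the polynomial \<open>p\<close> of the quasi-inverse does not vanish, dividing
  by it gives surjectivity, and \<open>p\<close> has finitely many roots.\<close>

lemma surj_mat_open:
  fixes T :: "'i \<Rightarrow> 'j \<Rightarrow> 'k::field poly"
  assumes fin: "finite J" and surj: "surj_mat I J (\<lambda>i j. poly (T i j) t)"
  shows "finite {t. \<not> surj_mat I J (\<lambda>i j. poly (T i j) t)}"
proof -
  obtain S p where p: "poly p t = 1"
    and S: "\<forall>l\<in>J. \<forall>j\<in>J. (\<Sum>i\<in>I. S l i * T i j) = (if l = j then p else 0)"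
    using surj_mat_quasi_inverse_poly[OF assms] by blast
  have "{t. \<not> surj_mat I J (\<lambda>i j. poly (T i j) t)} \<subseteq> {t. poly p t = 0}"
  proof
    fix s assume s: "s \<in> {t. \<not> surj_mat I J (\<lambda>i j. poly (T i j) t)}"
    show "s \<in> {t. poly p t = 0}"
    proof (rule ccontr)
      assume "s \<notin> {t. poly p t = 0}"
      then have nz: "poly p s \<noteq> 0" by simp
      have "surj_mat I J (\<lambda>i j. poly (T i j) s)"
      proof (rule surj_mat_if_quasi_inverse[OF fin nz])
        fix l j assume "l \<in> J" "j \<in> J"
        from arg_cong[OF S[rule_format, OF this], of "\<lambda>q. poly q s"]
        show "(\<Sum>i\<in>I. poly (S l i) s * poly (T i j) s) = (if l = j then poly p s else 0)"
          by (simp add: poly_sum split: if_splits)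
      qed
      then show False using s by simp
    qed
  qed
  moreover have "p \<noteq> 0" using p by auto
  ultimately show ?thesis using poly_roots_finite finite_subset by blast
qed

text \<open>Here \<open>T\<close> is multiplied on the right by an inverse \<open>B\<close> of its
  value at \<open>t\<close>. A row killed by \<open>T\<close> at \<open>s\<close> is killed by that
  square product, hence, after the adjugate, by \<open>poly p s\<close>.\<close>

lemma inj_mat_open:
  fixes T :: "'i \<Rightarrow> 'j \<Rightarrow> 'k::field poly"
  assumes fin: "finite I" "finite J" and inj: "inj_mat I J (\<lambda>i j. poly (T i j) t)"
  shows "finite {t. \<not> inj_mat I J (\<lambda>i j. poly (T i j) t)}"
proof -
  obtain B where B: "\<And>i l. i \<in> I \<Longrightarrow> l \<in> I \<Longrightarrow> (\<Sum>j\<in>J. poly (T i j) t * B j l) = (if i = l then 1 else 0)"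
    using inj_mat_left_inverse[OF fin inj] by blast
  define A where "A = (\<lambda>i l. \<Sum>j\<in>J. T i j * [:B j l:])"
  obtain S p where Sp: "(\<forall>i\<in>I. \<forall>l\<in>I. (\<Sum>j\<in>I. A i j * S j l) = (if i = l then p else 0)) \<and>
    (\<forall>i\<in>I. \<forall>l\<in>I. (\<Sum>j\<in>I. S i j * A j l) = (if i = l then p else 0)) \<and>
    (\<forall>h :: 'k poly \<Rightarrow> 'k. comm_ring_hom h \<longrightarrow>
       (\<forall>i\<in>I. \<forall>l\<in>I. h (A i l) = (if i = l then 1 else 0)) \<longrightarrow> h p = 1)"
    using adjugate_on[OF fin(1), of A] by blast
  have p1: "poly p t = 1"
    by (rule Sp[THEN conjunct2, THEN conjunct2, rule_format, OF comm_ring_hom_poly_eval])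
       (use B in \<open>auto simp: A_def poly_sum mult.commute\<close>)
  have "{t. \<not> inj_mat I J (\<lambda>i j. poly (T i j) t)} \<subseteq> {t. poly p t = 0}"
  proof
    fix s assume "s \<in> {t. \<not> inj_mat I J (\<lambda>i j. poly (T i j) t)}"
    then obtain f i0 where f: "\<And>j. j \<in> J \<Longrightarrow> (\<Sum>i\<in>I. f i * poly (T i j) s) = 0" and i0: "i0 \<in> I" "f i0 \<noteq> 0"
      unfolding inj_mat_def by blast
    have fA: "(\<Sum>i\<in>I. f i * poly (A i l) s) = 0" for l
    proof -
      have "(\<Sum>i\<in>I. f i * poly (A i l) s) = (\<Sum>j\<in>J. (\<Sum>i\<in>I. f i * poly (T i j) s) * B j l)"
        unfolding A_def
        unfolding poly_sum sum_distrib_left sum_distrib_right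
        by (subst sum.swap) (simp add: ac_simps)
      then show ?thesis using f by simp
    qed
    have "(\<Sum>l\<in>I. (\<Sum>i\<in>I. f i * poly (A i l) s) * poly (S l i0) s)
        = (\<Sum>i\<in>I. f i * poly (\<Sum>l\<in>I. A i l * S l i0) s)"
      unfolding poly_sum sum_distrib_left sum_distrib_right
      by (subst sum.swap) (simp add: mult.assoc)
    also have "\<dots> = (\<Sum>i\<in>I. if i = i0 then f i0 * poly p s else 0)"
      using Sp i0 by (intro sum.cong) auto
    also have "\<dots> = f i0 * poly p s" using fin i0 by simp
    finally show "s \<in> {t. poly p t = 0}" using fA i0 by simp
  qed
  moreover have "p \<noteq> 0" using p1 by auto
  ultimately show ?thesis using poly_roots_finite finite_subset by blast
qed

lemma fps_eq_X_power_times_unit: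
  fixes p :: "'k::field fps"
  assumes "p \<noteq> 0"
  obtains m u where "p = fps_X ^ m * u" "fps_nth u 0 \<noteq> 0"
proof (rule that)
  show "p = fps_X ^ subdegree p * fps_shift (subdegree p) p"
    using subdegree_decompose[of p] by (simp add: mult.commute)
  show "fps_nth (fps_shift (subdegree p) p) 0 \<noteq> 0"
    using assms by simp
qed

definition trunc_poly :: "nat \<Rightarrow> 'a::comm_ring_1 fps \<Rightarrow> 'a poly" where
  "trunc_poly N f = (\<Sum>n<N. monom (fps_nth f n) n)"

lemma coeff_trunc_poly: "coeff (trunc_poly N f) m = (if m < N then fps_nth f m else 0)"
  unfolding trunc_poly_def coeff_sum by (auto simp: coeff_monom)

text \<open>Over \<open>k[[t]]\<close> a quasi-inverse survives truncation: modulo \<open>t\<^sup>m\<^sup>+\<^sup>1\<close> the product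
  with the truncated inverse is \<open>t\<^sup>m\<close> times a matrix that is the identity at \<open>t = 0\<close>.\<close>

lemma surj_mat_truncate:
  fixes T :: "'i \<Rightarrow> 'j \<Rightarrow> 'k::field fps"
  assumes fin: "finite I" "finite J" and p: "p \<noteq> 0"
    and S: "\<And>l j. l \<in> J \<Longrightarrow> j \<in> J \<Longrightarrow> (\<Sum>i\<in>I. S l i * T i j) = (if l = j then p else 0)"
  shows "\<exists>N. \<forall>T'. (\<forall>i\<in>I. \<forall>j\<in>J. \<forall>m<N. coeff (T' i j) m = fps_nth (T i j) m) \<longrightarrow>
    finite {t. \<not> surj_mat I J (\<lambda>i j. poly (T' i j) t)}"
proof -
  obtain m u where u: "p = fps_X ^ m * u" "fps_nth u 0 \<noteq> 0"
    using fps_eq_X_power_times_unit[OF p] by blast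
  \<comment> \<open>Removing the unit \<open>u\<close> from \<open>p\<close> makes the quasi-inverse
    one with exactly \<open>t^m\<close> on the diagonal.\<close>
  define R where "R = (\<lambda>l i. inverse u * S l i)"
  have R: "(\<Sum>i\<in>I. R l i * T i j) = (if l = j then fps_X ^ m else 0)" if "l \<in> J" "j \<in> J" for l j
  proof -
    have "(\<Sum>i\<in>I. R l i * T i j) = inverse u * (\<Sum>i\<in>I. S l i * T i j)"
      by (simp add: R_def sum_distrib_left mult.assoc)
    then show ?thesis
      using S[OF that] u inverse_mult_eq_1[OF u(2)] by (auto simp: algebra_simps)
  qed
  show ?thesis
  \<comment> \<open>Coefficients up to and including \<open>t^m\<close> are kept, because the
    coefficient at \<open>t^m\<close> of the product is the one that has to be the identity.\<close>
  proof (intro exI[of _ "Suc m"] allI impI)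
    fix T' :: "'i \<Rightarrow> 'j \<Rightarrow> 'k poly"
    assume T': "\<forall>i\<in>I. \<forall>j\<in>J. \<forall>m'<Suc m. coeff (T' i j) m' = fps_nth (T i j) m'"
    define R' where "R' = (\<lambda>l i. trunc_poly (Suc m) (R l i))"
    have R': "coeff (R' l i) m' = fps_nth (R l i) m'" if "m' < Suc m" for l i m'
      using that unfolding R'_def by (simp add: coeff_trunc_poly)
    define C where "C = (\<lambda>l j. \<Sum>i\<in>I. R' l i * T' i j)"
    have C: "coeff (C l j) m' = (if l = j \<and> m' = m then 1 else 0)" if "l \<in> J" "j \<in> J" "m' < Suc m" for l j m'
    proof -
      have "coeff (C l j) m' = fps_nth (\<Sum>i\<in>I. R l i * T i j) m'"
        unfolding C_def coeff_sum fps_sum_nth coeff_mult fps_mult_nth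
        using that R' T' by (intro sum.cong) (auto simp: atMost_atLeast0)
      then show ?thesis using R[OF that(1,2)] that(3) by auto
    qed
    define A where "A = (\<lambda>l j. poly_shift m (C l j))"
    have CA: "C l j = monom 1 m * A l j" if "l \<in> J" "j \<in> J" for l j
      using C[OF that] unfolding A_def
      by (intro poly_eqI) (auto simp: coeff_monom_mult coeff_poly_shift)
    have "surj_mat J J (\<lambda>l j. poly (A l j) 0)"
    proof (rule surj_mat_if_quasi_inverse[where p=1 and S="\<lambda>l i. if l = i then 1 else 0"])
      fix l j assume "l \<in> J" "j \<in> J"
      then show "(\<Sum>i\<in>J. (if l = i then 1 else 0) * poly (A i j) 0) = (if l = j then 1 else 0)"
        using C[of l j m] fin by (simp add: A_def poly_0_coeff_0 coeff_poly_shift if_distrib[of "\<lambda>x. x * _"] cong: if_cong)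
    qed (use fin in auto)
    \<comment> \<open>\<open>t = 0\<close> is discarded as well, since surjectivity is recovered
      from \<open>C = t^m A\<close> by dividing by \<open>t^m\<close>.\<close>
    from surj_mat_open[OF fin(2) this]
    have *: "finite ({0} \<union> {t. \<not> surj_mat J J (\<lambda>i j. poly (A i j) t)})" by simp
    show "finite {t. \<not> surj_mat I J (\<lambda>i j. poly (T' i j) t)}"
    proof (rule finite_subset[OF _ *], rule subsetI, rule ccontr)
      fix t assume t: "t \<in> {t. \<not> surj_mat I J (\<lambda>i j. poly (T' i j) t)}"
        "t \<notin> {0} \<union> {t. \<not> surj_mat J J (\<lambda>i j. poly (A i j) t)}"
      then have A: "surj_mat J J (\<lambda>i j. poly (A i j) t)" and t0: "t \<noteq> 0" by auto
      obtain B where B: "\<And>l j. j \<in> J \<Longrightarrow> (\<Sum>i\<in>J. B l i * poly (A i j) t) = (if l = j then 1 else 0)"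
        using surj_mat_right_inverse[OF A] by blast
      have "surj_mat I J (\<lambda>i j. poly (T' i j) t)"
      proof (rule surj_mat_if_quasi_inverse[OF fin(2), where p="t ^ m" and S="\<lambda>l i. \<Sum>x\<in>J. B l x * poly (R' x i) t"])
        show "t ^ m \<noteq> 0" using t0 by simp
        fix l j assume lj: "l \<in> J" "j \<in> J"
        have "(\<Sum>i\<in>I. (\<Sum>x\<in>J. B l x * poly (R' x i) t) * poly (T' i j) t)
            = (\<Sum>x\<in>J. B l x * poly (C x j) t)"
          unfolding C_def poly_sum sum_distrib_left sum_distrib_right
          by (subst sum.swap) (simp add: ac_simps)
        also have "\<dots> = (\<Sum>x\<in>J. B l x * poly (A x j) t) * t ^ m"
          unfolding sum_distrib_right using lj CA by (intro sum.cong) (auto simp: poly_monom)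
        finally show "(\<Sum>i\<in>I. (\<Sum>x\<in>J. B l x * poly (R' x i) t) * poly (T' i j) t) = (if l = j then t ^ m else 0)"
          using B lj by simp
      qed
      then show False using t by simp
    qed
  qed
qed

section \<open>Ringel's map over commutative rings\<close>

type_synonym 'a fam = "nat \<Rightarrow> nat \<Rightarrow> nat \<Rightarrow> 'a"

definition arrow_idx :: "quiver \<Rightarrow> (nat \<Rightarrow> nat) \<Rightarrow> (nat \<Rightarrow> nat) \<Rightarrow> (nat \<times> nat \<times> nat) set" where
  "arrow_idx Q d e = {(a, r, c). a < length Q \<and> r < e (snd (Q ! a)) \<and> c < d (fst (Q ! a))}"

definition vertex_idx :: "nat \<Rightarrow> (nat \<Rightarrow> nat) \<Rightarrow> (nat \<Rightarrow> nat) \<Rightarrow> (nat \<times> nat \<times> nat) set" where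
  "vertex_idx n d e = {(i, r, c). i < n \<and> r < e i \<and> c < d i}"

definition supported :: "(nat \<times> nat \<times> nat) set \<Rightarrow> 'a::zero fam \<Rightarrow> bool" where
  "supported I \<phi> \<longleftrightarrow> (\<forall>i r c. \<phi> i r c \<noteq> 0 \<longrightarrow> (i, r, c) \<in> I)"

lemma arrow_idx_Sigma:
  "arrow_idx Q d e = (SIGMA a:{..<length Q}. {..<e (snd (Q ! a))} \<times> {..<d (fst (Q ! a))})"
  unfolding arrow_idx_def by auto

lemma vertex_idx_Sigma: "vertex_idx n d e = (SIGMA i:{..<n}. {..<e i} \<times> {..<d i})"
  unfolding vertex_idx_def by auto

lemma finite_arrow_idx [simp]: "finite (arrow_idx Q d e)"
  unfolding arrow_idx_Sigma by auto

lemma finite_vertex_idx [simp]: "finite (vertex_idx n d e)"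
  unfolding vertex_idx_Sigma by auto

lemma card_arrow_idx: "card (arrow_idx Q d e) = (\<Sum>a<length Q. d (fst (Q ! a)) * e (snd (Q ! a)))"
  unfolding arrow_idx_Sigma by (simp add: card_cartesian_product mult.commute)

lemma card_vertex_idx: "card (vertex_idx n d e) = (\<Sum>i<n. d i * e i)"
  unfolding vertex_idx_Sigma by (simp add: card_cartesian_product mult.commute)

lemma supported_zero: "supported I \<phi> \<Longrightarrow> (i, r, c) \<notin> I \<Longrightarrow> \<phi> i r c = 0"
  unfolding supported_def by blast

lemma is_rep_iff_supported: "is_rep Q d M \<longleftrightarrow> supported (arrow_idx Q d d) M"
  unfolding is_rep_def supported_def arrow_idx_def by auto

lemma vertex_maps_eq: "vertex_maps n d e = {\<phi>. supported (vertex_idx n d e) \<phi>}"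
  unfolding vertex_maps_def supported_def vertex_idx_def by auto

definition rdelta :: "quiver \<Rightarrow> (nat \<Rightarrow> nat) \<Rightarrow> (nat \<Rightarrow> nat) \<Rightarrow> 'a::comm_ring_1 fam \<Rightarrow> 'a fam \<Rightarrow> 'a fam \<Rightarrow> 'a fam" where
  "rdelta Q d e M N \<phi> = (\<lambda>a r c.
     if a < length Q \<and> r < e (snd (Q!a)) \<and> c < d (fst (Q!a)) then
       (\<Sum>j<e (fst (Q!a)). N a r j * \<phi> (fst (Q!a)) j c)
       - (\<Sum>j<d (snd (Q!a)). \<phi> (snd (Q!a)) r j * M a j c)
     else 0)"

lemma delta_eq_rdelta: "delta Q d e M N \<phi> = rdelta Q d e M N \<phi>"
  unfolding delta_def rdelta_def ..

lemma supported_rdelta: "supported (arrow_idx Q d e) (rdelta Q d e M N \<phi>)"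
  unfolding supported_def arrow_idx_def rdelta_def by auto

definition unit_fam :: "nat \<times> nat \<times> nat \<Rightarrow> 'a::zero_neq_one fam" where
  "unit_fam x = (\<lambda>i r c. if (i, r, c) = x then 1 else 0)"

lemma supported_unit_fam: "x \<in> I \<Longrightarrow> supported I (unit_fam x)"
  unfolding supported_def unit_fam_def by auto

text \<open>Rows are indexed by the basis of the source, in keeping with the convention that row
  vectors act on the left.\<close>

definition rdelta_mat :: "quiver \<Rightarrow> (nat \<Rightarrow> nat) \<Rightarrow> (nat \<Rightarrow> nat) \<Rightarrow> 'a::comm_ring_1 fam \<Rightarrow> 'a fam \<Rightarrow>
    nat \<times> nat \<times> nat \<Rightarrow> nat \<times> nat \<times> nat \<Rightarrow> 'a" where
  "rdelta_mat Q d e M N x y = rdelta Q d e M N (unit_fam x) (fst y) (fst (snd y)) (snd (snd y))"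

lemma rdelta_sum:
  "rdelta Q d e M N (\<lambda>i r c. \<Sum>x\<in>I. f x * \<phi> x i r c) =
   (\<lambda>a r c. \<Sum>x\<in>I. f x * rdelta Q d e M N (\<phi> x) a r c)"
proof (intro ext)
  fix a r c
  have 1: "(\<Sum>j<e (fst (Q!a)). N a r j * (\<Sum>x\<in>I. f x * \<phi> x (fst (Q!a)) j c))
      = (\<Sum>x\<in>I. f x * (\<Sum>j<e (fst (Q!a)). N a r j * \<phi> x (fst (Q!a)) j c))"
    unfolding sum_distrib_left by (subst sum.swap) (simp add: ac_simps)
  have 2: "(\<Sum>j<d (snd (Q!a)). (\<Sum>x\<in>I. f x * \<phi> x (snd (Q!a)) r j) * M a j c)
      = (\<Sum>x\<in>I. f x * (\<Sum>j<d (snd (Q!a)). \<phi> x (snd (Q!a)) r j * M a j c))"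
    unfolding sum_distrib_left sum_distrib_right by (subst sum.swap) (simp add: ac_simps)
  show "rdelta Q d e M N (\<lambda>i r c. \<Sum>x\<in>I. f x * \<phi> x i r c) a r c =
     (\<Sum>x\<in>I. f x * rdelta Q d e M N (\<phi> x) a r c)"
    unfolding rdelta_def by (auto simp: 1 2 sum_subtractf right_diff_distrib)
qed

lemma rdelta_add: "rdelta Q d e M N (\<lambda>i r c. \<phi> i r c + \<psi> i r c) =
   (\<lambda>a r c. rdelta Q d e M N \<phi> a r c + rdelta Q d e M N \<psi> a r c)"
  unfolding rdelta_def by (auto simp: fun_eq_iff sum.distrib algebra_simps)

lemma rdelta_diff: "rdelta Q d e M N (\<lambda>i r c. \<phi> i r c - \<psi> i r c) =
   (\<lambda>a r c. rdelta Q d e M N \<phi> a r c - rdelta Q d e M N \<psi> a r c)"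
  unfolding rdelta_def by (auto simp: fun_eq_iff sum_subtractf algebra_simps)

lemma rdelta_scale: "rdelta Q d e M N (\<lambda>i r c. p * \<phi> i r c) = (\<lambda>a r c. p * rdelta Q d e M N \<phi> a r c)"
  unfolding rdelta_def by (auto simp: fun_eq_iff sum_distrib_left algebra_simps)

lemma sum_unit_fam:
  assumes "finite I" "supported I \<phi>"
  shows "(\<lambda>i r c. \<Sum>x\<in>I. \<phi> (fst x) (fst (snd x)) (snd (snd x)) * unit_fam x i r c) = (\<phi> :: 'a::comm_ring_1 fam)"
proof (intro ext)
  fix i r c
  have "(\<Sum>x\<in>I. \<phi> (fst x) (fst (snd x)) (snd (snd x)) * unit_fam x i r c) =
    (\<Sum>x\<in>I. if x = (i, r, c) then \<phi> i r c else 0)"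
    by (intro sum.cong) (auto simp: unit_fam_def)
  then show "(\<Sum>x\<in>I. \<phi> (fst x) (fst (snd x)) (snd (snd x)) * unit_fam x i r c) = \<phi> i r c"
    using assms supported_zero[OF assms(2), of i r c] by auto
qed

lemma rdelta_expand:
  assumes "supported (vertex_idx n d e) \<phi>"
  shows "rdelta Q d e M N \<phi> a r c =
    (\<Sum>x\<in>vertex_idx n d e. \<phi> (fst x) (fst (snd x)) (snd (snd x)) * rdelta_mat Q d e M N x (a, r, c))"
  unfolding rdelta_mat_def
  using fun_cong[OF fun_cong[OF fun_cong[OF rdelta_sum[where I="vertex_idx n d e"
        and f="\<lambda>x. \<phi> (fst x) (fst (snd x)) (snd (snd x))" and \<phi>=unit_fam]]], of Q d e M N a r c]
  unfolding sum_unit_fam[OF finite_vertex_idx assms] by simp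

text \<open>The cokernel of \<open>rdelta\<close> is annihilated by \<open>p\<close>. For
  \<open>p = 1\<close> this is the vanishing of Ext^1; over k[t] or k[[t]] a nonzero
  \<open>p\<close> says that Ext^1 vanishes generically, and this weaker form survives the changes
  of ring.\<close>

definition quasi_surj :: "nat \<Rightarrow> quiver \<Rightarrow> (nat \<Rightarrow> nat) \<Rightarrow> (nat \<Rightarrow> nat) \<Rightarrow> 'a::comm_ring_1 \<Rightarrow> 'a fam \<Rightarrow> 'a fam \<Rightarrow> bool" where
  "quasi_surj n Q d e p M N \<longleftrightarrow> (\<forall>\<eta>. supported (arrow_idx Q d e) \<eta> \<longrightarrow>
     (\<exists>\<phi>. supported (vertex_idx n d e) \<phi> \<and> rdelta Q d e M N \<phi> = (\<lambda>a r c. p * \<eta> a r c)))"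

abbreviation ext_zero :: "nat \<Rightarrow> quiver \<Rightarrow> (nat \<Rightarrow> nat) \<Rightarrow> (nat \<Rightarrow> nat) \<Rightarrow> 'a::comm_ring_1 fam \<Rightarrow> 'a fam \<Rightarrow> bool" where
  "ext_zero n Q d e M N \<equiv> quasi_surj n Q d e 1 M N"

text \<open>Row \<open>l\<close> of \<open>S\<close> is a preimage of \<open>p\<close> times the
  unit family \<open>l\<close>; by linearity these suffice.\<close>

lemma quasi_surj_iff:
  "quasi_surj n Q d e p M N \<longleftrightarrow> (\<exists>S. \<forall>l\<in>arrow_idx Q d e. \<forall>j\<in>arrow_idx Q d e.
     (\<Sum>i\<in>vertex_idx n d e. S l i * rdelta_mat Q d e M N i j) = (if l = j then p else 0))"
proof
  assume L: "quasi_surj n Q d e p M N"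
  let ?J = "arrow_idx Q d e" and ?I = "vertex_idx n d e"
  have "\<forall>l\<in>?J. \<exists>\<phi>. supported ?I \<phi> \<and> rdelta Q d e M N \<phi> = (\<lambda>a r c. p * unit_fam l a r c)"
    using L unfolding quasi_surj_def using supported_unit_fam by blast
  then obtain \<Phi> where \<Phi>: "\<And>l. l \<in> ?J \<Longrightarrow> supported ?I (\<Phi> l)"
    "\<And>l. l \<in> ?J \<Longrightarrow> rdelta Q d e M N (\<Phi> l) = (\<lambda>a r c. p * unit_fam l a r c)" by metis
  show "\<exists>S. \<forall>l\<in>?J. \<forall>j\<in>?J. (\<Sum>i\<in>?I. S l i * rdelta_mat Q d e M N i j) = (if l = j then p else 0)"
  proof (intro exI[of _ "\<lambda>l x. \<Phi> l (fst x) (fst (snd x)) (snd (snd x))"] ballI)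
    fix l j assume lj: "l \<in> ?J" "j \<in> ?J"
    obtain a r c where j: "j = (a, r, c)" by (cases j) auto
    show "(\<Sum>x\<in>?I. \<Phi> l (fst x) (fst (snd x)) (snd (snd x)) * rdelta_mat Q d e M N x j) = (if l = j then p else 0)"
      using rdelta_expand[OF \<Phi>(1)[OF lj(1)], where Q=Q and M=M and N=N and a=a and r=r and c=c] \<Phi>(2)[OF lj(1)]
      unfolding j by (auto simp: unit_fam_def)
  qed
next
  let ?J = "arrow_idx Q d e" and ?I = "vertex_idx n d e"
  assume "\<exists>S. \<forall>l\<in>?J. \<forall>j\<in>?J. (\<Sum>i\<in>?I. S l i * rdelta_mat Q d e M N i j) = (if l = j then p else 0)"
  then obtain S where S: "\<And>l j. l \<in> ?J \<Longrightarrow> j \<in> ?J \<Longrightarrow> (\<Sum>i\<in>?I. S l i * rdelta_mat Q d e M N i j) = (if l = j then p else 0)"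
    by blast
  show "quasi_surj n Q d e p M N" unfolding quasi_surj_def
  proof (intro allI impI)
    fix \<eta> :: "'a fam" assume \<eta>: "supported ?J \<eta>"
    define \<phi> where "\<phi> = (\<lambda>i r c. if (i,r,c) \<in> ?I then
        \<Sum>l\<in>?J. \<eta> (fst l) (fst (snd l)) (snd (snd l)) * S l (i,r,c) else 0)"
    have supp: "supported ?I \<phi>" unfolding supported_def \<phi>_def by auto
    have "rdelta Q d e M N \<phi> a r c = p * \<eta> a r c" for a r c
    proof (cases "(a, r, c) \<in> ?J")
      case True
      have "rdelta Q d e M N \<phi> a r c = (\<Sum>x\<in>?I. (\<Sum>l\<in>?J. \<eta> (fst l) (fst (snd l)) (snd (snd l)) * S l x)
          * rdelta_mat Q d e M N x (a, r, c))"
        unfolding rdelta_expand[OF supp] by (intro sum.cong) (auto simp: \<phi>_def)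
      also have "\<dots> = (\<Sum>l\<in>?J. \<eta> (fst l) (fst (snd l)) (snd (snd l)) * (\<Sum>x\<in>?I. S l x * rdelta_mat Q d e M N x (a,r,c)))"
        unfolding sum_distrib_left sum_distrib_right by (subst sum.swap) (simp add: ac_simps)
      also have "\<dots> = (\<Sum>l\<in>?J. if l = (a,r,c) then \<eta> a r c * p else 0)"
        using S True by (intro sum.cong) auto
      also have "\<dots> = p * \<eta> a r c" using True by simp
      finally show ?thesis .
    next
      case False
      then show ?thesis
        using supported_zero[OF \<eta>] supported_zero[OF supported_rdelta[of Q d e M N \<phi>]] by simp
    qed
    then show "\<exists>\<phi>. supported ?I \<phi> \<and> rdelta Q d e M N \<phi> = (\<lambda>a r c. p * \<eta> a r c)"
      using supp by blast
  qed
qed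

lemma ext_zero_iff_surj_mat:
  fixes M N :: "'k::field fam"
  shows "ext_zero n Q d e M N \<longleftrightarrow> surj_mat (vertex_idx n d e) (arrow_idx Q d e) (rdelta_mat Q d e M N)"
proof
  assume "ext_zero n Q d e M N"
  then obtain S where S: "\<forall>l\<in>arrow_idx Q d e. \<forall>j\<in>arrow_idx Q d e.
     (\<Sum>i\<in>vertex_idx n d e. S l i * rdelta_mat Q d e M N i j) = (if l = j then 1 else 0)"
    unfolding quasi_surj_iff by blast
  show "surj_mat (vertex_idx n d e) (arrow_idx Q d e) (rdelta_mat Q d e M N)"
    by (rule surj_mat_if_quasi_inverse[where p=1 and S=S]) (use S in auto)
next
  assume "surj_mat (vertex_idx n d e) (arrow_idx Q d e) (rdelta_mat Q d e M N)"
  then obtain S where "\<And>l j. j \<in> arrow_idx Q d e \<Longrightarrow>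
     (\<Sum>i\<in>vertex_idx n d e. S l i * rdelta_mat Q d e M N i j) = (if l = j then 1 else 0)"
    using surj_mat_right_inverse by blast
  then show "ext_zero n Q d e M N" unfolding quasi_surj_iff by blast
qed

lemma rdelta_mat_hom:
  assumes "comm_ring_hom h"
  shows "rdelta_mat Q d e (\<lambda>a r c. h (M a r c)) (\<lambda>a r c. h (N a r c)) x y = h (rdelta_mat Q d e M N x y)"
proof -
  interpret comm_ring_hom h by fact
  have u: "unit_fam x i r c = h (unit_fam x i r c)" for i r c unfolding unit_fam_def by simp
  show ?thesis unfolding rdelta_mat_def rdelta_def
    by (subst (1 2) u) (simp add: hom_distribs)
qed

section \<open>Vanishing of Ext^1 as surjectivity\<close>

interpretation fam_space: vector_space "scl :: 'k::field \<Rightarrow> 'k fam \<Rightarrow> 'k fam"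
  by unfold_locales (auto simp: scl_def fun_eq_iff algebra_simps)

lemma fam_sum_apply: "(\<Sum>x\<in>A. f x) i r c = (\<Sum>x\<in>A. (f x :: 'a::comm_monoid_add fam) i r c)"
  by (induct A rule: infinite_finite_induct) auto

lemma inj_unit_fam: "inj_on (unit_fam :: _ \<Rightarrow> 'k::field fam) J"
  unfolding inj_on_def unit_fam_def
  by (metis (mono_tags, lifting) prod_cases3 zero_neq_one)

lemma independent_unit_fam:
  assumes "finite J"
  shows "fam_space.independent ((unit_fam :: _ \<Rightarrow> 'k::field fam) ` J)"
proof (rule fam_space.independent_if_scalars_zero)
  fix f :: "'k fam \<Rightarrow> 'k" and x :: "'k fam"
  assume z: "(\<Sum>x\<in>unit_fam ` J. scl (f x) x) = 0" and x: "x \<in> unit_fam ` J"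
  then obtain y where y: "y \<in> J" "x = unit_fam y" by blast
  have "(\<Sum>x\<in>unit_fam ` J. scl (f x) x) (fst y) (fst (snd y)) (snd (snd y))
      = (\<Sum>l\<in>J. if l = y then f (unit_fam y) else 0)"
    unfolding sum.reindex[OF inj_unit_fam] fam_sum_apply
    using y by (intro sum.cong) (auto simp: scl_def unit_fam_def)
  then show "f x = 0" using z y assms by simp
qed (use assms in auto)

lemma supported_eq_span:
  assumes "finite J"
  shows "{\<eta>. supported J \<eta>} = fam_space.span ((unit_fam :: _ \<Rightarrow> 'k::field fam) ` J)"
proof
  show "{\<eta>. supported J \<eta>} \<subseteq> fam_space.span ((unit_fam :: _ \<Rightarrow> 'k fam) ` J)"
  proof
    fix \<eta> :: "'k fam" assume "\<eta> \<in> {\<eta>. supported J \<eta>}"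
    then have "supported J \<eta>" by simp
    from sum_unit_fam[OF assms this]
    have "\<eta> = (\<Sum>x\<in>J. scl (\<eta> (fst x) (fst (snd x)) (snd (snd x))) (unit_fam x))"
      by (auto simp: fun_eq_iff fam_sum_apply scl_def)
    also have "\<dots> \<in> fam_space.span (unit_fam ` J)"
      by (intro fam_space.span_sum fam_space.span_scale fam_space.span_base) auto
    finally show "\<eta> \<in> fam_space.span (unit_fam ` J)" .
  qed
  show "fam_space.span ((unit_fam :: _ \<Rightarrow> 'k fam) ` J) \<subseteq> {\<eta>. supported J \<eta>}"
  proof (rule fam_space.span_minimal)
    show "unit_fam ` J \<subseteq> {\<eta>. supported J \<eta>}" using supported_unit_fam by blast
    show "fam_space.subspace {\<eta>. supported J (\<eta> :: 'k fam)}"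
      unfolding fam_space.subspace_def supported_def by (force simp: scl_def)
  qed
qed

lemma subspace_delta_image:
  "fam_space.subspace (delta Q d e M N ` vertex_maps n d (e :: nat \<Rightarrow> nat) :: 'k::field fam set)"
  unfolding fam_space.subspace_def
proof (intro conjI ballI allI)
  have "delta Q d e M N 0 = 0" unfolding delta_def by (auto simp: fun_eq_iff)
  moreover have "0 \<in> vertex_maps n d e" unfolding vertex_maps_def by simp
  ultimately show "0 \<in> delta Q d e M N ` vertex_maps n d e" by (metis imageI)
next
  fix x y :: "'k fam" assume "x \<in> delta Q d e M N ` vertex_maps n d e" "y \<in> delta Q d e M N ` vertex_maps n d e"
  then obtain f g where "f \<in> vertex_maps n d e" "g \<in> vertex_maps n d e" "x = delta Q d e M N f" "y = delta Q d e M N g"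
    by blast
  moreover from this have "(\<lambda>i r c. f i r c + g i r c) \<in> vertex_maps n d e"
    unfolding vertex_maps_def by (smt (verit) add.right_neutral mem_Collect_eq)
  moreover have "x + y = delta Q d e M N (\<lambda>i r c. f i r c + g i r c)"
    using calculation unfolding delta_eq_rdelta rdelta_add by (auto simp: fun_eq_iff)
  ultimately show "x + y \<in> delta Q d e M N ` vertex_maps n d e" by blast
next
  fix k :: 'k and x :: "'k fam" assume "x \<in> delta Q d e M N ` vertex_maps n d e"
  then obtain f where "f \<in> vertex_maps n d e" "x = delta Q d e M N f" by blast
  moreover from this have "(\<lambda>i r c. k * f i r c) \<in> vertex_maps n d e"
    unfolding vertex_maps_def by auto
  moreover have "scl k x = delta Q d e M N (\<lambda>i r c. k * f i r c)"
    using calculation unfolding delta_eq_rdelta rdelta_scale by (simp add: scl_def)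
  ultimately show "scl k x \<in> delta Q d e M N ` vertex_maps n d e" by blast
qed

text \<open>The subtraction in \<open>dim_ext\<close> is truncated, so the value 0 only says that
  the image has at least the dimension of the ambient space; being contained in the span of that
  many unit families, it is everything.\<close>

lemma dim_ext_eq_0_iff:
  fixes M N :: "'k::field rep"
  shows "dim_ext n Q d e M N = 0 \<longleftrightarrow> ext_zero n Q d e M N"
proof -
  let ?im = "delta Q d e M N ` vertex_maps n d e" and ?J = "arrow_idx Q d e"
  let ?u = "unit_fam :: _ \<Rightarrow> 'k fam"
  have sub: "?im \<subseteq> fam_space.span (?u ` ?J)"
    using supported_rdelta[of Q d e M N] unfolding supported_eq_span[OF finite_arrow_idx, symmetric] delta_eq_rdelta by auto
  have cu: "card (?u ` ?J) = card ?J" by (rule card_image[OF inj_unit_fam])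
  have d0: "dim_ext n Q d e M N = 0 \<longleftrightarrow> card ?J \<le> fam_space.dim ?im"
    unfolding dim_ext_def kdim_def card_arrow_idx[symmetric] by simp
  have e0: "ext_zero n Q d e M N \<longleftrightarrow> {\<eta>. supported ?J \<eta>} \<subseteq> ?im"
    unfolding quasi_surj_def vertex_maps_eq delta_eq_rdelta by (auto simp: image_iff)
  show ?thesis
  proof
    assume "dim_ext n Q d e M N = 0"
    then have le: "card ?J \<le> fam_space.dim ?im" using d0 by simp
    obtain B where B: "B \<subseteq> ?im" "fam_space.independent B" "?im \<subseteq> fam_space.span B" "card B = fam_space.dim ?im"
      using fam_space.basis_exists[of ?im] by blast
    have "B \<subseteq> fam_space.span (?u ` ?J)" using B(1) sub by (rule subset_trans)
    from fam_space.independent_span_bound[OF _ B(2) this] have fB: "finite B" by simp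
    have spB: "fam_space.span B = ?im"
      by (intro subset_antisym fam_space.span_minimal[OF B(1) subspace_delta_image] B(3))
    have "\<eta> \<in> ?im" if "supported ?J \<eta>" for \<eta>
    proof (rule ccontr)
      assume no: "\<eta> \<notin> ?im"
      then have ind: "fam_space.independent (insert \<eta> B)"
        using B(2) no unfolding fam_space.independent_insert spB by auto
      have "insert \<eta> B \<subseteq> fam_space.span (?u ` ?J)"
        using that B(1) sub supported_eq_span[OF finite_arrow_idx, of Q d e] by blast
      from fam_space.independent_span_bound[OF _ ind this] have "card (insert \<eta> B) \<le> card (?u ` ?J)" by simp
      moreover have "\<eta> \<notin> B" using no B(1) by blast
      ultimately show False using fB cu le B(4) by simp
    qed
    then show "ext_zero n Q d e M N" unfolding e0 by blast
  next
    assume "ext_zero n Q d e M N"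
    then have "?im = fam_space.span (?u ` ?J)"
      using e0 sub supported_eq_span[OF finite_arrow_idx, of Q d e] by blast
    then have "fam_space.dim ?im = card (?u ` ?J)"
      by (simp only: fam_space.dim_span fam_space.dim_eq_card_independent[OF independent_unit_fam[OF finite_arrow_idx]])
    then show "dim_ext n Q d e M N = 0" using d0 cu by simp
  qed
qed

text \<open>0 is the smallest natural number, so the minimum is 0 exactly if 0 is attained; the zero
  representations show that the set of values is not empty.\<close>

lemma ext_eq_0_iff:
  fixes K :: "'k::field itself"
  shows "ext K n Q a b = 0 \<longleftrightarrow> (\<exists>(M::'k rep) N. is_rep Q a M \<and> is_rep Q b N \<and> ext_zero n Q a b M N)"
proof -
  let ?P = "\<lambda>x. \<exists>(M::'k rep) N. is_rep Q a M \<and> is_rep Q b N \<and> x = dim_ext n Q a b M N"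
  have ex: "?P (dim_ext n Q a b (\<lambda>_ _ _. 0 :: 'k) (\<lambda>_ _ _. 0))"
    by (intro exI conjI) (auto simp: is_rep_def)
  have "ext K n Q a b = 0 \<longleftrightarrow> ?P 0"
  proof
    assume "ext K n Q a b = 0"
    then show "?P 0" using LeastI[of ?P, OF ex] unfolding ext_def by simp
  next
    assume "?P 0"
    then show "ext K n Q a b = 0" unfolding ext_def by (rule Least_eq_0)
  qed
  then show ?thesis by (simp only: dim_ext_eq_0_iff[symmetric] eq_commute[of "0::nat"])
qed

section \<open>Bricks and generic choices\<close>

definition id_fam :: "nat \<Rightarrow> (nat \<Rightarrow> nat) \<Rightarrow> 'a::comm_ring_1 fam" where
  "id_fam n x = (\<lambda>i r c. if i < n \<and> r < x i \<and> r = c then 1 else 0)"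

definition fam_of :: "(nat \<times> nat \<times> nat) set \<Rightarrow> (nat \<times> nat \<times> nat \<Rightarrow> 'a::zero) \<Rightarrow> 'a fam" where
  "fam_of I f = (\<lambda>i r c. if (i, r, c) \<in> I then f (i, r, c) else 0)"

text \<open>The Schur condition without dimensions: as the absence of nonscalar solutions of a
  linear system it becomes a rank condition.\<close>

definition brick :: "nat \<Rightarrow> quiver \<Rightarrow> (nat \<Rightarrow> nat) \<Rightarrow> 'k::field fam \<Rightarrow> bool" where
  "brick n Q x M \<longleftrightarrow> is_rep Q x M \<and> (\<forall>\<phi>. supported (vertex_idx n x x) \<phi> \<longrightarrow>
     rdelta Q x x M M \<phi> = (\<lambda>a r c. 0) \<longrightarrow> (\<exists>k. \<phi> = (\<lambda>i r c. k * id_fam n x i r c)))"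

lemma supported_fam_of: "supported I (fam_of I f)"
  unfolding supported_def fam_of_def by auto

lemma supported_id_fam: "supported (vertex_idx n x x) (id_fam n x)"
  unfolding supported_def id_fam_def vertex_idx_def by auto

lemma quiver_ok_nth:
  assumes "quiver_ok n Q" "a < length Q"
  shows "fst (Q ! a) < n" "snd (Q ! a) < n"
  using assms unfolding quiver_ok_def by (metis (no_types, lifting) case_prod_beta nth_mem)+

lemma rdelta_id_fam:
  assumes ok: "quiver_ok n Q" and M: "supported (arrow_idx Q x x) M" and N: "supported (arrow_idx Q x x) N"
  shows "rdelta Q x x M N (id_fam n x) = (\<lambda>a r c. N a r c - M a r c)"
proof (intro ext)
  fix a r c
  show "rdelta Q x x M N (id_fam n x) a r c = N a r c - M a r c"
  proof (cases "(a, r, c) \<in> arrow_idx Q x x")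
    case True
    then have *: "a < length Q" "r < x (snd (Q!a))" "c < x (fst (Q!a))" by (auto simp: arrow_idx_def)
    have "(\<Sum>j<x (fst (Q!a)). N a r j * id_fam n x (fst (Q!a)) j c) = (\<Sum>j<x (fst (Q!a)). if j = c then N a r c else 0)"
      using quiver_ok_nth[OF ok *(1)] * by (intro sum.cong) (auto simp: id_fam_def)
    moreover have "(\<Sum>j<x (snd (Q!a)). id_fam n x (snd (Q!a)) r j * M a j c) = (\<Sum>j<x (snd (Q!a)). if j = r then M a r c else 0)"
      using quiver_ok_nth[OF ok *(1)] * by (intro sum.cong) (auto simp: id_fam_def)
    ultimately show ?thesis using * by (simp add: rdelta_def)
  next
    case False
    then show ?thesis
      using supported_zero[OF M] supported_zero[OF N] supported_zero[OF supported_rdelta[of Q x x M N "id_fam n x"]]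
      by simp
  qed
qed

lemma rdelta_fam_of:
  "rdelta Q d e M N (fam_of (vertex_idx n d e) f) a r c =
    (\<Sum>x\<in>vertex_idx n d e. f x * rdelta_mat Q d e M N x (a, r, c))"
  unfolding rdelta_expand[OF supported_fam_of] by (intro sum.cong) (auto simp: fam_of_def)

text \<open>The extra column \<open>None\<close> records the entry \<open>(v, 0, 0)\<close>, which is nonzero on the identity: the
  matrix is injective iff the endomorphisms are the scalars.\<close>

definition brick_mat :: "quiver \<Rightarrow> (nat \<Rightarrow> nat) \<Rightarrow> nat \<Rightarrow> 'a::comm_ring_1 fam \<Rightarrow>
    nat \<times> nat \<times> nat \<Rightarrow> (nat \<times> nat \<times> nat) option \<Rightarrow> 'a" where
  "brick_mat Q x v M i j = (case j of None \<Rightarrow> if i = (v, 0, 0) then 1 else 0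
     | Some j \<Rightarrow> rdelta_mat Q x x M M i j)"

lemma brick_iff_inj_mat:
  fixes M :: "'k::field fam"
  assumes ok: "quiver_ok n Q" and M: "is_rep Q x M" and v: "v < n" "0 < x v"
  shows "brick n Q x M \<longleftrightarrow>
    inj_mat (vertex_idx n x x) (insert None (Some ` arrow_idx Q x x)) (brick_mat Q x v M)"
proof -
  let ?I = "vertex_idx n x x" and ?J = "arrow_idx Q x x"
  have vI: "(v, 0, 0) \<in> ?I" using v by (simp add: vertex_idx_def)
  have sN: "(\<Sum>i\<in>?I. f i * brick_mat Q x v M i None) = f (v,0,0)" for f
  proof -
    have "(\<Sum>i\<in>?I. f i * brick_mat Q x v M i None) = (\<Sum>i\<in>?I. if i = (v,0,0) then f (v,0,0) else 0)"
      by (intro sum.cong) (auto simp: brick_mat_def)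
    then show ?thesis using vI by simp
  qed
  have sS: "(\<Sum>i\<in>?I. f i * brick_mat Q x v M i (Some (a,r,c))) = rdelta Q x x M M (fam_of ?I f) a r c" for f a r c
    unfolding rdelta_fam_of by (simp add: brick_mat_def)
  have cond: "(\<forall>j\<in>insert None (Some ` ?J). (\<Sum>i\<in>?I. f i * brick_mat Q x v M i j) = 0) \<longleftrightarrow>
      f (v,0,0) = 0 \<and> rdelta Q x x M M (fam_of ?I f) = (\<lambda>a r c. 0)" (is "?A f \<longleftrightarrow> ?B f") for f
  proof
    assume "?A f"
    have "rdelta Q x x M M (fam_of ?I f) a r c = 0" for a r c
      using \<open>?A f\<close> supported_zero[OF supported_rdelta[of Q x x M M "fam_of ?I f"], of a r c] sS[of f a r c]
      by (cases "(a,r,c) \<in> ?J") auto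
    then show "?B f" using \<open>?A f\<close> sN[of f] by auto
  next
    assume "?B f"
    then show "?A f" using sN[of f] sS[of f] by auto
  qed
  show ?thesis
  proof
    assume b: "brick n Q x M"
    show "inj_mat ?I (insert None (Some ` ?J)) (brick_mat Q x v M)"
      unfolding inj_mat_def cond
    proof (intro allI impI, elim conjE)
      fix f assume f: "f (v,0,0) = 0" "rdelta Q x x M M (fam_of ?I f) = (\<lambda>a r c. 0)"
      obtain k where k: "fam_of ?I f = (\<lambda>i r c. k * id_fam n x i r c)"
        using b f(2) supported_fam_of unfolding brick_def by blast
      have "k = 0"
        using fun_cong[OF fun_cong[OF fun_cong[OF k, of v], of 0], of 0] f(1) v vI
        by (simp add: fam_of_def id_fam_def)
      show "\<forall>i\<in>?I. f i = 0"
      proof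
        fix i assume "i \<in> ?I"
        then show "f i = 0"
          using fun_cong[OF fun_cong[OF fun_cong[OF k, of "fst i"], of "fst (snd i)"], of "snd (snd i)"] \<open>k = 0\<close>
          by (simp add: fam_of_def)
      qed
    qed
  next
    assume inj: "inj_mat ?I (insert None (Some ` ?J)) (brick_mat Q x v M)"
    show "brick n Q x M" unfolding brick_def
    proof (intro conjI allI impI M)
      fix \<phi> :: "'k fam" assume \<phi>: "supported ?I \<phi>" "rdelta Q x x M M \<phi> = (\<lambda>a r c. 0)"
      \<comment> \<open>Subtracting the multiple of the identity given by the entry
        \<open>(v, 0, 0)\<close> makes the extra column vanish.\<close>
      define k where "k = \<phi> v 0 0"
      define f where "f = (\<lambda>i. \<phi> (fst i) (fst (snd i)) (snd (snd i)) - k * id_fam n x (fst i) (fst (snd i)) (snd (snd i)))"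
      have ff: "fam_of ?I f = (\<lambda>i r c. \<phi> i r c - k * id_fam n x i r c)"
        using supported_zero[OF \<phi>(1)] supported_zero[OF supported_id_fam[of n x, where 'a='k]]
        by (auto simp: fam_of_def f_def fun_eq_iff)
      have "rdelta Q x x M M (fam_of ?I f) = (\<lambda>a r c. 0)"
        unfolding ff rdelta_diff rdelta_scale \<phi>(2)
        using rdelta_id_fam[OF ok, of x M M] M by (simp add: is_rep_iff_supported)
      moreover have "f (v,0,0) = 0" using v by (simp add: f_def k_def id_fam_def)
      ultimately have z: "\<forall>i\<in>?I. f i = 0" using inj unfolding inj_mat_def cond by blast
      then have "fam_of ?I f = (\<lambda>i r c. 0)" by (auto simp: fam_of_def fun_eq_iff)
      then have "\<phi> i r c - k * id_fam n x i r c = 0" for i r c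
        unfolding ff by meson
      then have "\<phi> = (\<lambda>i r c. k * id_fam n x i r c)" by (simp add: fun_eq_iff)
      then show "\<exists>k. \<phi> = (\<lambda>i r c. k * id_fam n x i r c)" ..
    qed
  qed
qed

text \<open>The identity is a nonzero vector of the one-dimensional endomorphism space, hence spans
  it.\<close>

lemma dim_hom_eq_1_brick:
  fixes M :: "'k::field rep"
  assumes ok: "quiver_ok n Q" and M: "is_rep Q x M" and v: "v < n" "0 < x v" and dim: "dim_hom n Q x x M M = 1"
  shows "brick n Q x M"
proof -
  let ?E = "{\<phi> \<in> vertex_maps n x x. delta Q x x M M \<phi> = 0}"
  obtain B where B: "B \<subseteq> ?E" "fam_space.independent B" "?E \<subseteq> fam_space.span B" "card B = fam_space.dim ?E"
    using fam_space.basis_exists[of ?E] by blast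
  have "card B = 1" using B(4) dim by (simp add: dim_hom_def kdim_def)
  then obtain b where b: "B = {b}" by (auto simp: card_1_singleton_iff)
  have mult: "\<exists>k. \<phi> = scl k b" if "\<phi> \<in> ?E" for \<phi>
    using that B(3) unfolding b fam_space.span_singleton by blast
  have "id_fam n x \<in> ?E"
    using rdelta_id_fam[OF ok, of x M M] M supported_id_fam[of n x]
    by (auto simp: vertex_maps_eq delta_eq_rdelta is_rep_iff_supported fun_eq_iff)
  from mult[OF this] obtain k where k: "id_fam n x = scl k b" by blast
  have "k \<noteq> 0"
  proof
    assume "k = 0"
    then have "id_fam n x v 0 0 = (0::'k)" using k by (simp add: scl_def)
    then show False using v by (simp add: id_fam_def)
  qed
  show ?thesis unfolding brick_def
  proof (intro conjI allI impI M)
    fix \<phi> :: "'k fam" assume "supported (vertex_idx n x x) \<phi>" "rdelta Q x x M M \<phi> = (\<lambda>a r c. 0)"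
    then have "\<phi> \<in> ?E" by (auto simp: vertex_maps_eq delta_eq_rdelta fun_eq_iff)
    from mult[OF this] obtain m where m: "\<phi> = scl m b" by blast
    have "\<phi> = (\<lambda>i r c. (m / k) * id_fam n x i r c)"
      unfolding m k using \<open>k \<noteq> 0\<close> by (simp add: scl_def)
    then show "\<exists>k. \<phi> = (\<lambda>i r c. k * id_fam n x i r c)" by blast
  qed
qed

section \<open>Openness along lines and generic choices\<close>

definition line :: "'k::field fam \<Rightarrow> 'k fam \<Rightarrow> 'k \<Rightarrow> 'k fam" where
  "line u v t = (\<lambda>a r c. u a r c + t * (v a r c - u a r c))"

definition poly_line :: "'k::field fam \<Rightarrow> 'k fam \<Rightarrow> 'k poly fam" where
  "poly_line u v = (\<lambda>a r c. [:u a r c, v a r c - u a r c:])"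

lemma poly_poly_line: "(\<lambda>a r c. poly (poly_line u v a r c) t) = line u v t"
  unfolding poly_line_def line_def by (auto simp: fun_eq_iff)

lemma line_0 [simp]: "line u v 0 = u" and line_1 [simp]: "line u v 1 = v"
  unfolding line_def by auto

lemma rdelta_mat_line:
  "rdelta_mat Q d e (line u v t) (line u' v' t) x y = poly (rdelta_mat Q d e (poly_line u v) (poly_line u' v') x y) t"
  using rdelta_mat_hom[OF comm_ring_hom_poly_eval[of t], of Q d e "poly_line u v" "poly_line u' v'" x y]
  unfolding poly_poly_line .

text \<open>\<open>u\<close> is the value at parameter 0, so openness is tested from the good end;
  the points of \<open>V\<close> are tuples, and all components move along their lines with a common
  parameter.\<close>

definition line_open :: "(nat \<Rightarrow> 'k::field fam) set \<Rightarrow> ((nat \<Rightarrow> 'k fam) \<Rightarrow> bool) \<Rightarrow> bool" where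
  "line_open V P \<longleftrightarrow> (\<forall>u\<in>V. \<forall>v\<in>V. P u \<longrightarrow> finite {t. \<not> P (\<lambda>j. line (u j) (v j) t)})"

lemma line_rev: "line u v (1 - t) = line v u t"
  unfolding line_def by (auto simp: fun_eq_iff algebra_simps)

text \<open>By induction one tuple \<open>u\<close> satisfies the old conditions and some
  \<open>v\<close> the new one; on the line joining them each condition excludes finitely many
  parameters, and the field is infinite.\<close>

lemma generic_choice:
  fixes V :: "(nat \<Rightarrow> 'k::field_char_0 fam) set"
  assumes "finite \<P>" and open': "\<And>P. P \<in> \<P> \<Longrightarrow> line_open V P" and ne: "\<And>P. P \<in> \<P> \<Longrightarrow> \<exists>u\<in>V. P u"
    and V: "V \<noteq> {}" "\<And>u v t. u \<in> V \<Longrightarrow> v \<in> V \<Longrightarrow> (\<lambda>j. line (u j) (v j) t) \<in> V"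
  shows "\<exists>u\<in>V. \<forall>P\<in>\<P>. P u"
  using assms(1-3)
proof (induction \<P> rule: finite_induct)
  case empty
  then show ?case using V by auto
next
  case (insert P \<P>)
  obtain u where u: "u \<in> V" "\<And>P. P \<in> \<P> \<Longrightarrow> P u" using insert.IH insert.prems by blast
  obtain v where v: "v \<in> V" "P v" using insert.prems by blast
  have f1: "finite {t. \<not> P (\<lambda>j. line (v j) (u j) t)}"
    using insert.prems(1)[of P] u v unfolding line_open_def by blast
  \<comment> \<open>\<open>u\<close> lies at parameter 1 of the line from \<open>v\<close>, so the
    line is reversed by sending \<open>t\<close> to \<open>1 - t\<close> before openness
    applies.\<close>
  have f2: "finite {t. \<not> R (\<lambda>j. line (v j) (u j) t)}" if "R \<in> \<P>" for R
  proof -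
    have "finite {t. \<not> R (\<lambda>j. line (u j) (v j) t)}"
      using insert.prems(1)[of R] u v that unfolding line_open_def by blast
    then have "finite ((\<lambda>t. 1 - t) ` {t. \<not> R (\<lambda>j. line (u j) (v j) t)})" by (rule finite_imageI)
    moreover have "{t. \<not> R (\<lambda>j. line (v j) (u j) t)} \<subseteq> (\<lambda>t. 1 - t) ` {t. \<not> R (\<lambda>j. line (u j) (v j) t)}"
    proof
      fix t assume "t \<in> {t. \<not> R (\<lambda>j. line (v j) (u j) t)}"
      then have "1 - t \<in> {t. \<not> R (\<lambda>j. line (u j) (v j) t)}" by (simp add: line_rev)
      then show "t \<in> (\<lambda>t. 1 - t) ` {t. \<not> R (\<lambda>j. line (u j) (v j) t)}" by force
    qed
    ultimately show ?thesis by (rule finite_subset[rotated])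
  qed
  have "finite ({t. \<not> P (\<lambda>j. line (v j) (u j) t)} \<union> (\<Union>R\<in>\<P>. {t. \<not> R (\<lambda>j. line (v j) (u j) t)}))"
    using f1 f2 insert.hyps by blast
  from ex_new_if_finite[OF infinite_UNIV_char_0 this] obtain t where
    "t \<notin> {t. \<not> P (\<lambda>j. line (v j) (u j) t)} \<union> (\<Union>R\<in>\<P>. {t. \<not> R (\<lambda>j. line (v j) (u j) t)})" by blast
  then show ?case using V(2)[OF v(1) u(1), of t] by blast
qed

lemma line_open_ext_zero: "line_open V (\<lambda>X. ext_zero n Q (x i) (x j) (X i) (X j))"
  unfolding line_open_def
proof (intro ballI impI)
  fix u v :: "nat \<Rightarrow> 'a fam"
  assume "ext_zero n Q (x i) (x j) (u i) (u j)"
  then have "surj_mat (vertex_idx n (x i) (x j)) (arrow_idx Q (x i) (x j))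
     (\<lambda>y z. poly (rdelta_mat Q (x i) (x j) (poly_line (u i) (v i)) (poly_line (u j) (v j)) y z) 0)"
    unfolding ext_zero_iff_surj_mat rdelta_mat_line[symmetric] by simp
  from surj_mat_open[OF finite_arrow_idx this]
  show "finite {t. \<not> ext_zero n Q (x i) (x j) (line (u i) (v i) t) (line (u j) (v j) t)}"
    unfolding ext_zero_iff_surj_mat rdelta_mat_line[symmetric] .
qed

lemma is_rep_line: "is_rep Q x u \<Longrightarrow> is_rep Q x v \<Longrightarrow> is_rep Q x (line u v t)"
  unfolding is_rep_def line_def by (metis add.right_neutral diff_zero mult_zero_right)

lemma line_open_brick:
  assumes ok: "quiver_ok n Q" and v: "v0 < n" "0 < x j v0" and V: "\<And>X. X \<in> V \<Longrightarrow> is_rep Q (x j) (X j)"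
  shows "line_open V (\<lambda>X. brick n Q (x j) (X j))"
  unfolding line_open_def
proof (intro ballI impI)
  fix u v :: "nat \<Rightarrow> 'a fam"
  assume uv: "u \<in> V" "v \<in> V" and b: "brick n Q (x j) (u j)"
  note iff = brick_iff_inj_mat[where x="x j", OF ok _ v]
  have bm: "brick_mat Q (x j) v0 (line (u j) (v j) t) = (\<lambda>y z. poly (brick_mat Q (x j) v0 (poly_line (u j) (v j)) y z) t)" for t
    by (auto simp: brick_mat_def fun_eq_iff rdelta_mat_line split: option.splits)
  let ?inj = "inj_mat (vertex_idx n (x j) (x j)) (insert None (Some ` arrow_idx Q (x j) (x j)))"
  have "?inj (brick_mat Q (x j) v0 (line (u j) (v j) 0))"
    using b iff[OF V[OF uv(1)]] by simp
  then have "?inj (\<lambda>y z. poly (brick_mat Q (x j) v0 (poly_line (u j) (v j)) y z) 0)" unfolding bm .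
  from inj_mat_open[OF _ _ this] have "finite {t. \<not> ?inj (brick_mat Q (x j) v0 (line (u j) (v j) t))}"
    unfolding bm by simp
  then show "finite {t. \<not> brick n Q (x j) (line (u j) (v j) t)}"
    using iff[OF is_rep_line[OF V[OF uv(1)] V[OF uv(2)]]] by simp
qed

text \<open>\<open>E\<close> collects the pairs that must have vanishing Ext and \<open>B\<close>
  the members that must be bricks. For \<open>i \<noteq> j\<close> the two members of a witnessing
  pair can be put at their places independently, which would fail on the diagonal.\<close>

lemma generic_tuple:
  fixes x :: "nat \<Rightarrow> nat \<Rightarrow> nat" and K :: "'k::field_char_0 itself"
  assumes ok: "quiver_ok n Q"
    and E: "\<And>i j. (i, j) \<in> E \<Longrightarrow> i < s \<and> j < s \<and> i \<noteq> j \<and> Defs.ext K n Q (x i) (x j) = 0"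
    and B: "\<And>j. j \<in> B \<Longrightarrow> j < s \<and> (\<exists>v<n. 0 < x j v) \<and> (\<exists>M::'k fam. brick n Q (x j) M)"
  shows "\<exists>X :: nat \<Rightarrow> 'k fam. (\<forall>j<s. is_rep Q (x j) (X j)) \<and>
    (\<forall>(i,j)\<in>E. ext_zero n Q (x i) (x j) (X i) (X j)) \<and> (\<forall>j\<in>B. brick n Q (x j) (X j))"
proof -
  define V where "V = {X :: nat \<Rightarrow> 'k fam. \<forall>j<s. is_rep Q (x j) (X j)}"
  define \<P> where "\<P> = (\<lambda>(i,j) X. ext_zero n Q (x i) (x j) (X i) (X j)) ` E \<union> (\<lambda>j X. brick n Q (x j) (X j :: 'k fam)) ` B"
  have fin: "finite E" "finite B"
  proof -
    have "E \<subseteq> {..<s} \<times> {..<s}" using E by auto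
    then show "finite E" by (rule finite_subset) auto
    have "B \<subseteq> {..<s}" using B by auto
    then show "finite B" by (rule finite_subset) auto
  qed
  have zero: "is_rep Q y (\<lambda>_ _ _. 0 :: 'k)" for y unfolding is_rep_def by simp
  have "\<exists>X\<in>V. \<forall>P\<in>\<P>. P X"
  proof (rule generic_choice)
    show "finite \<P>" unfolding \<P>_def using fin by simp
    show "V \<noteq> {}" using zero unfolding V_def by (auto intro!: exI[of _ "\<lambda>_ _ _ _. 0"])
    show "(\<lambda>j. line (u j) (v j) t) \<in> V" if "u \<in> V" "v \<in> V" for u v t
      using that is_rep_line unfolding V_def by blast
    fix P assume P: "P \<in> \<P>"
    show "line_open V P"
    proof -
      consider i j where "P = (\<lambda>X. ext_zero n Q (x i) (x j) (X i) (X j))"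
        | j where "j \<in> B" "P = (\<lambda>X. brick n Q (x j) (X j))" using P unfolding \<P>_def by auto
      then show ?thesis
      proof cases
        case 1 show ?thesis unfolding 1 by (rule line_open_ext_zero)
      next
        case 2
        then obtain v where v: "v < n" "0 < x j v" "j < s" using B by blast
        show ?thesis unfolding 2 by (rule line_open_brick[where x=x and j=j, OF ok v(1,2)]) (use v V_def in auto)
      qed
    qed
    show "\<exists>X\<in>V. P X"
    proof -
      consider i j where "(i,j) \<in> E" "P = (\<lambda>X. ext_zero n Q (x i) (x j) (X i) (X j))"
        | j where "j \<in> B" "P = (\<lambda>X. brick n Q (x j) (X j))" using P unfolding \<P>_def by auto
      then show ?thesis
      proof cases
        case 1
        then obtain M N :: "'k fam" where MN: "is_rep Q (x i) M" "is_rep Q (x j) N" "ext_zero n Q (x i) (x j) M N"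
          using E[OF 1(1)] unfolding ext_eq_0_iff by blast
        show ?thesis
          by (rule bexI[of _ "\<lambda>k. if k = i then M else if k = j then N else (\<lambda>_ _ _. 0)"])
             (use 1 MN E[OF 1(1)] zero in \<open>auto simp: V_def\<close>)
      next
        case 2
        then obtain M :: "'k fam" where M: "brick n Q (x j) M" using B by blast
        show ?thesis
          by (rule bexI[of _ "\<lambda>k. if k = j then M else (\<lambda>_ _ _. 0)"])
             (use 2 M zero in \<open>auto simp: V_def brick_def\<close>)
      qed
    qed
  qed
  then obtain X where X: "X \<in> V" "\<And>P. P \<in> \<P> \<Longrightarrow> P X" by blast
  have "ext_zero n Q (x i) (x j) (X i) (X j)" if "(i, j) \<in> E" for i j
  proof -
    have "(\<lambda>X. ext_zero n Q (x i) (x j) (X i) (X j)) \<in> \<P>"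
      unfolding \<P>_def by (rule UnI1, rule rev_image_eqI[OF that]) simp
    from X(2)[OF this] show ?thesis .
  qed
  moreover have "brick n Q (x j) (X j)" if "j \<in> B" for j
  proof -
    have "(\<lambda>X. brick n Q (x j) (X j)) \<in> \<P>"
      unfolding \<P>_def by (rule UnI2, rule rev_image_eqI[OF that]) simp
    from X(2)[OF this] show ?thesis .
  qed
  ultimately show ?thesis using X(1) unfolding V_def by blast
qed

section \<open>Direct sums\<close>

text \<open>A direct sum is coordinatised by bijections \<open>ix v\<close> from pairs (block, index in the block) to
  the coordinates at the vertex \<open>v\<close>.\<close>

locale blocks =
  fixes s :: nat and x :: "nat \<Rightarrow> nat \<Rightarrow> nat" and d :: "nat \<Rightarrow> nat" and ix :: "nat \<Rightarrow> nat \<times> nat \<Rightarrow> nat"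
  assumes bij: "bij_betw (ix v) (SIGMA j:{..<s}. {..<x j v}) {..<d v}"
begin

definition lab :: "nat \<Rightarrow> nat \<Rightarrow> nat" where
  "lab v r = fst (inv_into (SIGMA j:{..<s}. {..<x j v}) (ix v) r)"

definition pos :: "nat \<Rightarrow> nat \<Rightarrow> nat" where
  "pos v r = snd (inv_into (SIGMA j:{..<s}. {..<x j v}) (ix v) r)"

lemma lab_pos:
  assumes "r < d v"
  shows "lab v r < s" "pos v r < x (lab v r) v" "ix v (lab v r, pos v r) = r"
proof -
  have *: "inv_into (SIGMA j:{..<s}. {..<x j v}) (ix v) r \<in> (SIGMA j:{..<s}. {..<x j v})"
    using bij[of v] assms by (metis bij_betw_apply bij_betw_inv_into lessThan_iff)
  then show "lab v r < s" "pos v r < x (lab v r) v" unfolding lab_def pos_def by (auto simp: mem_Sigma_iff)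
  show "ix v (lab v r, pos v r) = r"
    unfolding lab_def pos_def using bij[of v] assms by (simp add: bij_betw_inv_into_right)
qed

lemma ix:
  assumes "j < s" "m < x j v"
  shows "ix v (j, m) < d v" "lab v (ix v (j, m)) = j" "pos v (ix v (j, m)) = m"
proof -
  have "(j, m) \<in> (SIGMA j:{..<s}. {..<x j v})" using assms by auto
  from bij_betw_inv_into_left[OF bij this] show "lab v (ix v (j, m)) = j" "pos v (ix v (j, m)) = m"
    unfolding lab_def pos_def by auto
  from bij_betw_apply[OF bij \<open>(j, m) \<in> _\<close>] show "ix v (j, m) < d v" by simp
qed

lemma sum_blocks: "(\<Sum>l<d v. f l) = (\<Sum>j<s. \<Sum>m<x j v. (f (ix v (j, m)) :: 'a::comm_monoid_add))"
  using sum.reindex_bij_betw[OF bij[of v], of f] by (simp add: sum.Sigma)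

lemma sum_one_block:
  assumes "j < s" and "\<And>l. l < d v \<Longrightarrow> lab v l \<noteq> j \<Longrightarrow> f l = (0 :: 'a::comm_monoid_add)"
  shows "(\<Sum>l<d v. f l) = (\<Sum>m<x j v. f (ix v (j, m)))"
proof -
  have "(\<Sum>l<d v. f l) = (\<Sum>i<s. if i = j then \<Sum>m<x j v. f (ix v (j, m)) else 0)"
    unfolding sum_blocks using assms(2) ix by (intro sum.cong) (auto intro!: sum.neutral)
  then show ?thesis using assms(1) by simp
qed

definition dsum :: "quiver \<Rightarrow> (nat \<Rightarrow> 'a::zero fam) \<Rightarrow> 'a fam" where
  "dsum Q X = (\<lambda>a r c. if a < length Q \<and> r < d (snd (Q!a)) \<and> c < d (fst (Q!a)) \<and>
      lab (snd (Q!a)) r = lab (fst (Q!a)) c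
    then X (lab (snd (Q!a)) r) a (pos (snd (Q!a)) r) (pos (fst (Q!a)) c) else 0)"

lemma supported_dsum: "supported (arrow_idx Q d d) (dsum Q X)"
  unfolding supported_def arrow_idx_def dsum_def by auto

definition diagonal :: "quiver \<Rightarrow> 'a::zero fam \<Rightarrow> bool" where
  "diagonal Q Y \<longleftrightarrow> supported (arrow_idx Q d d) Y \<and>
     (\<forall>a r c. Y a r c \<noteq> 0 \<longrightarrow> lab (snd (Q!a)) r = lab (fst (Q!a)) c)"

lemma diagonal_dsum: "diagonal Q (dsum Q X)"
  unfolding diagonal_def using supported_dsum by (auto simp: dsum_def split: if_splits)

end

lemma blocks_exist:
  assumes "\<And>v. d v = (\<Sum>j<s. x j v)"
  shows "\<exists>ix. blocks s x d ix"
proof -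
  have "\<exists>f. bij_betw f (SIGMA j:{..<s}. {..<x j v}) {..<d v}" for v
    by (rule finite_same_card_bij) (use assms in auto)
  then show ?thesis unfolding blocks_def by metis
qed

text \<open>A single representation counts as a direct sum with one block, so that maps from it into
  a direct sum are an instance of \<open>block_pair\<close>.\<close>

lemma blocks_single: "blocks (Suc 0) (\<lambda>_. d) d (\<lambda>v. snd)"
  by unfold_locales (auto simp: bij_betw_def inj_on_def image_def)

locale block_pair = src: blocks s x d ix + tgt: blocks s' y e iy
  for s x d ix s' y e iy
begin

text \<open>The component from summand \<open>i\<close> of the source to summand \<open>j\<close> of
  the target; \<open>vasm\<close> and \<open>aasm\<close> put such components together
  again.\<close>

definition vblk :: "nat \<Rightarrow> nat \<Rightarrow> 'a::zero fam \<Rightarrow> 'a fam" where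
  "vblk i j \<phi> = (\<lambda>v r c. if r < y j v \<and> c < x i v then \<phi> v (iy v (j, r)) (ix v (i, c)) else 0)"

definition ablk :: "quiver \<Rightarrow> nat \<Rightarrow> nat \<Rightarrow> 'a::zero fam \<Rightarrow> 'a fam" where
  "ablk Q i j \<eta> = (\<lambda>a r c. if a < length Q \<and> r < y j (snd (Q!a)) \<and> c < x i (fst (Q!a))
     then \<eta> a (iy (snd (Q!a)) (j, r)) (ix (fst (Q!a)) (i, c)) else 0)"

definition vasm :: "(nat \<Rightarrow> nat \<Rightarrow> 'a::zero fam) \<Rightarrow> 'a fam" where
  "vasm \<Phi> = (\<lambda>v r c. if r < e v \<and> c < d v
     then \<Phi> (src.lab v c) (tgt.lab v r) v (tgt.pos v r) (src.pos v c) else 0)"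

definition aasm :: "quiver \<Rightarrow> (nat \<Rightarrow> nat \<Rightarrow> 'a::zero fam) \<Rightarrow> 'a fam" where
  "aasm Q \<Phi> = (\<lambda>a r c. if a < length Q \<and> r < e (snd (Q!a)) \<and> c < d (fst (Q!a))
     then \<Phi> (src.lab (fst (Q!a)) c) (tgt.lab (snd (Q!a)) r) a (tgt.pos (snd (Q!a)) r) (src.pos (fst (Q!a)) c) else 0)"

lemma supported_vblk:
  assumes "supported (vertex_idx n d e) \<phi>" "i < s" "j < s'"
  shows "supported (vertex_idx n (x i) (y j)) (vblk i j \<phi>)"
  using assms unfolding supported_def vertex_idx_def vblk_def by auto

lemma supported_ablk: "supported (arrow_idx Q (x i) (y j)) (ablk Q i j \<eta>)"
  unfolding supported_def arrow_idx_def ablk_def by auto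

lemma supported_aasm: "supported (arrow_idx Q d e) (aasm Q \<Phi>)"
  unfolding supported_def arrow_idx_def aasm_def by auto

lemma supported_vasm:
  assumes "\<And>i j. i < s \<Longrightarrow> j < s' \<Longrightarrow> supported (vertex_idx n (x i) (y j)) (\<Phi> i j)"
  shows "supported (vertex_idx n d e) (vasm \<Phi>)"
  unfolding supported_def
proof (intro allI impI)
  fix v r c assume nz: "vasm \<Phi> v r c \<noteq> 0"
  then have rc: "r < e v" "c < d v" by (auto simp: vasm_def split: if_splits)
  from assms[OF src.lab_pos(1)[OF rc(2)] tgt.lab_pos(1)[OF rc(1)]] nz
  have "v < n" unfolding supported_def vertex_idx_def vasm_def using rc by auto
  then show "(v, r, c) \<in> vertex_idx n d e" using rc by (simp add: vertex_idx_def)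
qed

lemma vblk_vasm:
  assumes "i < s" "j < s'" "supported (vertex_idx n (x i) (y j)) (\<Phi> i j)"
  shows "vblk i j (vasm \<Phi>) = \<Phi> i j"
  using assms supported_zero[OF assms(3)] src.ix tgt.ix
  by (auto simp: vblk_def vasm_def fun_eq_iff vertex_idx_def)

lemma ablk_aasm:
  assumes "i < s" "j < s'" "supported (arrow_idx Q (x i) (y j)) (\<Phi> i j)"
  shows "ablk Q i j (aasm Q \<Phi>) = \<Phi> i j"
  using assms supported_zero[OF assms(3)] src.ix tgt.ix
  by (auto simp: ablk_def aasm_def fun_eq_iff arrow_idx_def)

lemma ablk_inject:
  assumes "supported (arrow_idx Q d e) \<eta>" "supported (arrow_idx Q d e) \<eta>'"
    and "\<And>i j. i < s \<Longrightarrow> j < s' \<Longrightarrow> ablk Q i j \<eta> = ablk Q i j \<eta>'"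
  shows "\<eta> = \<eta>'"
proof (intro ext)
  fix a r c
  show "\<eta> a r c = \<eta>' a r c"
  proof (cases "(a, r, c) \<in> arrow_idx Q d e")
    case True
    then have *: "a < length Q" "r < e (snd (Q!a))" "c < d (fst (Q!a))" by (auto simp: arrow_idx_def)
    note l = src.lab_pos[OF *(3)] tgt.lab_pos[OF *(2)]
    from fun_cong[OF fun_cong[OF fun_cong[OF assms(3)[OF l(1) l(4)], of a],
          of "tgt.pos (snd (Q!a)) r"], of "src.pos (fst (Q!a)) c"]
    show ?thesis using * l by (simp add: ablk_def)
  next
    case False
    then show ?thesis using supported_zero[OF assms(1)] supported_zero[OF assms(2)] by simp
  qed
qed

text \<open>A direct sum has no entries between different blocks, so in each matrix product the
  summation over the middle index shrinks to one block.\<close>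

lemma ablk_rdelta:
  fixes X Y :: "nat \<Rightarrow> 'a::comm_ring_1 fam"
  assumes ij: "i < s" "j < s'"
  shows "ablk Q i j (rdelta Q d e (src.dsum Q X) (tgt.dsum Q Y) \<phi>) =
    rdelta Q (x i) (y j) (X i) (Y j) (vblk i j \<phi>)"
proof (intro ext)
  fix a r c
  let ?s = "fst (Q!a)" and ?t = "snd (Q!a)"
  show "ablk Q i j (rdelta Q d e (src.dsum Q X) (tgt.dsum Q Y) \<phi>) a r c =
    rdelta Q (x i) (y j) (X i) (Y j) (vblk i j \<phi>) a r c"
  proof (cases "a < length Q \<and> r < y j ?t \<and> c < x i ?s")
    case True
    then have *: "a < length Q" "r < y j ?t" "c < x i ?s" by auto
    note i1 = src.ix[OF ij(1) *(3)] and i2 = tgt.ix[OF ij(2) *(2)]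
    have 1: "(\<Sum>l<e ?s. tgt.dsum Q Y a (iy ?t (j, r)) l * \<phi> ?s l (ix ?s (i, c)))
      = (\<Sum>m<y j ?s. Y j a r m * vblk i j \<phi> ?s m c)"
      by (subst tgt.sum_one_block[OF ij(2)])
         (use * i1 i2 tgt.ix[OF ij(2)] in \<open>auto simp: tgt.dsum_def vblk_def intro!: sum.cong\<close>)
    have 2: "(\<Sum>l<d ?t. \<phi> ?t (iy ?t (j, r)) l * src.dsum Q X a l (ix ?s (i, c)))
      = (\<Sum>m<x i ?t. vblk i j \<phi> ?t r m * X i a m c)"
      by (subst src.sum_one_block[OF ij(1)])
         (use * i1 i2 src.ix[OF ij(1)] in \<open>auto simp: src.dsum_def vblk_def intro!: sum.cong\<close>)
    show ?thesis unfolding ablk_def rdelta_def using * i1 i2 1 2 by simp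
  next
    case False
    then show ?thesis unfolding ablk_def rdelta_def by auto
  qed
qed

lemma solve_blockwise:
  fixes X Y :: "nat \<Rightarrow> 'a::comm_ring_1 fam"
  assumes \<eta>: "supported (arrow_idx Q d e) \<eta>"
    and sol: "\<And>i j. i < s \<Longrightarrow> j < s' \<Longrightarrow>
      \<exists>\<phi>. supported (vertex_idx n (x i) (y j)) \<phi> \<and> rdelta Q (x i) (y j) (X i) (Y j) \<phi> = ablk Q i j \<eta>"
  shows "\<exists>\<phi>. supported (vertex_idx n d e) \<phi> \<and> rdelta Q d e (src.dsum Q X) (tgt.dsum Q Y) \<phi> = \<eta>"
proof -
  obtain \<Phi> where \<Phi>: "\<And>i j. i < s \<Longrightarrow> j < s' \<Longrightarrow>
      supported (vertex_idx n (x i) (y j)) (\<Phi> i j) \<and> rdelta Q (x i) (y j) (X i) (Y j) (\<Phi> i j) = ablk Q i j \<eta>"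
    using sol by metis
  have "rdelta Q d e (src.dsum Q X) (tgt.dsum Q Y) (vasm \<Phi>) = \<eta>"
  proof (rule ablk_inject[OF supported_rdelta \<eta>])
    fix i j assume "i < s" "j < s'"
    then show "ablk Q i j (rdelta Q d e (src.dsum Q X) (tgt.dsum Q Y) (vasm \<Phi>)) = ablk Q i j \<eta>"
      using \<Phi>[of i j] vblk_vasm[of i j n \<Phi>] by (simp add: ablk_rdelta)
  qed
  then show ?thesis using supported_vasm \<Phi> by blast
qed

text \<open>Ext^1 of direct sums is the sum of the Ext^1 of the pairs of summands, so one
  \<open>p\<close> annihilates it exactly if it annihilates every piece.\<close>

lemma quasi_surj_dsum:
  fixes X Y :: "nat \<Rightarrow> 'a::comm_ring_1 fam"
  shows "quasi_surj n Q d e p (src.dsum Q X) (tgt.dsum Q Y) \<longleftrightarrow>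
    (\<forall>i<s. \<forall>j<s'. quasi_surj n Q (x i) (y j) p (X i) (Y j))" (is "?L \<longleftrightarrow> ?R")
proof
  assume ?L
  show ?R
  proof (intro allI impI)
    fix i j assume ij: "i < s" "j < s'"
    show "quasi_surj n Q (x i) (y j) p (X i) (Y j)" unfolding quasi_surj_def
    proof (intro allI impI)
      fix \<eta> :: "'a fam" assume \<eta>: "supported (arrow_idx Q (x i) (y j)) \<eta>"
      let ?\<eta> = "aasm Q (\<lambda>_ _. \<eta>)"
      obtain \<phi> where \<phi>: "supported (vertex_idx n d e) \<phi>"
        "rdelta Q d e (src.dsum Q X) (tgt.dsum Q Y) \<phi> = (\<lambda>a r c. p * ?\<eta> a r c)"
        using \<open>?L\<close> supported_aasm unfolding quasi_surj_def by blast
      have "rdelta Q (x i) (y j) (X i) (Y j) (vblk i j \<phi>) = ablk Q i j (\<lambda>a r c. p * ?\<eta> a r c)"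
        using ablk_rdelta[OF ij, of Q X Y \<phi>] \<phi>(2) by simp
      also have "\<dots> = (\<lambda>a r c. p * ablk Q i j ?\<eta> a r c)" by (auto simp: ablk_def fun_eq_iff)
      also have "ablk Q i j ?\<eta> = \<eta>" by (rule ablk_aasm[OF ij \<eta>])
      finally show "\<exists>\<phi>. supported (vertex_idx n (x i) (y j)) \<phi> \<and>
          rdelta Q (x i) (y j) (X i) (Y j) \<phi> = (\<lambda>a r c. p * \<eta> a r c)"
        using supported_vblk[OF \<phi>(1) ij] by blast
    qed
  qed
next
  assume R: ?R
  show ?L unfolding quasi_surj_def
  proof (intro allI impI)
    fix \<eta> :: "'a fam" assume \<eta>: "supported (arrow_idx Q d e) \<eta>"
    show "\<exists>\<phi>. supported (vertex_idx n d e) \<phi> \<and>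
      rdelta Q d e (src.dsum Q X) (tgt.dsum Q Y) \<phi> = (\<lambda>a r c. p * \<eta> a r c)"
    proof (rule solve_blockwise)
      show "supported (arrow_idx Q d e) (\<lambda>a r c. p * \<eta> a r c)" using \<eta> unfolding supported_def by force
      fix i j assume ij: "i < s" "j < s'"
      have "ablk Q i j (\<lambda>a r c. p * \<eta> a r c) = (\<lambda>a r c. p * ablk Q i j \<eta> a r c)"
        by (auto simp: ablk_def fun_eq_iff)
      then show "\<exists>\<phi>. supported (vertex_idx n (x i) (y j)) \<phi> \<and>
          rdelta Q (x i) (y j) (X i) (Y j) \<phi> = ablk Q i j (\<lambda>a r c. p * \<eta> a r c)"
        using R ij supported_ablk[of Q i j \<eta>] unfolding quasi_surj_def by simp
    qed
  qed
qed

end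

lemma dsum_single:
  assumes "supported (arrow_idx Q b b) B"
  shows "blocks.dsum (Suc 0) (\<lambda>_. b) b (\<lambda>v. snd) Q (\<lambda>_. B) = B"
proof -
  interpret blocks "Suc 0" "\<lambda>_. b" b "\<lambda>v. snd" by (rule blocks_single)
  have l: "lab v r = 0" "pos v r = r" if "r < b v" for v r
    using lab_pos[OF that] by auto
  show ?thesis
    using supported_zero[OF assms] l by (auto simp: dsum_def fun_eq_iff arrow_idx_def)
qed

lemma quasi_surj_dsum_right:
  fixes Y :: "nat \<Rightarrow> 'a::comm_ring_1 fam"
  assumes "blocks s x d ix" and B: "supported (arrow_idx Q b b) B"
  shows "quasi_surj n Q b d p B (blocks.dsum s x d ix Q Y) \<longleftrightarrow> (\<forall>j<s. quasi_surj n Q b (x j) p B (Y j))"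
proof -
  interpret block_pair "Suc 0" "\<lambda>_. b" b "\<lambda>v. snd" s x d ix
    using assms(1) blocks_single by (simp add: block_pair_def)
  show ?thesis using quasi_surj_dsum[of n Q p "\<lambda>_. B" Y] unfolding dsum_single[OF B] by simp
qed

context blocks
begin

lemma block_pair_self: "block_pair s x d ix s x d ix"
  using blocks_axioms by (simp add: block_pair_def)

lemma dsum_diagonal_blocks:
  assumes "diagonal Q Y"
  shows "dsum Q (\<lambda>j. block_pair.ablk x ix x ix Q j j Y) = Y"
proof -
  interpret block_pair s x d ix s x d ix by (rule block_pair_self)
  show ?thesis
  proof (intro ext)
    fix a r c
    let ?s = "fst (Q!a)" and ?t = "snd (Q!a)"
    show "dsum Q (\<lambda>j. ablk Q j j Y) a r c = Y a r c"
    proof (cases "a < length Q \<and> r < d ?t \<and> c < d ?s")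
      case True
      note l = lab_pos[of r ?t] lab_pos[of c ?s]
      show ?thesis
      proof (cases "lab ?t r = lab ?s c")
        case T: True
        then show ?thesis using True l by (simp add: dsum_def ablk_def)
      next
        case False
        then show ?thesis using assms by (auto simp: dsum_def diagonal_def)
      qed
    next
      case False
      then have "(a, r, c) \<notin> arrow_idx Q d d" by (auto simp: arrow_idx_def)
      with assms have "Y a r c = 0" unfolding diagonal_def using supported_zero by blast
      then show ?thesis using False by (auto simp: dsum_def)
    qed
  qed
qed

end

section \<open>Generic extensions of direct sums, duality, restriction\<close>

text \<open>The generic choice must give one representation of dimension \<open>b\<close> that works
  against all \<open>x j\<close> at once; hence \<open>b\<close> joins the tuple as member
  \<open>s\<close>.\<close>

lemma ext_sum_right:
  fixes K :: "'k::field_char_0 itself" and x :: "nat \<Rightarrow> nat \<Rightarrow> nat" and s :: nat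
  assumes ok: "quiver_ok n Q" and d: "\<And>v. d v = (\<Sum>j<s. x j v)"
    and ext: "\<And>j. j < s \<Longrightarrow> Defs.ext K n Q b (x j) = 0"
  shows "Defs.ext K n Q b d = 0"
proof -
  define y where "y = x(s := b)"
  have "\<exists>X :: nat \<Rightarrow> 'k fam. (\<forall>j<Suc s. is_rep Q (y j) (X j)) \<and>
    (\<forall>(i,j)\<in>{s} \<times> {..<s}. ext_zero n Q (y i) (y j) (X i) (X j)) \<and> (\<forall>j\<in>{}. brick n Q (y j) (X j))"
    by (rule generic_tuple[OF ok, where K=K]) (use ext in \<open>auto simp: y_def\<close>)
  then obtain X :: "nat \<Rightarrow> 'k fam" where X: "\<forall>j<Suc s. is_rep Q (y j) (X j)"
    "\<And>j. j < s \<Longrightarrow> ext_zero n Q b (x j) (X s) (X j)" by (auto simp: y_def)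
  obtain ix where ix: "blocks s x d ix" using blocks_exist[of d x s] d by blast
  have Xs: "is_rep Q b (X s)" using X(1) by (auto simp: y_def)
  have "ext_zero n Q b d (X s) (blocks.dsum s x d ix Q X)"
    using quasi_surj_dsum_right[OF ix] Xs X(2) unfolding is_rep_iff_supported by blast
  moreover have "is_rep Q d (blocks.dsum s x d ix Q X)"
    unfolding is_rep_iff_supported by (rule blocks.supported_dsum[OF ix])
  ultimately show ?thesis unfolding ext_eq_0_iff using Xs by blast
qed

section \<open>Duality with the opposite quiver\<close>

definition op_quiver :: "quiver \<Rightarrow> quiver" where
  "op_quiver Q = map prod.swap Q"

definition fam_transpose :: "'a fam \<Rightarrow> 'a fam" where
  "fam_transpose M = (\<lambda>a r c. M a c r)"

lemma op_quiver_simps [simp]: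
  "length (op_quiver Q) = length Q"
  "a < length Q \<Longrightarrow> fst (op_quiver Q ! a) = snd (Q ! a)"
  "a < length Q \<Longrightarrow> snd (op_quiver Q ! a) = fst (Q ! a)"
  "op_quiver (op_quiver Q) = Q"
  unfolding op_quiver_def by auto

lemma quiver_ok_op: "quiver_ok n Q \<Longrightarrow> quiver_ok n (op_quiver Q)"
  unfolding quiver_ok_def op_quiver_def by auto

lemma supported_transpose_arrow:
  "supported (arrow_idx Q d e) \<eta> \<Longrightarrow> supported (arrow_idx (op_quiver Q) e d) (fam_transpose \<eta>)"
  unfolding supported_def arrow_idx_def fam_transpose_def by auto

lemma supported_transpose_vertex:
  "supported (vertex_idx n d e) \<phi> \<Longrightarrow> supported (vertex_idx n e d) (fam_transpose \<phi>)"
  unfolding supported_def vertex_idx_def fam_transpose_def by auto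

lemma rdelta_transpose:
  "rdelta (op_quiver Q) e d (fam_transpose N) (fam_transpose M) (fam_transpose \<phi>) a r c =
    - rdelta Q d e M N \<phi> a c r"
  by (cases "a < length Q") (auto simp: rdelta_def fam_transpose_def mult.commute)

text \<open>Transposition exchanges the two products in \<open>rdelta\<close>, which accounts for
  the sign; statements about the second argument of ext thereby yield statements about the
  first.\<close>

lemma ext_zero_op:
  fixes M N :: "'a::comm_ring_1 fam"
  assumes "ext_zero n Q d e M N"
  shows "ext_zero n (op_quiver Q) e d (fam_transpose N) (fam_transpose M)"
  unfolding quasi_surj_def
proof (intro allI impI)
  fix \<eta> :: "'a fam" assume \<eta>: "supported (arrow_idx (op_quiver Q) e d) \<eta>"
  have "supported (arrow_idx Q d e) (\<lambda>a r c. - fam_transpose \<eta> a r c)"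
    using supported_transpose_arrow[OF \<eta>] unfolding supported_def by simp
  then obtain \<phi> where \<phi>: "supported (vertex_idx n d e) \<phi>" "rdelta Q d e M N \<phi> = (\<lambda>a r c. - fam_transpose \<eta> a r c)"
    using assms unfolding quasi_surj_def by auto
  show "\<exists>\<phi>. supported (vertex_idx n e d) \<phi> \<and>
     rdelta (op_quiver Q) e d (fam_transpose N) (fam_transpose M) \<phi> = (\<lambda>a r c. 1 * \<eta> a r c)"
    by (intro exI[of _ "fam_transpose \<phi>"] conjI supported_transpose_vertex \<phi>(1) HOL.ext)
       (simp add: rdelta_transpose \<phi>(2), simp add: fam_transpose_def)
qed

lemma ext_op_imp:
  fixes K :: "'k::field itself"
  assumes "Defs.ext K n Q a b = 0"
  shows "Defs.ext K n (op_quiver Q) b a = 0"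
proof -
  obtain M N :: "'k rep" where "is_rep Q a M" "is_rep Q b N" "ext_zero n Q a b M N"
    using assms unfolding ext_eq_0_iff by blast
  then show ?thesis unfolding ext_eq_0_iff is_rep_iff_supported
    using ext_zero_op supported_transpose_arrow by blast
qed

lemma ext_op: "Defs.ext K n (op_quiver Q) b a = 0 \<longleftrightarrow> Defs.ext K n Q a b = 0"
proof
  assume "Defs.ext K n (op_quiver Q) b a = 0"
  from ext_op_imp[OF this] show "Defs.ext K n Q a b = 0" by simp
qed (rule ext_op_imp)

lemma ext_sum_left:
  fixes K :: "'k::field_char_0 itself" and x :: "nat \<Rightarrow> nat \<Rightarrow> nat" and s :: nat
  assumes ok: "quiver_ok n Q" and d: "\<And>v. d v = (\<Sum>j<s. x j v)"
    and ext: "\<And>j. j < s \<Longrightarrow> Defs.ext K n Q (x j) b = 0"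
  shows "Defs.ext K n Q d b = 0"
  by (rule ext_sum_right[OF quiver_ok_op[OF ok] d, of K b, unfolded ext_op, OF ext])

text \<open>Where \<open>b\<close> vanishes, vertex maps out of \<open>b\<close> are zero, so
  cutting rows and columns of \<open>N\<close> at such vertices drops equations but no unknowns.
  This serves the sum with a negative root, which lowers one coordinate.\<close>

lemma ext_restrict_right:
  fixes K :: "'k::field itself"
  assumes ext: "Defs.ext K n Q b e = 0" and le: "\<And>v. e' v \<le> e v" and eq: "\<And>v. b v \<noteq> 0 \<Longrightarrow> e' v = e v"
  shows "Defs.ext K n Q b e' = 0"
proof -
  obtain M N :: "'k rep" where MN: "is_rep Q b M" "is_rep Q e N" "ext_zero n Q b e M N"
    using ext unfolding ext_eq_0_iff by blast
  define N' where "N' = (\<lambda>a r c. if (a, r, c) \<in> arrow_idx Q e' e' then N a r c else 0)"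
  have "ext_zero n Q b e' M N'" unfolding quasi_surj_def
  proof (intro allI impI)
    fix \<eta> :: "'k fam" assume \<eta>: "supported (arrow_idx Q b e') \<eta>"
    have "supported (arrow_idx Q b e) \<eta>"
      using \<eta> unfolding supported_def arrow_idx_def
      by (auto intro: less_le_trans[OF _ le])
    then obtain \<phi> where \<phi>: "supported (vertex_idx n b e) \<phi>" "rdelta Q b e M N \<phi> = \<eta>"
      using MN(3) unfolding quasi_surj_def by auto
    have s': "supported (vertex_idx n b e') \<phi>"
      using \<phi>(1) eq unfolding supported_def vertex_idx_def by fastforce
    have "rdelta Q b e' M N' \<phi> a r c = \<eta> a r c" for a r c
    proof (cases "(a, r, c) \<in> arrow_idx Q b e'")
      case True
      then have *: "a < length Q" "r < e' (snd (Q!a))" "c < b (fst (Q!a))" by (auto simp: arrow_idx_def)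
      have es: "e' (fst (Q!a)) = e (fst (Q!a))" using eq *(3) by simp
      have "rdelta Q b e' M N' \<phi> a r c = rdelta Q b e M N \<phi> a r c"
        unfolding rdelta_def using * es le[of "snd (Q!a)"] by (simp add: N'_def arrow_idx_def)
      then show ?thesis using \<phi>(2) by simp
    next
      case False
      then show ?thesis using supported_zero[OF \<eta>] supported_zero[OF supported_rdelta[of Q b e' M N' \<phi>]] by simp
    qed
    then show "\<exists>\<phi>. supported (vertex_idx n b e') \<phi> \<and> rdelta Q b e' M N' \<phi> = (\<lambda>a r c. 1 * \<eta> a r c)"
      using s' by (auto simp: fun_eq_iff)
  qed
  moreover have "is_rep Q e' N'" unfolding is_rep_iff_supported supported_def N'_def by auto
  ultimately show ?thesis unfolding ext_eq_0_iff using MN(1) by blast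
qed

lemma ext_restrict_left:
  fixes K :: "'k::field itself"
  assumes ext: "Defs.ext K n Q e b = 0" and le: "\<And>v. e' v \<le> e v" and eq: "\<And>v. b v \<noteq> 0 \<Longrightarrow> e' v = e v"
  shows "Defs.ext K n Q e' b = 0"
  by (rule ext_restrict_right[of K n "op_quiver Q" b e e', unfolded ext_op, OF ext le eq])

section \<open>Block diagonalisation over formal power series\<close>

definition vmul :: "(nat \<Rightarrow> nat) \<Rightarrow> 'a::comm_ring_1 fam \<Rightarrow> 'a fam \<Rightarrow> 'a fam" where
  "vmul d \<phi> \<psi> = (\<lambda>v r c. \<Sum>j<d v. \<phi> v r j * \<psi> v j c)"

definition amul_left :: "quiver \<Rightarrow> (nat \<Rightarrow> nat) \<Rightarrow> 'a::comm_ring_1 fam \<Rightarrow> 'a fam \<Rightarrow> 'a fam" where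
  "amul_left Q d \<phi> \<eta> = (\<lambda>a r c. \<Sum>j<d (snd (Q!a)). \<phi> (snd (Q!a)) r j * \<eta> a j c)"

definition amul_right :: "quiver \<Rightarrow> (nat \<Rightarrow> nat) \<Rightarrow> 'a::comm_ring_1 fam \<Rightarrow> 'a fam \<Rightarrow> 'a fam" where
  "amul_right Q d \<eta> \<phi> = (\<lambda>a r c. \<Sum>j<d (fst (Q!a)). \<eta> a r j * \<phi> (fst (Q!a)) j c)"

lemma supported_vmul:
  assumes "supported (vertex_idx n e f) \<phi>" "supported (vertex_idx n d e) \<psi>"
  shows "supported (vertex_idx n d f) (vmul e \<phi> \<psi>)"
  unfolding supported_def
proof (intro allI impI)
  fix v r c assume "vmul e \<phi> \<psi> v r c \<noteq> 0"
  then obtain j where "\<phi> v r j * \<psi> v j c \<noteq> 0" unfolding vmul_def by (meson sum.neutral)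
  then have "\<phi> v r j \<noteq> 0" "\<psi> v j c \<noteq> 0" by auto
  then show "(v, r, c) \<in> vertex_idx n d f"
    using assms unfolding supported_def vertex_idx_def by blast
qed

lemma vmul_assoc: "vmul e (vmul f \<phi> \<psi>) \<chi> = vmul f \<phi> (vmul e \<psi> \<chi>)"
  unfolding vmul_def sum_distrib_left sum_distrib_right
  by (intro HOL.ext) (subst sum.swap, simp add: mult.assoc)

lemma vmul_id_left:
  assumes "supported (vertex_idx n d e) \<phi>"
  shows "vmul e (id_fam n e) \<phi> = \<phi>"
proof (intro HOL.ext)
  fix v r c
  have "vmul e (id_fam n e) \<phi> v r c = (\<Sum>j<e v. if j = r then \<phi> v r c else 0)"
    unfolding vmul_def using supported_zero[OF assms]
    by (intro sum.cong) (auto simp: id_fam_def vertex_idx_def)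
  then show "vmul e (id_fam n e) \<phi> v r c = \<phi> v r c"
    using supported_zero[OF assms, of v r c] by (auto simp: vertex_idx_def)
qed

lemma vmul_id_right:
  assumes "supported (vertex_idx n d e) \<phi>"
  shows "vmul d \<phi> (id_fam n d) = \<phi>"
proof (intro HOL.ext)
  fix v r c
  have "vmul d \<phi> (id_fam n d) v r c = (\<Sum>j<d v. if j = c then \<phi> v r c else 0)"
    unfolding vmul_def using supported_zero[OF assms]
    by (intro sum.cong) (auto simp: id_fam_def vertex_idx_def)
  then show "vmul d \<phi> (id_fam n d) v r c = \<phi> v r c"
    using supported_zero[OF assms, of v r c] by (auto simp: vertex_idx_def)
qed

lemma amul_left_vmul: "amul_left Q e (vmul d \<phi> \<psi>) \<eta> = amul_left Q d \<phi> (amul_left Q e \<psi> \<eta>)"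
  unfolding vmul_def amul_left_def sum_distrib_left sum_distrib_right
  by (intro HOL.ext) (subst sum.swap, simp add: mult.assoc)

lemma amul_left_id:
  assumes ok: "quiver_ok n Q" and \<eta>: "supported (arrow_idx Q d e) \<eta>"
  shows "amul_left Q e (id_fam n e) \<eta> = \<eta>"
proof (intro HOL.ext)
  fix a r c
  have "amul_left Q e (id_fam n e) \<eta> a r c = (\<Sum>j<e (snd (Q!a)). if j = r then \<eta> a r c else 0)"
    unfolding amul_left_def using supported_zero[OF \<eta>] quiver_ok_nth[OF ok, of a]
    by (intro sum.cong) (auto simp: id_fam_def arrow_idx_def)
  then show "amul_left Q e (id_fam n e) \<eta> a r c = \<eta> a r c"
    using supported_zero[OF \<eta>, of a r c] by (auto simp: arrow_idx_def)
qed

text \<open>The two terms with \<open>N\<close> between \<open>\<psi>\<close> and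
  \<open>\<phi>\<close> cancel; this product rule is behind the closure of homomorphisms under
  composition.\<close>

lemma rdelta_vmul:
  assumes \<phi>: "supported (vertex_idx n d e) \<phi>" and \<psi>: "supported (vertex_idx n e f) \<psi>"
  shows "rdelta Q d f M P (vmul e \<psi> \<phi>) = (\<lambda>a r c.
    amul_right Q e (rdelta Q e f N P \<psi>) \<phi> a r c + amul_left Q e \<psi> (rdelta Q d e M N \<phi>) a r c)"
proof (intro HOL.ext)
  fix a r c
  let ?s = "fst (Q!a)" and ?t = "snd (Q!a)"
  show "rdelta Q d f M P (vmul e \<psi> \<phi>) a r c =
    amul_right Q e (rdelta Q e f N P \<psi>) \<phi> a r c + amul_left Q e \<psi> (rdelta Q d e M N \<phi>) a r c"
  proof (cases "a < length Q \<and> r < f ?t \<and> c < d ?s")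
    case True
    have 1: "amul_right Q e (rdelta Q e f N P \<psi>) \<phi> a r c =
      (\<Sum>j<e ?s. (\<Sum>l<f ?s. P a r l * \<psi> ?s l j) * \<phi> ?s j c) - (\<Sum>j<e ?s. (\<Sum>l<e ?t. \<psi> ?t r l * N a l j) * \<phi> ?s j c)"
      unfolding amul_right_def rdelta_def using True
      by (simp add: sum_subtractf[symmetric] left_diff_distrib)
    have 2: "amul_left Q e \<psi> (rdelta Q d e M N \<phi>) a r c =
      (\<Sum>j<e ?t. \<psi> ?t r j * (\<Sum>l<e ?s. N a j l * \<phi> ?s l c)) - (\<Sum>j<e ?t. \<psi> ?t r j * (\<Sum>l<d ?t. \<phi> ?t j l * M a l c))"
      unfolding amul_left_def rdelta_def using True
      by (simp add: sum_subtractf[symmetric] right_diff_distrib)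
    have 3: "(\<Sum>j<e ?s. (\<Sum>l<e ?t. \<psi> ?t r l * N a l j) * \<phi> ?s j c) = (\<Sum>j<e ?t. \<psi> ?t r j * (\<Sum>l<e ?s. N a j l * \<phi> ?s l c))"
      unfolding sum_distrib_left sum_distrib_right by (subst sum.swap) (simp add: mult.assoc)
    have 4: "(\<Sum>j<e ?s. (\<Sum>l<f ?s. P a r l * \<psi> ?s l j) * \<phi> ?s j c) = (\<Sum>j<f ?s. P a r j * vmul e \<psi> \<phi> ?s j c)"
      unfolding vmul_def sum_distrib_left sum_distrib_right by (subst sum.swap) (simp add: mult.assoc)
    have 5: "(\<Sum>j<e ?t. \<psi> ?t r j * (\<Sum>l<d ?t. \<phi> ?t j l * M a l c)) = (\<Sum>j<d ?t. vmul e \<psi> \<phi> ?t r j * M a j c)"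
      unfolding vmul_def sum_distrib_left sum_distrib_right by (subst sum.swap) (simp add: mult.assoc)
    show ?thesis unfolding 1 2 3 4 5 using True by (simp add: rdelta_def)
  next
    case False
    have "amul_right Q e (rdelta Q e f N P \<psi>) \<phi> a r c = 0"
    proof (cases "c < d ?s")
      case True
      then show ?thesis using False by (auto simp: amul_right_def rdelta_def)
    next
      case c: False
      then show ?thesis unfolding amul_right_def using supported_zero[OF \<phi>, of ?s _ c] by (simp add: vertex_idx_def)
    qed
    moreover have "amul_left Q e \<psi> (rdelta Q d e M N \<phi>) a r c = 0"
    proof (cases "r < f ?t")
      case True
      then show ?thesis using False by (auto simp: amul_left_def rdelta_def)
    next
      case c: False
      then show ?thesis unfolding amul_left_def using supported_zero[OF \<psi>, of ?t r] by (simp add: vertex_idx_def)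
    qed
    ultimately show ?thesis using False by (auto simp: rdelta_def)
  qed
qed

text \<open>At each vertex the matrix is the identity modulo \<open>t\<close>, so its determinant
  has constant term 1 and is a unit of k[[t]]; the inverse is the adjugate divided by it.\<close>

lemma fps_vertex_inverse:
  fixes G :: "'k::field fps fam"
  assumes G: "supported (vertex_idx n d d) G" and G0: "\<And>v r c. fps_nth (G v r c) 0 = id_fam n d v r c"
  obtains H where "supported (vertex_idx n d d) H" "vmul d G H = id_fam n d" "vmul d H G = id_fam n d"
proof -
  have "\<forall>v\<in>{..<n}. \<exists>S. (\<forall>r<d v. \<forall>c<d v. (\<Sum>j<d v. G v r j * S j c) = (if r = c then 1 else 0)) \<and>
      (\<forall>r<d v. \<forall>c<d v. (\<Sum>j<d v. S r j * G v j c) = (if r = c then 1 else 0))"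
  proof
    fix v assume v: "v \<in> {..<n}"
    obtain S p where S: "(\<forall>i\<in>{..<d v}. \<forall>l\<in>{..<d v}. (\<Sum>j\<in>{..<d v}. G v i j * S j l) = (if i = l then p else 0)) \<and>
      (\<forall>i\<in>{..<d v}. \<forall>l\<in>{..<d v}. (\<Sum>j\<in>{..<d v}. S i j * G v j l) = (if i = l then p else 0)) \<and>
      (\<forall>h :: 'k fps \<Rightarrow> 'k. comm_ring_hom h \<longrightarrow>
       (\<forall>i\<in>{..<d v}. \<forall>l\<in>{..<d v}. h (G v i l) = (if i = l then 1 else 0)) \<longrightarrow> h p = 1)"
      using adjugate_on[of "{..<d v}" "G v"] by blast
    have "fps_nth p 0 = 1"
      by (rule S[THEN conjunct2, THEN conjunct2, rule_format, OF comm_ring_hom_fps_nth_0])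
         (use v in \<open>auto simp: G0 id_fam_def\<close>)
    then have u: "inverse p * p = 1" by (intro inverse_mult_eq_1) simp
    show "\<exists>S. (\<forall>r<d v. \<forall>c<d v. (\<Sum>j<d v. G v r j * S j c) = (if r = c then 1 else 0)) \<and>
      (\<forall>r<d v. \<forall>c<d v. (\<Sum>j<d v. S r j * G v j c) = (if r = c then 1 else 0))"
    proof (intro exI[of _ "\<lambda>r c. inverse p * S r c"] conjI allI impI)
      fix r c assume rc: "r < d v" "c < d v"
      have "(\<Sum>j<d v. G v r j * (inverse p * S j c)) = inverse p * (\<Sum>j<d v. G v r j * S j c)"
        by (simp add: sum_distrib_left ac_simps)
      then show "(\<Sum>j<d v. G v r j * (inverse p * S j c)) = (if r = c then 1 else 0)"
        using S rc u by simp
      have "(\<Sum>j<d v. inverse p * S r j * G v j c) = inverse p * (\<Sum>j<d v. S r j * G v j c)"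
        by (simp add: sum_distrib_left ac_simps)
      then show "(\<Sum>j<d v. inverse p * S r j * G v j c) = (if r = c then 1 else 0)"
        using S rc u by simp
    qed
  qed
  from bchoice[OF this] obtain S where SS: "\<forall>v\<in>{..<n}.
      (\<forall>r<d v. \<forall>c<d v. (\<Sum>j<d v. G v r j * S v j c) = (if r = c then 1 else 0)) \<and>
      (\<forall>r<d v. \<forall>c<d v. (\<Sum>j<d v. S v r j * G v j c) = (if r = c then 1 else 0))" ..
  have S: "(\<Sum>j<d v. G v r j * S v j c) = (if r = c then 1 else 0)"
     "(\<Sum>j<d v. S v r j * G v j c) = (if r = c then 1 else 0)" if "v < n" "r < d v" "c < d v" for v r c
    using SS that by auto
  define H where "H = (\<lambda>v r c. if (v, r, c) \<in> vertex_idx n d d then S v r c else 0)"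
  have H: "supported (vertex_idx n d d) H" unfolding supported_def H_def by auto
  have a: "vmul d G H v r c = id_fam n d v r c" for v r c
  proof (cases "(v, r, c) \<in> vertex_idx n d d")
    case True
    then have "vmul d G H v r c = (\<Sum>j<d v. G v r j * S v j c)"
      unfolding vmul_def by (intro sum.cong) (auto simp: H_def vertex_idx_def)
    then show ?thesis using S(1)[of v r c] True by (auto simp: vertex_idx_def id_fam_def)
  next
    case False
    then show ?thesis using supported_zero[OF supported_vmul[OF G H]] supported_zero[OF supported_id_fam] by metis
  qed
  have b: "vmul d H G v r c = id_fam n d v r c" for v r c
  proof (cases "(v, r, c) \<in> vertex_idx n d d")
    case True
    then have "vmul d H G v r c = (\<Sum>j<d v. S v r j * G v j c)"
      unfolding vmul_def by (intro sum.cong) (auto simp: H_def vertex_idx_def)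
    then show ?thesis using S(2)[of v r c] True by (auto simp: vertex_idx_def id_fam_def)
  next
    case False
    then show ?thesis using supported_zero[OF supported_vmul[OF H G]] supported_zero[OF supported_id_fam] by metis
  qed
  show ?thesis by (rule that[OF H]) (use a b in \<open>auto simp: fun_eq_iff\<close>)
qed

context blocks
begin

text \<open>\<open>Y\<close> is the part of \<open>C\<close> inside the diagonal blocks; what
  remains has only blocks \<open>(i, j)\<close> with \<open>i \<noteq> j\<close>, each in the image
  of \<delta> by hypothesis.\<close>

lemma solve_off_diagonal:
  fixes X :: "nat \<Rightarrow> 'k::comm_ring_1 fam"
  assumes ext: "\<And>i j. i < s \<Longrightarrow> j < s \<Longrightarrow> i \<noteq> j \<Longrightarrow> ext_zero n Q (x i) (x j) (X i) (X j)"
    and C: "supported (arrow_idx Q d d) C"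
  shows "\<exists>\<phi> Y. supported (vertex_idx n d d) \<phi> \<and> diagonal Q Y \<and>
    rdelta Q d d (dsum Q X) (dsum Q X) \<phi> = (\<lambda>a r c. C a r c - Y a r c)"
proof -
  interpret block_pair s x d ix s x d ix by (rule block_pair_self)
  define Y where "Y = (\<lambda>a r c. if lab (snd (Q!a)) r = lab (fst (Q!a)) c then C a r c else 0)"
  have Y: "diagonal Q Y" unfolding diagonal_def using C by (auto simp: Y_def supported_def)
  have "\<exists>\<phi>. supported (vertex_idx n d d) \<phi> \<and> rdelta Q d d (dsum Q X) (dsum Q X) \<phi> = (\<lambda>a r c. C a r c - Y a r c)"
  proof (rule solve_blockwise)
    show "supported (arrow_idx Q d d) (\<lambda>a r c. C a r c - Y a r c)"
      using C unfolding supported_def Y_def by auto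
    fix i j assume ij: "i < s" "j < s"
    show "\<exists>\<phi>. supported (vertex_idx n (x i) (x j)) \<phi> \<and>
       rdelta Q (x i) (x j) (X i) (X j) \<phi> = ablk Q i j (\<lambda>a r c. C a r c - Y a r c)"
    proof (cases "i = j")
      case True
      then have "ablk Q i j (\<lambda>a r c. C a r c - Y a r c) = (\<lambda>a r c. 0)"
        using ix ij by (auto simp: ablk_def Y_def fun_eq_iff)
      moreover have "rdelta Q (x i) (x j) (X i) (X j) (\<lambda>v r c. 0) = (\<lambda>a r c. 0)"
        by (auto simp: rdelta_def fun_eq_iff)
      ultimately show ?thesis by (intro exI[of _ "\<lambda>v r c. 0"]) (auto simp: supported_def)
    next
      case False
      show ?thesis
        using ext[OF ij False] supported_ablk[of Q i j "\<lambda>a r c. C a r c - Y a r c"]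
        unfolding quasi_surj_def by simp
    qed
  qed
  then show ?thesis using Y by blast
qed

text \<open>Order by order, the coefficient of \<open>t\<^sup>m\<close> in \<open>Y G - G L\<close> is \<open>\<delta>(G\<^sub>m) + Y\<^sub>m - C\<close> with \<open>C\<close>
  depending on lower order terms only; the off-diagonal part of \<open>C\<close> is in the image of \<open>\<delta>\<close>.\<close>

lemma block_diagonalisation:
  fixes X :: "nat \<Rightarrow> 'k::field fam" and L :: "'k fps fam"
  assumes ok: "quiver_ok n Q"
    and ext: "\<And>i j. i < s \<Longrightarrow> j < s \<Longrightarrow> i \<noteq> j \<Longrightarrow> ext_zero n Q (x i) (x j) (X i) (X j)"
    and L: "supported (arrow_idx Q d d) L" and L0: "\<And>a r c. fps_nth (L a r c) 0 = dsum Q X a r c"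
  shows "\<exists>G Y. supported (vertex_idx n d d) G \<and> (\<forall>v r c. fps_nth (G v r c) 0 = id_fam n d v r c) \<and>
    diagonal Q Y \<and> (\<forall>a r c. fps_nth (Y a r c) 0 = dsum Q X a r c) \<and> rdelta Q d d L Y G = (\<lambda>a r c. 0)"
proof -
  define A where "A = dsum Q X"
  have A: "supported (arrow_idx Q d d) A" unfolding A_def by (rule supported_dsum)
  \<comment> \<open>\<open>f m\<close> holds the coefficients \<open>(G_m, Y_m)\<close>. From the
    convolution for \<open>Y G - G L\<close> at \<open>t^m\<close> the terms with \<open>G_m\<close>
    or \<open>Y_m\<close> are left out: the range \<open>i < m\<close> of the first sum omits
    \<open>G_m L_0\<close>, the open range of the second omits \<open>Y_0 G_m\<close> and
    \<open>Y_m G_0\<close>.\<close>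
  define C where "C = (\<lambda>(f :: nat \<Rightarrow> 'k fam \<times> 'k fam) m a r c.
      if (a, r, c) \<in> arrow_idx Q d d then
        (\<Sum>i<m. \<Sum>j<d (snd (Q!a)). fst (f i) (snd (Q!a)) r j * fps_nth (L a j c) (m - i))
        - (\<Sum>i\<in>{0<..<m}. \<Sum>j<d (fst (Q!a)). snd (f i) a r j * fst (f (m - i)) (fst (Q!a)) j c)
      else 0)"
  define P where "P = (\<lambda>f m (p :: 'k fam \<times> 'k fam).
      supported (vertex_idx n d d) (fst p) \<and> diagonal Q (snd p) \<and>
      (if m = 0 then p = (id_fam n d, A)
       else rdelta Q d d A A (fst p) = (\<lambda>a r c. C f m a r c - snd p a r c)))"
  \<comment> \<open>Course-of-values recursion: the requirement at \<open>m\<close> refers to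
    \<open>f\<close> only below \<open>m\<close>.\<close>
  have "\<exists>f. \<forall>m. P f m (f m)"
  proof (rule dependent_wf_choice[OF wf_less])
    fix f g :: "nat \<Rightarrow> 'k fam \<times> 'k fam" and m r
    assume "\<And>z. (z, m) \<in> {(x, y). x < y} \<Longrightarrow> f z = g z"
    then have fg: "f z = g z" if "z < m" for z using that by simp
    then have "C f m = C g m" unfolding C_def by (intro HOL.ext) (auto intro!: sum.cong)
    then show "P f m r = P g m r" unfolding P_def by simp
  next
    fix m and f :: "nat \<Rightarrow> 'k fam \<times> 'k fam"
    have sC: "supported (arrow_idx Q d d) (C f m)" unfolding supported_def C_def by simp
    show "\<exists>r. P f m r"
    proof (cases "m = 0")
      case True
      then show ?thesis unfolding P_def
        by (intro exI[of _ "(id_fam n d, A)"]) (simp add: supported_id_fam A_def diagonal_dsum)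
    next
      case False
      obtain \<phi> Y where "supported (vertex_idx n d d) \<phi>" "diagonal Q Y"
        "rdelta Q d d A A \<phi> = (\<lambda>a r c. C f m a r c - Y a r c)"
        using solve_off_diagonal[OF ext sC] unfolding A_def by blast
      then show ?thesis unfolding P_def using False by (intro exI[of _ "(\<phi>, Y)"]) simp
    qed
  qed
  then obtain f where f: "\<And>m. P f m (f m)" by blast
  have f0: "f 0 = (id_fam n d, A)" using f[of 0] unfolding P_def by simp
  have fs: "supported (vertex_idx n d d) (fst (f m))" "diagonal Q (snd (f m))" for m
    using f[of m] unfolding P_def by auto
  have fm: "rdelta Q d d A A (fst (f m)) a r c = C f m a r c - snd (f m) a r c" if "0 < m" for m a r c
    using f[of m] that unfolding P_def by simp
  define G where "G = (\<lambda>v r c. Abs_fps (\<lambda>m. fst (f m) v r c))"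
  define Y where "Y = (\<lambda>a r c. Abs_fps (\<lambda>m. snd (f m) a r c))"
  have sG: "supported (vertex_idx n d d) G" unfolding supported_def
  proof (intro allI impI)
    fix v r c assume "G v r c \<noteq> 0"
    then obtain m where "fst (f m) v r c \<noteq> 0" unfolding G_def by (auto simp: fps_eq_iff)
    then show "(v, r, c) \<in> vertex_idx n d d" using fs(1)[of m] unfolding supported_def by blast
  qed
  have dY: "diagonal Q Y"
  proof -
    have *: "\<exists>m. snd (f m) a r c \<noteq> 0" if "Y a r c \<noteq> 0" for a r c
      using that unfolding Y_def by (auto simp: fps_eq_iff)
    show ?thesis using fs(2) * unfolding diagonal_def supported_def by meson
  qed
  have "rdelta Q d d L Y G a r c = 0" for a r c
  proof (cases "(a, r, c) \<in> arrow_idx Q d d")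
    case True
    let ?s = "fst (Q!a)" and ?t = "snd (Q!a)"
    have *: "a < length Q" "r < d ?t" "c < d ?s" using True by (auto simp: arrow_idx_def)
    note st = quiver_ok_nth[OF ok *(1)]
    show ?thesis
    proof (rule fps_ext)
      fix m
      define U where "U = (\<lambda>i. \<Sum>j<d ?s. snd (f i) a r j * fst (f (m - i)) ?s j c)"
      define W where "W = (\<lambda>i. \<Sum>j<d ?t. fst (f i) ?t r j * fps_nth (L a j c) (m - i))"
      have "fps_nth (rdelta Q d d L Y G a r c) m = (\<Sum>i\<le>m. U i) - (\<Sum>i\<le>m. W i)"
        using * unfolding rdelta_def U_def W_def
        by (simp add: fps_sum_nth fps_mult_nth Y_def G_def atMost_atLeast0)
           (subst (1 2) sum.swap, rule refl)
      also have "\<dots> = 0"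
      proof (cases "m = 0")
        case True
        have "rdelta Q d d A A (id_fam n d) a r c = 0"
          using rdelta_id_fam[OF ok A A] by simp
        then show ?thesis using * True by (simp add: U_def W_def f0 rdelta_def L0 A_def)
      next
        case False
        then have m: "0 < m" by simp
        have U: "(\<Sum>i\<le>m. U i) = U 0 + U m + (\<Sum>i\<in>{0<..<m}. U i)"
        proof -
          have "{..m} = insert 0 (insert m {0<..<m})" using m by auto
          then show ?thesis using m by (simp add: add.assoc)
        qed
        have W: "(\<Sum>i\<le>m. W i) = (\<Sum>i<m. W i) + W m" by (simp add: lessThan_Suc_atMost[symmetric])
        have "U m = (\<Sum>j<d ?s. if j = c then snd (f m) a r c else 0)"
          unfolding U_def using * st by (intro sum.cong) (auto simp: f0 id_fam_def)
        then have Um: "U m = snd (f m) a r c" using * by simp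
        have U0: "U 0 = (\<Sum>j<d ?s. A a r j * fst (f m) ?s j c)" unfolding U_def by (simp add: f0)
        have Wm: "W m = (\<Sum>j<d ?t. fst (f m) ?t r j * A a j c)" unfolding W_def by (simp add: L0 A_def)
        have "U 0 - W m = (\<Sum>i<m. W i) - (\<Sum>i\<in>{0<..<m}. U i) - snd (f m) a r c"
          using fm[OF m, of a r c] * True unfolding U0 Wm unfolding rdelta_def C_def U_def W_def by simp
        then show ?thesis unfolding U W Um by (simp add: algebra_simps)
      qed
      finally show "fps_nth (rdelta Q d d L Y G a r c) m = fps_nth 0 m" by simp
    qed
  next
    case False
    then show ?thesis using supported_zero[OF supported_rdelta] by blast
  qed
  then have "rdelta Q d d L Y G = (\<lambda>a r c. 0)" by (simp add: fun_eq_iff)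
  moreover have "fps_nth (G v r c) 0 = id_fam n d v r c" for v r c by (simp add: G_def f0)
  moreover have "fps_nth (Y a r c) 0 = dsum Q X a r c" for a r c by (simp add: Y_def f0 A_def)
  ultimately show ?thesis using sG dY by blast
qed

end

section \<open>Ext vanishing under change of ring\<close>

lemma rdelta_mat_additive:
  fixes h :: "'a::comm_ring_1 \<Rightarrow> 'b::comm_ring_1"
  assumes h: "\<And>a b. h (a - b) = h a - h b"
  shows "rdelta_mat Q d e (\<lambda>a r c. h (M a r c)) (\<lambda>a r c. h (N a r c)) x y = h (rdelta_mat Q d e M N x y)"
proof -
  have h0: "h 0 = 0" using h[of 0 0] by simp
  have hadd: "h (a + b) = h a + h b" for a b
    using h[of a "0 - b"] h[of 0 b] h0 by simp
  have hsum: "h (sum f A) = (\<Sum>i\<in>A. h (f i))" for f and A :: "nat set"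
    by (induct A rule: infinite_finite_induct) (auto simp: h0 hadd)
  \<comment> \<open>Additivity of \<open>h\<close> is enough, since in every product one factor is
    an entry 0 or 1 of a unit family. The case in view is the extraction of a coefficient, which is
    not multiplicative.\<close>
  have u1: "h (a * unit_fam x v r c) = h a * unit_fam x v r c" for a v r c
    unfolding unit_fam_def by (simp add: h0)
  have u2: "h (unit_fam x v r c * a) = unit_fam x v r c * h a" for a v r c
    unfolding unit_fam_def by (simp add: h0)
  show ?thesis unfolding rdelta_mat_def rdelta_def by (simp add: h hsum u1 u2 h0)
qed

lemma quasi_surj_hom:
  assumes "comm_ring_hom h" and "quasi_surj n Q d e p M N"
  shows "quasi_surj n Q d e (h p) (\<lambda>a r c. h (M a r c)) (\<lambda>a r c. h (N a r c))"
proof -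
  interpret comm_ring_hom h by fact
  obtain S where S: "\<forall>l\<in>arrow_idx Q d e. \<forall>j\<in>arrow_idx Q d e.
     (\<Sum>i\<in>vertex_idx n d e. S l i * rdelta_mat Q d e M N i j) = (if l = j then p else 0)"
    using assms(2) unfolding quasi_surj_iff by blast
  show ?thesis unfolding quasi_surj_iff
  proof (intro exI[of _ "\<lambda>l i. h (S l i)"] ballI)
    fix l j assume "l \<in> arrow_idx Q d e" "j \<in> arrow_idx Q d e"
    then have "h (\<Sum>i\<in>vertex_idx n d e. S l i * rdelta_mat Q d e M N i j) = h (if l = j then p else 0)"
      using S by simp
    then show "(\<Sum>i\<in>vertex_idx n d e. h (S l i) *
        rdelta_mat Q d e (\<lambda>a r c. h (M a r c)) (\<lambda>a r c. h (N a r c)) i j) = (if l = j then h p else 0)"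
      unfolding rdelta_mat_hom[OF assms(1)] by (simp add: hom_distribs split: if_splits)
  qed
qed

lemma quasi_surj_poly_line:
  fixes M M' N N' :: "'k::field fam"
  assumes "ext_zero n Q d e (line M M' t) (line N N' t)"
  obtains p where "p \<noteq> 0" "quasi_surj n Q d e p (poly_line M M') (poly_line N N')"
proof -
  have "surj_mat (vertex_idx n d e) (arrow_idx Q d e)
     (\<lambda>x y. poly (rdelta_mat Q d e (poly_line M M') (poly_line N N') x y) t)"
    using assms unfolding ext_zero_iff_surj_mat rdelta_mat_line .
  from surj_mat_quasi_inverse_poly[OF finite_arrow_idx this] obtain S p where p: "poly p t = 1" and
    S: "\<forall>l\<in>arrow_idx Q d e. \<forall>j\<in>arrow_idx Q d e.
     (\<Sum>i\<in>vertex_idx n d e. S l i * rdelta_mat Q d e (poly_line M M') (poly_line N N') i j) = (if l = j then p else 0)"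
    by blast
  have "p \<noteq> 0" using p by auto
  moreover have "quasi_surj n Q d e p (poly_line M M') (poly_line N N')" unfolding quasi_surj_iff using S by blast
  ultimately show ?thesis using that by blast
qed

text \<open>\<open>G\<close> is an isomorphism from \<open>L\<close> to \<open>Y\<close>: a
  right-hand side for \<open>Y\<close> is pulled back by \<open>H\<close>, solved for
  \<open>L\<close> and pushed forward by \<open>G\<close>.\<close>

lemma quasi_surj_transport:
  fixes B L Y :: "'a::comm_ring_1 fam"
  assumes ok: "quiver_ok n Q" and q: "quasi_surj n Q b d p B L" and G: "supported (vertex_idx n d d) G"
    and H: "supported (vertex_idx n d d) H" and GH: "vmul d G H = id_fam n d"
    and int: "rdelta Q d d L Y G = (\<lambda>a r c. 0)"
  shows "quasi_surj n Q b d p B Y"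
  unfolding quasi_surj_def
proof (intro allI impI)
  fix \<eta> :: "'a fam" assume \<eta>: "supported (arrow_idx Q b d) \<eta>"
  let ?\<eta> = "\<lambda>a r c. if a < length Q then amul_left Q d H \<eta> a r c else 0"
  have "supported (arrow_idx Q b d) ?\<eta>" unfolding supported_def
  proof (intro allI impI)
    fix a r c assume nz: "?\<eta> a r c \<noteq> 0"
    then have a: "a < length Q" "amul_left Q d H \<eta> a r c \<noteq> 0" by (auto split: if_splits)
    then obtain j where "H (snd (Q!a)) r j * \<eta> a j c \<noteq> 0" unfolding amul_left_def by (meson sum.neutral)
    then have "H (snd (Q!a)) r j \<noteq> 0" "\<eta> a j c \<noteq> 0" by auto
    then show "(a, r, c) \<in> arrow_idx Q b d"
      using \<eta> H a unfolding supported_def arrow_idx_def vertex_idx_def by blast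
  qed
  then obtain \<phi> where \<phi>: "supported (vertex_idx n b d) \<phi>" "rdelta Q b d B L \<phi> = (\<lambda>a r c. p * ?\<eta> a r c)"
    using q unfolding quasi_surj_def by blast
  have "rdelta Q b d B Y (vmul d G \<phi>) a r c = p * \<eta> a r c" for a r c
  proof (cases "a < length Q")
    case True
    have "rdelta Q b d B Y (vmul d G \<phi>) a r c = amul_left Q d G (\<lambda>a r c. p * ?\<eta> a r c) a r c"
      unfolding rdelta_vmul[OF \<phi>(1) G, where N=L] int \<phi>(2) by (simp add: amul_right_def)
    also have "\<dots> = p * amul_left Q d G (amul_left Q d H \<eta>) a r c"
      using True by (simp add: amul_left_def[of Q d G] sum_distrib_left ac_simps)
    also have "\<dots> = p * \<eta> a r c"
      unfolding amul_left_vmul[symmetric] GH amul_left_id[OF ok \<eta>] ..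
    finally show ?thesis .
  next
    case False
    then show ?thesis using supported_zero[OF \<eta>, of a r c] by (simp add: rdelta_def arrow_idx_def)
  qed
  then show "\<exists>\<phi>. supported (vertex_idx n b d) \<phi> \<and> rdelta Q b d B Y \<phi> = (\<lambda>a r c. p * \<eta> a r c)"
    using supported_vmul[OF G \<phi>(1)] by blast
qed

lemma comm_ring_hom_fps_of_poly: "comm_ring_hom (fps_of_poly :: 'a::comm_ring_1 poly \<Rightarrow> 'a fps)"
  by unfold_locales (auto simp: fps_of_poly_add fps_of_poly_mult)

text \<open>Truncating the series at a sufficiently high order keeps surjectivity for almost all
  values of \<open>t\<close>; evaluation at such a value gives a representation over the
  field.\<close>

lemma ext_zero_truncate:
  fixes B :: "'k::field_char_0 fam" and Y :: "'k fps fam"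
  assumes p: "p \<noteq> 0" and q: "quasi_surj n Q b e p (\<lambda>a r c. fps_const (B a r c)) Y"
    and Y: "supported (arrow_idx Q e e) Y"
  shows "\<exists>N. is_rep Q e N \<and> ext_zero n Q b e B N"
proof -
  let ?I = "vertex_idx n b e" and ?J = "arrow_idx Q b e"
  let ?B = "\<lambda>a r c. fps_const (B a r c)"
  obtain S where S: "\<forall>l\<in>?J. \<forall>j\<in>?J. (\<Sum>i\<in>?I. S l i * rdelta_mat Q b e ?B Y i j) = (if l = j then p else 0)"
    using q unfolding quasi_surj_iff by blast
  have "\<exists>N. \<forall>T'. (\<forall>i\<in>?I. \<forall>j\<in>?J. \<forall>m<N. coeff (T' i j) m = fps_nth (rdelta_mat Q b e ?B Y i j) m) \<longrightarrow>
    finite {t. \<not> surj_mat ?I ?J (\<lambda>i j. poly (T' i j) t)}"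
    by (rule surj_mat_truncate[OF _ _ p, where S=S]) (use S in auto)
  then obtain N where N: "\<And>T'. (\<forall>i\<in>?I. \<forall>j\<in>?J. \<forall>m<N. coeff (T' i j) m = fps_nth (rdelta_mat Q b e ?B Y i j) m) \<Longrightarrow>
    finite {t. \<not> surj_mat ?I ?J (\<lambda>i j. poly (T' i j) t)}" by blast
  let ?T = "rdelta_mat Q b e (\<lambda>a r c. [:B a r c:]) (\<lambda>a r c. trunc_poly N (Y a r c))"
  have "coeff (?T i j) m = fps_nth (rdelta_mat Q b e ?B Y i j) m" if "m < N" for i j m
  proof -
    have "coeff (?T i j) m = rdelta_mat Q b e (\<lambda>a r c. coeff [:B a r c:] m) (\<lambda>a r c. coeff (trunc_poly N (Y a r c)) m) i j"
      by (rule rdelta_mat_additive[symmetric]) simp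
    also have "(\<lambda>a r c. coeff [:B a r c:] m) = (\<lambda>a r c. fps_nth (fps_const (B a r c)) m)"
      by (auto simp: fun_eq_iff coeff_pCons split: nat.splits)
    also have "(\<lambda>a r c. coeff (trunc_poly N (Y a r c)) m) = (\<lambda>a r c. fps_nth (Y a r c) m)"
      using that by (simp add: coeff_trunc_poly)
    also have "rdelta_mat Q b e (\<lambda>a r c. fps_nth (fps_const (B a r c)) m) (\<lambda>a r c. fps_nth (Y a r c) m) i j
        = fps_nth (rdelta_mat Q b e ?B Y i j) m"
      by (rule rdelta_mat_additive) simp
    finally show ?thesis .
  qed
  then have "finite {t. \<not> surj_mat ?I ?J (\<lambda>i j. poly (?T i j) t)}" using N by blast
  from ex_new_if_finite[OF infinite_UNIV_char_0 this] obtain t where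
    t: "surj_mat ?I ?J (\<lambda>i j. poly (?T i j) t)" by blast
  have "(\<lambda>i j. poly (?T i j) t) = rdelta_mat Q b e (\<lambda>a r c. poly [:B a r c:] t) (\<lambda>a r c. poly (trunc_poly N (Y a r c)) t)"
    by (intro HOL.ext) (rule rdelta_mat_hom[OF comm_ring_hom_poly_eval, symmetric])
  then have "ext_zero n Q b e B (\<lambda>a r c. poly (trunc_poly N (Y a r c)) t)"
    using t unfolding ext_zero_iff_surj_mat by simp
  moreover have "is_rep Q e (\<lambda>a r c. poly (trunc_poly N (Y a r c)) t)"
    unfolding is_rep_iff_supported supported_def
  proof (intro allI impI)
    fix a r c assume "poly (trunc_poly N (Y a r c)) t \<noteq> 0"
    then have "Y a r c \<noteq> 0" by (auto simp: trunc_poly_def)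
    then show "(a, r, c) \<in> arrow_idx Q e e" using Y unfolding supported_def by blast
  qed
  ultimately show ?thesis by blast
qed

text \<open>Ext^1 vanishes at the end \<open>t = 1\<close> of the line, hence over k[t] up to a
  polynomial \<open>p\<close>, hence up to \<open>p\<close> also over k[[t]] at
  \<open>t = 0\<close>. There the line is isomorphic to a block diagonal \<open>Y\<close>, and from
  its \<open>j\<close>-th block, truncated and evaluated, comes the required representation of
  dimension \<open>x j\<close>.\<close>

lemma ext_summand_right:
  fixes K :: "'k::field_char_0 itself" and x :: "nat \<Rightarrow> nat \<Rightarrow> nat" and s :: nat
  assumes ok: "quiver_ok n Q" and d: "\<And>v. d v = (\<Sum>j<s. x j v)"
    and orth: "\<And>i j. i < s \<Longrightarrow> j < s \<Longrightarrow> i \<noteq> j \<Longrightarrow> Defs.ext K n Q (x i) (x j) = 0"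
    and ext: "Defs.ext K n Q b d = 0" and j: "j < s"
  shows "Defs.ext K n Q b (x j) = 0"
proof -
  have "\<exists>X :: nat \<Rightarrow> 'k fam. (\<forall>j<s. is_rep Q (x j) (X j)) \<and>
    (\<forall>(i,j)\<in>{(i,j). i < s \<and> j < s \<and> i \<noteq> j}. ext_zero n Q (x i) (x j) (X i) (X j)) \<and>
    (\<forall>j\<in>{}. brick n Q (x j) (X j))"
    by (rule generic_tuple[OF ok, where K=K]) (use orth in auto)
  then obtain X :: "nat \<Rightarrow> 'k fam" where
    X: "\<And>i j. i < s \<Longrightarrow> j < s \<Longrightarrow> i \<noteq> j \<Longrightarrow> ext_zero n Q (x i) (x j) (X i) (X j)" by auto
  obtain ix where ix: "blocks s x d ix" using blocks_exist[of d x s] d by blast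
  interpret blocks s x d ix by fact
  interpret block_pair s x d ix s x d ix by (rule block_pair_self)
  obtain B N :: "'k rep" where BN: "is_rep Q b B" "is_rep Q d N" "ext_zero n Q b d B N"
    using ext unfolding ext_eq_0_iff by blast
  define A where "A = dsum Q X"
  have A: "is_rep Q d A" unfolding A_def is_rep_iff_supported by (rule supported_dsum)
  \<comment> \<open>\<open>B\<close> is moved along a constant line; only the second argument
    changes.\<close>
  have "ext_zero n Q b d (line B B 1) (line A N 1)" using BN by simp
  then obtain p where p: "p \<noteq> 0" "quasi_surj n Q b d p (poly_line B B) (poly_line A N)"
    by (rule quasi_surj_poly_line)
  define L where "L = (\<lambda>a r c. fps_of_poly (poly_line A N a r c))"
  have BB: "(\<lambda>a r c. fps_of_poly (poly_line B B a r c)) = (\<lambda>a r c. fps_const (B a r c))"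
    by (simp add: poly_line_def fps_of_poly_pCons)
  have q: "quasi_surj n Q b d (fps_of_poly p) (\<lambda>a r c. fps_const (B a r c)) L"
    using quasi_surj_hom[OF comm_ring_hom_fps_of_poly p(2)] unfolding BB L_def .
  have L: "supported (arrow_idx Q d d) L"
    using A BN(2) unfolding is_rep_iff_supported supported_def L_def poly_line_def by (auto simp: fps_of_poly_pCons)
  have L0: "fps_nth (L a r c) 0 = dsum Q X a r c" for a r c
    by (simp add: L_def poly_line_def A_def)
  obtain G Y where G: "supported (vertex_idx n d d) G" "\<And>v r c. fps_nth (G v r c) 0 = id_fam n d v r c"
    and Y: "diagonal Q Y" and int: "rdelta Q d d L Y G = (\<lambda>a r c. 0)"
    using block_diagonalisation[OF ok X L L0] by blast
  obtain H where H: "supported (vertex_idx n d d) H" "vmul d G H = id_fam n d"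
    using fps_vertex_inverse[OF G] by blast
  have "quasi_surj n Q b d (fps_of_poly p) (\<lambda>a r c. fps_const (B a r c)) Y"
    by (rule quasi_surj_transport[OF ok q G(1) H int])
  then have "quasi_surj n Q b d (fps_of_poly p) (\<lambda>a r c. fps_const (B a r c)) (dsum Q (\<lambda>j. ablk Q j j Y))"
    unfolding dsum_diagonal_blocks[OF Y] .
  moreover have "supported (arrow_idx Q b b) (\<lambda>a r c. fps_const (B a r c))"
    using BN(1) unfolding is_rep_iff_supported supported_def by auto
  ultimately have "quasi_surj n Q b (x j) (fps_of_poly p) (\<lambda>a r c. fps_const (B a r c)) (ablk Q j j Y)"
    using j quasi_surj_dsum_right[OF blocks_axioms, where Y="\<lambda>j. ablk Q j j Y"] by simp
  moreover have "fps_of_poly p \<noteq> 0" using p(1) by simp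
  ultimately obtain N' where "is_rep Q (x j) N'" "ext_zero n Q b (x j) B N'"
    using ext_zero_truncate supported_ablk by blast
  then show ?thesis unfolding ext_eq_0_iff using BN(1) by blast
qed

lemma ext_summand_left:
  fixes K :: "'k::field_char_0 itself" and x :: "nat \<Rightarrow> nat \<Rightarrow> nat" and s :: nat
  assumes ok: "quiver_ok n Q" and d: "\<And>v. d v = (\<Sum>j<s. x j v)"
    and orth: "\<And>i j. i < s \<Longrightarrow> j < s \<Longrightarrow> i \<noteq> j \<Longrightarrow> Defs.ext K n Q (x i) (x j) = 0"
    and ext: "Defs.ext K n Q d b = 0" and j: "j < s"
  shows "Defs.ext K n Q (x j) b = 0"
proof -
  have op: "Defs.ext K n (op_quiver Q) (x i) (x j) = 0" if "i < s" "j < s" "i \<noteq> j" for i j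
    unfolding ext_op using orth[OF that(2,1)] that by simp
  show ?thesis
    using ext_summand_right[where K=K and b=b and d=d and x=x and s=s, OF quiver_ok_op[OF ok] d op _ j] ext
    unfolding ext_op by blast
qed

section \<open>Bricks and the Euler form\<close>

text \<open>Surjectivity of \<delta> bounds the dimensions; in terms of the Euler form,
  \<open><x, z>\<close> is nonnegative.\<close>

lemma ext_zero_card:
  fixes K :: "'k::field itself"
  assumes "Defs.ext K n Q x z = 0"
  shows "card (arrow_idx Q x z) \<le> card (vertex_idx n x z)"
proof -
  obtain M N :: "'k rep" where "ext_zero n Q x z M N"
    using assms unfolding ext_eq_0_iff by blast
  then show ?thesis unfolding ext_zero_iff_surj_mat by (rule surj_mat_card[rotated 2]) simp_all
qed

lemma rdelta_add_multiple:
  "rdelta Q d e M (\<lambda>a r c. N a r c + t * \<xi> a r c) \<phi> a r c =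
    rdelta Q d e M N \<phi> a r c + t * rdelta Q d e (\<lambda>_ _ _. 0) \<xi> \<phi> a r c"
  unfolding rdelta_def by (auto simp: sum.distrib sum_distrib_left algebra_simps)

text \<open>If \<open>\<xi>\<close> is not in the image of \<open>\<delta>\<close>, the brick \<open>M\<close> has no nonzero maps to \<open>M + t \<xi>\<close> for
  generic \<open>t\<close>: the map \<open>\<delta>\<close> for this pair, rescaled so that the identity is sent to \<open>\<xi>\<close>, is
  injective at \<open>t = 0\<close>.\<close>

lemma brick_ext_self:
  fixes K :: "'k::field_char_0 itself" and M :: "'k fam"
  assumes ok: "quiver_ok n Q" and b: "brick n Q x M" and v: "v < n" "0 < x v"
    and card: "card (arrow_idx Q x x) \<le> card (vertex_idx n x x)"
  shows "Defs.ext K n Q x x = 0"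
proof (cases "ext_zero n Q x x M M")
  case True
  then show ?thesis using b unfolding ext_eq_0_iff brick_def by blast
next
  case False
  let ?I = "vertex_idx n x x" and ?J = "arrow_idx Q x x" and ?i0 = "(v, 0::nat, 0::nat)"
  have i0: "?i0 \<in> ?I" using v by (simp add: vertex_idx_def)
  have M: "supported ?J M" using b by (simp add: brick_def is_rep_iff_supported)
  obtain \<xi> where \<xi>: "supported ?J \<xi>" and no: "\<And>\<phi>. supported ?I \<phi> \<Longrightarrow> rdelta Q x x M M \<phi> \<noteq> \<xi>"
    using False unfolding quasi_surj_def by auto
  \<comment> \<open>The unit family at \<open>(v, 0, 0)\<close> loses the identity here. For
    \<open>t \<noteq> 0\<close> the matrix \<open>T\<close> belongs to the basis in which this
    vector is moreover increased by the identity divided by \<open>t\<close>; as \<delta> sends the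
    identity to \<open>t \<xi>\<close>, the summand \<open>\<xi>\<close> takes its place and the
    entries stay polynomial.\<close>
  define e :: "nat \<times> nat \<times> nat \<Rightarrow> 'k fam" where
    "e = (\<lambda>i w r c. unit_fam i w r c - (if i = ?i0 then id_fam n x w r c else 0))"
  define T where "T = (\<lambda>i j. [: rdelta Q x x M M (e i) (fst j) (fst (snd j)) (snd (snd j))
       + (if i = ?i0 then \<xi> (fst j) (fst (snd j)) (snd (snd j)) else 0),
     rdelta Q x x (\<lambda>_ _ _. 0) \<xi> (e i) (fst j) (fst (snd j)) (snd (snd j)) :])"
  define N where "N = (\<lambda>t a r c. M a r c + t * \<xi> a r c)"
  have sum_e: "(\<lambda>w r c. \<Sum>i\<in>?I. f i * e i w r c) = (\<lambda>w r c. fam_of ?I f w r c - f ?i0 * id_fam n x w r c)" for f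
  proof (intro HOL.ext)
    fix w r c
    have "(\<Sum>i\<in>?I. f i * e i w r c) = (\<Sum>i\<in>?I. f i * unit_fam i w r c) - (\<Sum>i\<in>?I. if i = ?i0 then f ?i0 * id_fam n x w r c else 0)"
      unfolding sum_subtractf[symmetric] by (intro sum.cong) (auto simp: e_def algebra_simps)
    moreover have "(\<Sum>i\<in>?I. f i * unit_fam i w r c) = (\<Sum>i\<in>?I. if i = (w, r, c) then f (w, r, c) else 0)"
      by (intro sum.cong) (auto simp: unit_fam_def)
    ultimately show "(\<Sum>i\<in>?I. f i * e i w r c) = fam_of ?I f w r c - f ?i0 * id_fam n x w r c"
      using i0 by (simp add: fam_of_def)
  qed
  have T: "(\<Sum>i\<in>?I. f i * poly (T i (a, r, c)) t) =
      rdelta Q x x M (N t) (\<lambda>w r c. fam_of ?I f w r c - f ?i0 * id_fam n x w r c) a r c + f ?i0 * \<xi> a r c" for f a r c t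
  proof -
    have p: "poly (T i (a, r, c)) t = rdelta Q x x M (N t) (e i) a r c + (if i = ?i0 then \<xi> a r c else 0)" for i
      unfolding N_def rdelta_add_multiple by (simp add: T_def)
    have "(\<Sum>i\<in>?I. f i * poly (T i (a, r, c)) t) =
        (\<Sum>i\<in>?I. f i * rdelta Q x x M (N t) (e i) a r c) + (\<Sum>i\<in>?I. if i = ?i0 then f ?i0 * \<xi> a r c else 0)"
      unfolding p sum.distrib[symmetric] by (intro sum.cong) (auto simp: algebra_simps)
    then show ?thesis using i0 unfolding sum_e[symmetric] rdelta_sum by simp
  qed
  have ext0: "fam_of ?I f = (\<lambda>_ _ _. 0) \<longleftrightarrow> (\<forall>i\<in>?I. f i = 0)" for f :: "_ \<Rightarrow> 'k"
    by (auto simp: fam_of_def fun_eq_iff)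
  have "inj_mat ?I ?J (\<lambda>i j. poly (T i j) 0)" unfolding inj_mat_def
  proof (intro allI impI)
    fix f :: "nat \<times> nat \<times> nat \<Rightarrow> 'k"
    let ?F = "\<lambda>w r c. fam_of ?I f w r c - f ?i0 * id_fam n x w r c"
    assume "\<forall>j\<in>?J. (\<Sum>i\<in>?I. f i * poly (T i j) 0) = 0"
    then have z: "rdelta Q x x M M ?F a r c + f ?i0 * \<xi> a r c = 0" if "(a, r, c) \<in> ?J" for a r c
      using that T[of f a r c 0] by (simp add: N_def)
    have z: "rdelta Q x x M M ?F a r c = - f ?i0 * \<xi> a r c" for a r c
    proof (cases "(a, r, c) \<in> ?J")
      case True
      then show ?thesis using z[OF True] by (simp add: eq_neg_iff_add_eq_0)
    next
      case False
      then show ?thesis using supported_zero[OF \<xi>] supported_zero[OF supported_rdelta[of Q x x M M ?F]] by simp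
    qed
    have sF: "supported ?I ?F"
      using supported_fam_of[of ?I f] supported_id_fam[of n x] unfolding supported_def by (metis diff_zero mult_zero_right)
    have f0: "f ?i0 = 0"
    proof (rule ccontr)
      assume nz: "f ?i0 \<noteq> 0"
      have "rdelta Q x x M M (\<lambda>w r c. - inverse (f ?i0) * ?F w r c) = \<xi>"
        unfolding rdelta_scale z using nz by (simp add: fun_eq_iff)
      moreover have "supported ?I (\<lambda>w r c. - inverse (f ?i0) * ?F w r c)"
        using sF unfolding supported_def by (metis mult_zero_right)
      ultimately show False using no by blast
    qed
    have "rdelta Q x x M M (fam_of ?I f) = (\<lambda>a r c. 0)" using z f0 by (simp add: fun_eq_iff)
    then obtain k where k: "fam_of ?I f = (\<lambda>i r c. k * id_fam n x i r c)"
      using b supported_fam_of unfolding brick_def by blast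
    have "k = 0"
      using fun_cong[OF fun_cong[OF fun_cong[OF k, of v], of 0], of 0] f0 v i0 by (simp add: fam_of_def id_fam_def)
    then show "\<forall>i\<in>?I. f i = 0" using k ext0[of f] by simp
  qed
  from inj_mat_open[OF _ _ this] have "finite ({0} \<union> {t. \<not> inj_mat ?I ?J (\<lambda>i j. poly (T i j) t)})" by simp
  from ex_new_if_finite[OF infinite_UNIV_char_0 this] obtain t where
    t: "t \<noteq> 0" "inj_mat ?I ?J (\<lambda>i j. poly (T i j) t)" by blast
  have N: "supported ?J (N t)" using M \<xi> unfolding N_def supported_def by (metis add_0 mult_zero_right)
  have "inj_mat ?I ?J (rdelta_mat Q x x M (N t))" unfolding inj_mat_def
  proof (intro allI impI)
    fix f :: "nat \<times> nat \<times> nat \<Rightarrow> 'k"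
    assume z: "\<forall>j\<in>?J. (\<Sum>i\<in>?I. f i * rdelta_mat Q x x M (N t) i j) = 0"
    have z: "rdelta Q x x M (N t) (fam_of ?I f) a r c = 0" for a r c
      using z rdelta_fam_of[of Q x x M "N t" n f a r c]
        supported_zero[OF supported_rdelta[of Q x x M "N t" "fam_of ?I f"], of a r c]
      by (cases "(a, r, c) \<in> ?J") auto
    \<comment> \<open>\<open>g\<close> gives the coefficients of the same vertex map in the rescaled
      basis: the coefficient at \<open>(v, 0, 0)\<close> is multiplied by \<open>t\<close>, and the
      others are corrected by the multiple of the identity that this introduces.\<close>
    define g where "g = (\<lambda>i. f i + (f ?i0 * t - f ?i0) * id_fam n x (fst i) (fst (snd i)) (snd (snd i)))"
    have g0: "g ?i0 = f ?i0 * t" using v by (simp add: g_def id_fam_def)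
    have "fam_of ?I g w r c - g ?i0 * id_fam n x w r c = fam_of ?I f w r c - f ?i0 * id_fam n x w r c" for w r c
      using supported_zero[OF supported_id_fam[of n x, where 'a='k], of w r c] unfolding g0
      by (auto simp: fam_of_def g_def algebra_simps)
    then have "(\<Sum>i\<in>?I. g i * poly (T i (a, r, c)) t) = 0" for a r c
      unfolding T using z rdelta_id_fam[OF ok M N]
      by (simp add: rdelta_diff rdelta_scale g0) (simp add: N_def)
    then have "\<forall>i\<in>?I. g i = 0" using t(2) unfolding inj_mat_def by (metis prod_cases3)
    moreover from this have "f ?i0 = 0" using g0 i0 t(1) by auto
    ultimately show "\<forall>i\<in>?I. f i = 0" by (simp add: g_def)
  qed
  then have "surj_mat ?I ?J (rdelta_mat Q x x M (N t))"
    by (rule inj_mat_surj_mat[OF finite_vertex_idx finite_arrow_idx _ card])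
  then show ?thesis
    unfolding ext_eq_0_iff ext_zero_iff_surj_mat is_rep_iff_supported using M N by blast
qed

text \<open>After subtraction of a scalar the entry \<open>(v, 0, 0)\<close> vanishes. If the
  coefficients below \<open>t^m\<close> are zero, the one at \<open>t^m\<close> is an endomorphism
  of the brick \<open>M\<close> with that entry zero, hence zero itself.\<close>

lemma brick_fps_endomorphism:
  fixes M :: "'k::field fam" and Y \<phi> :: "'k fps fam"
  assumes ok: "quiver_ok n Q" and b: "brick n Q x M" and v: "v < n" "0 < x v"
    and Y: "supported (arrow_idx Q x x) Y" and Y0: "\<And>a r c. fps_nth (Y a r c) 0 = M a r c"
    and \<phi>: "supported (vertex_idx n x x) \<phi>" "rdelta Q x x Y Y \<phi> = (\<lambda>a r c. 0)"
  shows "\<exists>k. \<phi> = (\<lambda>i r c. k * id_fam n x i r c)"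
proof -
  let ?I = "vertex_idx n x x"
  define \<psi> where "\<psi> = (\<lambda>i r c. \<phi> i r c - \<phi> v 0 0 * id_fam n x i r c)"
  have \<psi>: "supported ?I \<psi>"
    using \<phi>(1) supported_id_fam[of n x, where 'a="'k fps"] unfolding supported_def \<psi>_def by (metis diff_zero mult_zero_right)
  have d\<psi>: "rdelta Q x x Y Y \<psi> a r c = 0" for a r c
    unfolding \<psi>_def rdelta_diff rdelta_scale \<phi>(2) rdelta_id_fam[OF ok Y Y] by simp
  have v0: "\<psi> v 0 0 = 0" using v by (simp add: \<psi>_def id_fam_def)
  have "\<forall>i r c. fps_nth (\<psi> i r c) m = 0" for m
  proof (induction m rule: less_induct)
    case (less m)
    let ?p = "\<lambda>i r c. fps_nth (\<psi> i r c) m"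
    have mult: "fps_nth (f * \<psi> i r c) m = fps_nth f 0 * fps_nth (\<psi> i r c) m" for f i r c
    proof -
      have "fps_nth (f * \<psi> i r c) m = (\<Sum>l\<in>{0..m}. if l = 0 then fps_nth f 0 * fps_nth (\<psi> i r c) m else 0)"
        unfolding fps_mult_nth using less by (intro sum.cong) auto
      then show ?thesis by simp
    qed
    have mult': "fps_nth (\<psi> i r c * f) m = fps_nth (\<psi> i r c) m * fps_nth f 0" for f i r c
      using mult[of f i r c] by (simp add: mult.commute)
    have "rdelta Q x x M M ?p a r c = fps_nth (rdelta Q x x Y Y \<psi> a r c) m" for a r c
      unfolding rdelta_def by (simp add: fps_sum_nth mult mult' Y0)
    then have "rdelta Q x x M M ?p = (\<lambda>a r c. 0)" by (simp add: d\<psi> fun_eq_iff)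
    moreover have "supported ?I ?p"
      using supported_zero[OF \<psi>] unfolding supported_def by (metis fps_zero_nth)
    ultimately obtain k where k: "?p = (\<lambda>i r c. k * id_fam n x i r c)" using b unfolding brick_def by blast
    have "k = 0"
      using fun_cong[OF fun_cong[OF fun_cong[OF k, of v], of 0], of 0] v v0 by (simp add: id_fam_def)
    then show ?case using k by (metis mult_zero_left)
  qed
  then have z: "\<psi> i r c = 0" for i r c by (simp add: fps_eq_iff)
  have "\<phi> i r c = \<phi> v 0 0 * id_fam n x i r c" for i r c
    using z[of i r c] unfolding \<psi>_def by (rule eq_iff_diff_eq_0[THEN iffD2])
  then have "\<phi> = (\<lambda>i r c. \<phi> v 0 0 * id_fam n x i r c)" by (intro HOL.ext)
  then show ?thesis by (rule exI)
qed

section \<open>Traces on endomorphism rings\<close>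

definition endo :: "nat \<Rightarrow> quiver \<Rightarrow> (nat \<Rightarrow> nat) \<Rightarrow> 'a::comm_ring_1 fam \<Rightarrow> 'a fam \<Rightarrow> bool" where
  "endo n Q d L \<phi> \<longleftrightarrow> supported (vertex_idx n d d) \<phi> \<and> rdelta Q d d L L \<phi> = (\<lambda>a r c. 0)"

definition vtrace :: "(nat \<Rightarrow> nat) \<Rightarrow> 'a::comm_ring_1 fam \<Rightarrow> nat \<Rightarrow> 'a" where
  "vtrace d \<phi> v = (\<Sum>r<d v. \<phi> v r r)"

text \<open>What a decomposition into bricks of dimensions \<open>x j\<close> leaves behind in the
  endomorphism ring: the corner at \<open>E j\<close> consists of scalar multiples of
  \<open>E j\<close>, and in characteristic zero the traces of \<open>E j\<close> recover
  \<open>x j\<close>.\<close>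

definition brick_idempotents :: "nat \<Rightarrow> quiver \<Rightarrow> (nat \<Rightarrow> nat) \<Rightarrow> 'a::comm_ring_1 fam \<Rightarrow>
    nat \<Rightarrow> (nat \<Rightarrow> nat \<Rightarrow> nat) \<Rightarrow> (nat \<Rightarrow> 'a fam) \<Rightarrow> bool" where
  "brick_idempotents n Q d L s x E \<longleftrightarrow>
     (\<forall>j<s. endo n Q d L (E j) \<and> vmul d (E j) (E j) = E j \<and>
        (\<forall>v<n. vtrace d (E j) v = of_nat (x j v)) \<and>
        (\<forall>\<phi>. endo n Q d L \<phi> \<longrightarrow> (\<exists>k. vmul d (E j) (vmul d \<phi> (E j)) = (\<lambda>v r c. k * E j v r c)))) \<and>
     (\<forall>v r c. (\<Sum>j<s. E j v r c) = id_fam n d v r c)"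

lemma rdelta_vmul_zero:
  assumes "supported (vertex_idx n d e) \<phi>" "supported (vertex_idx n e f) \<psi>"
    and "rdelta Q d e M N \<phi> = (\<lambda>a r c. 0)" "rdelta Q e f N P \<psi> = (\<lambda>a r c. 0)"
  shows "rdelta Q d f M P (vmul e \<psi> \<phi>) = (\<lambda>a r c. 0)"
  unfolding rdelta_vmul[OF assms(1,2), where N=N] assms(3,4) by (simp add: amul_left_def amul_right_def)

lemma endo_vmul: "endo n Q d L \<phi> \<Longrightarrow> endo n Q d L \<psi> \<Longrightarrow> endo n Q d L (vmul d \<phi> \<psi>)"
  unfolding endo_def using supported_vmul rdelta_vmul_zero by blast

lemma vtrace_vmul_commute: "vtrace d (vmul d \<phi> \<psi>) v = vtrace d (vmul d \<psi> \<phi>) v"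
  unfolding vtrace_def vmul_def by (subst sum.swap) (simp add: mult.commute)

lemma vtrace_scale: "vtrace d (\<lambda>v r c. k * \<phi> v r c) v = k * vtrace d \<phi> v"
  unfolding vtrace_def by (simp add: sum_distrib_left)

lemma vmul_scale_left: "vmul d (\<lambda>v r c. k * \<phi> v r c) \<psi> = (\<lambda>v r c. k * vmul d \<phi> \<psi> v r c)"
  unfolding vmul_def by (simp add: sum_distrib_left mult.assoc)

lemma vmul_scale_right: "vmul d \<phi> (\<lambda>v r c. k * \<psi> v r c) = (\<lambda>v r c. k * vmul d \<phi> \<psi> v r c)"
  unfolding vmul_def by (simp add: sum_distrib_left ac_simps)

lemma vtrace_idempotent_sandwich:
  assumes "vmul d e e = e"
  shows "vtrace d (vmul d \<phi> e) v = vtrace d (vmul d e (vmul d \<phi> e)) v"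
proof -
  have "vtrace d (vmul d e (vmul d \<phi> e)) v = vtrace d (vmul d (vmul d \<phi> e) e) v"
    by (rule vtrace_vmul_commute)
  then show ?thesis by (simp add: vmul_assoc assms)
qed

lemma vtrace_decompose:
  assumes \<phi>: "supported (vertex_idx n d d) \<phi>" and one: "\<And>v r c. (\<Sum>j<s. E j v r c) = id_fam n d v r c"
  shows "vtrace d \<phi> v = (\<Sum>j<s. vtrace d (vmul d \<phi> (E j)) v)"
proof -
  have "(\<Sum>j<s. vtrace d (vmul d \<phi> (E j)) v) = (\<Sum>r<d v. \<Sum>l<d v. \<phi> v r l * (\<Sum>j<s. E j v l r))"
    unfolding vtrace_def vmul_def
    by (subst sum.swap, intro sum.cong refl, subst sum.swap) (simp add: sum_distrib_left)
  also have "\<dots> = vtrace d (vmul d \<phi> (id_fam n d)) v"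
    unfolding one vtrace_def vmul_def ..
  also have "\<dots> = vtrace d \<phi> v" unfolding vmul_id_right[OF \<phi>] ..
  finally show ?thesis by simp
qed

text \<open>The two-sided ideal of endomorphisms all of whose multiples have trace vector parallel to \<open>z\<close>
  only sees the brick whose dimension vector is parallel to \<open>z\<close>.\<close>

lemma trace_parallel_ideal:
  fixes L :: "'a::{idom,semiring_char_0} fam"
  assumes E: "brick_idempotents n Q d L s x E" and \<phi>: "endo n Q d L \<phi>"
    and par: "\<And>\<psi> u v. endo n Q d L \<psi> \<Longrightarrow> u < n \<Longrightarrow> v < n \<Longrightarrow>
       of_nat (z u) * vtrace d (vmul d \<phi> \<psi>) v = of_nat (z v) * vtrace d (vmul d \<phi> \<psi>) u"
    and uniq: "\<And>i j. i < s \<Longrightarrow> j < s \<Longrightarrow> \<forall>u<n. \<forall>v<n. z u * x i v = z v * x i u \<Longrightarrow>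
       \<forall>u<n. \<forall>v<n. z u * x j v = z v * x j u \<Longrightarrow> i = j"
  shows "(\<forall>v<n. vtrace d \<phi> v = 0) \<or> (\<exists>j<s. \<exists>c. (\<forall>u<n. \<forall>v<n. z u * x j v = z v * x j u) \<and>
     (\<forall>v<n. vtrace d \<phi> v = c * of_nat (x j v) \<and> vtrace d (vmul d \<phi> \<phi>) v = c * c * of_nat (x j v)))"
proof -
  define p where "p = (\<lambda>j. \<forall>u<n. \<forall>v<n. z u * x j v = z v * x j u)"
  have E1: "endo n Q d L (E j)" "vmul d (E j) (E j) = E j" "\<And>v. v < n \<Longrightarrow> vtrace d (E j) v = of_nat (x j v)"
    "\<And>\<phi>. endo n Q d L \<phi> \<Longrightarrow> \<exists>k. vmul d (E j) (vmul d \<phi> (E j)) = (\<lambda>v r c. k * E j v r c)" if "j < s" for j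
    using E that unfolding brick_idempotents_def by blast+
  have one: "(\<Sum>j<s. E j v r c) = id_fam n d v r c" for v r c
    using E unfolding brick_idempotents_def by blast
  have s\<phi>: "supported (vertex_idx n d d) \<phi>" using \<phi> by (simp add: endo_def)
  \<comment> \<open>For a brick \<open>i\<close> off the ray of \<open>z\<close>, the corner of
    \<open>\<phi> \<psi>\<close> at \<open>E i\<close> is a scalar \<open>k\<close> with trace
    vector \<open>k x_i\<close>; as a trace vector of the ideal it is also parallel to
    \<open>z\<close>, so \<open>k = 0\<close>.\<close>
  have key: "vtrace d (vmul d (vmul d \<phi> \<psi>) (E i)) v = 0" if i: "i < s" and np: "\<not> p i" and \<psi>: "endo n Q d L \<psi>"
    and v: "v < n" for i \<psi> v
  proof -
    obtain k where k: "vmul d (E i) (vmul d (vmul d \<phi> \<psi>) (E i)) = (\<lambda>v r c. k * E i v r c)"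
      using E1(4)[OF i endo_vmul[OF \<phi> \<psi>]] by blast
    have tr: "vtrace d (vmul d (vmul d \<phi> \<psi>) (E i)) v = k * of_nat (x i v)" if "v < n" for v
      unfolding vtrace_idempotent_sandwich[OF E1(2)[OF i]] k vtrace_scale using E1(3)[OF i that] by simp
    obtain u w where uw: "u < n" "w < n" "z u * x i w \<noteq> z w * x i u" using np unfolding p_def by blast
    have "of_nat (z u) * vtrace d (vmul d \<phi> (vmul d \<psi> (E i))) w = of_nat (z w) * vtrace d (vmul d \<phi> (vmul d \<psi> (E i))) u"
      by (rule par[OF endo_vmul[OF \<psi> E1(1)[OF i]] uw(1,2)])
    then have "k * of_nat (z u * x i w) = k * of_nat (z w * x i u)"
      using tr[OF uw(1)] tr[OF uw(2)] by (simp add: vmul_assoc ac_simps)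
    then have "k = 0" using uw(3) by (simp only: mult_cancel_left of_nat_eq_iff) simp
    then show ?thesis using tr[OF v] by simp
  qed
  have id: "endo n Q d L \<psi> \<Longrightarrow> vmul d \<psi> (id_fam n d) = \<psi>" for \<psi>
    unfolding endo_def using vmul_id_right by blast
  have key1: "vtrace d (vmul d \<phi> (E i)) v = 0" if i: "i < s" and np: "\<not> p i" and v: "v < n" for i v
    using key[OF i np E1(1)[OF i] v] by (simp add: vmul_assoc E1(2)[OF i])
  have tr1: "vtrace d \<phi> v = (\<Sum>i<s. if p i then vtrace d (vmul d \<phi> (E i)) v else 0)" if "v < n" for v
    unfolding vtrace_decompose[OF s\<phi> one] using key1 that by (intro sum.cong) auto
  show ?thesis
  proof (cases "\<exists>j<s. p j")
    case False
    then show ?thesis using tr1 by simp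
  next
    case True
    then obtain j where j: "j < s" "p j" by blast
    have pj: "p i \<longleftrightarrow> i = j" if "i < s" for i using uniq[OF that j(1)] j unfolding p_def by blast
    obtain c where c: "vmul d (E j) (vmul d \<phi> (E j)) = (\<lambda>v r c'. c * E j v r c')"
      using E1(4)[OF j(1) \<phi>] by blast
    have "vtrace d \<phi> v = c * of_nat (x j v)" if v: "v < n" for v
    proof -
      have "vtrace d \<phi> v = (\<Sum>i<s. if i = j then vtrace d (vmul d \<phi> (E j)) v else 0)"
        unfolding tr1[OF v] using pj by (intro sum.cong) auto
      also have "\<dots> = vtrace d (vmul d \<phi> (E j)) v" using j(1) by simp
      finally show ?thesis
        unfolding vtrace_idempotent_sandwich[OF E1(2)[OF j(1)]] c vtrace_scale using E1(3)[OF j(1) v] by simp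
    qed
    \<comment> \<open>The trace of the square matters because the ray determines \<open>x j\<close>
      only up to a factor: a second equation is what later separates \<open>c\<close> from
      \<open>x j\<close>.\<close>
    moreover have "vtrace d (vmul d \<phi> \<phi>) v = c * c * of_nat (x j v)" if v: "v < n" for v
    proof -
      \<comment> \<open>\<open>t i l\<close> is the trace of \<open>\<phi> E_l \<phi> E_i\<close>.
        It vanishes if \<open>i \<noteq> j\<close>, by \<open>key\<close> with
        \<open>\<psi> = E_l \<phi>\<close>, and by its symmetry also if
        \<open>l \<noteq> j\<close>.\<close>
      define t where "t = (\<lambda>i l. vtrace d (vmul d (vmul d (vmul d \<phi> (E l)) \<phi>) (E i)) v)"
      have s2: "supported (vertex_idx n d d) (vmul d \<phi> \<phi>)" using supported_vmul s\<phi> by blast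
      have "vtrace d (vmul d \<phi> \<phi>) v = (\<Sum>i<s. vtrace d (vmul d (vmul d \<phi> \<phi>) (E i)) v)"
        by (rule vtrace_decompose[OF s2 one])
      also have "\<dots> = (\<Sum>i<s. \<Sum>l<s. t i l)"
      proof (intro sum.cong refl)
        fix i assume i: "i \<in> {..<s}"
        have s3: "supported (vertex_idx n d d) (vmul d (vmul d \<phi> (E i)) \<phi>)"
          using supported_vmul s\<phi> E1(1) i unfolding endo_def by blast
        have "vtrace d (vmul d (vmul d \<phi> \<phi>) (E i)) v = vtrace d (vmul d (vmul d \<phi> (E i)) \<phi>) v"
          using vtrace_vmul_commute[of d \<phi> "vmul d \<phi> (E i)" v] by (simp add: vmul_assoc)
        also have "\<dots> = (\<Sum>l<s. vtrace d (vmul d (vmul d (vmul d \<phi> (E i)) \<phi>) (E l)) v)"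
          by (rule vtrace_decompose[OF s3 one])
        also have "\<dots> = (\<Sum>l<s. t i l)"
        proof (intro sum.cong refl)
          fix l
          show "vtrace d (vmul d (vmul d (vmul d \<phi> (E i)) \<phi>) (E l)) v = t i l"
            unfolding t_def using vtrace_vmul_commute[of d "vmul d \<phi> (E i)" "vmul d \<phi> (E l)" v]
            by (simp add: vmul_assoc)
        qed
        finally show "vtrace d (vmul d (vmul d \<phi> \<phi>) (E i)) v = (\<Sum>l<s. t i l)" .
      qed
      also have "\<dots> = (\<Sum>i<s. \<Sum>l<s. if i = j \<and> l = j then t j j else 0)"
      proof (intro sum.cong refl)
        fix i l assume il: "i \<in> {..<s}" "l \<in> {..<s}"
        have z1: "t a b = 0" if "a < s" "b < s" "a \<noteq> j" for a b
          using key[OF that(1) _ endo_vmul[OF E1(1)[OF that(2)] \<phi>] v] pj[OF that(1)] that(3)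
          unfolding t_def by (simp add: vmul_assoc)
        have sym: "t i l = t l i"
          unfolding t_def using vtrace_vmul_commute[of d "vmul d \<phi> (E l)" "vmul d \<phi> (E i)" v]
          by (simp add: vmul_assoc)
        show "t i l = (if i = j \<and> l = j then t j j else 0)"
          using z1[of i l] z1[of l i] sym il by auto
      qed
      also have "\<dots> = (\<Sum>i<s. if i = j then t j j else 0)"
        using j(1) by (intro sum.cong) auto
      also have "\<dots> = t j j" using j(1) by simp
      also have "t j j = vtrace d (vmul d (E j) (vmul d (vmul d (vmul d \<phi> (E j)) \<phi>) (E j))) v"
        unfolding t_def by (rule vtrace_idempotent_sandwich[OF E1(2)[OF j(1)]])
      also have "vmul d (E j) (vmul d (vmul d (vmul d \<phi> (E j)) \<phi>) (E j)) =
          vmul d (vmul d (E j) (vmul d \<phi> (E j))) (vmul d (E j) (vmul d \<phi> (E j)))"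
      proof -
        have "vmul d (vmul d (E j) (vmul d \<phi> (E j))) (vmul d (E j) (vmul d \<phi> (E j))) =
            vmul d (E j) (vmul d \<phi> (vmul d (vmul d (E j) (E j)) (vmul d \<phi> (E j))))"
          by (simp only: vmul_assoc)
        then show ?thesis unfolding E1(2)[OF j(1)] by (simp only: vmul_assoc)
      qed
      also have "\<dots> = (\<lambda>v r c'. c * (c * E j v r c'))"
        unfolding c vmul_scale_left vmul_scale_right E1(2)[OF j(1)] ..
      also have "vtrace d (\<lambda>v r c'. c * (c * E j v r c')) v = c * c * of_nat (x j v)"
        unfolding vtrace_scale using E1(3)[OF j(1) v] by simp
      finally show ?thesis .
    qed
    ultimately show ?thesis using j unfolding p_def by blast
  qed
qed

lemma amul_right_vmul: "amul_right Q e (amul_right Q d \<eta> \<phi>) \<psi> = amul_right Q d \<eta> (vmul e \<phi> \<psi>)"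
  unfolding vmul_def amul_right_def sum_distrib_left sum_distrib_right
  by (intro HOL.ext) (subst sum.swap, simp add: mult.assoc)

lemma amul_right_id:
  assumes ok: "quiver_ok n Q" and \<eta>: "supported (arrow_idx Q d e) \<eta>"
  shows "amul_right Q d \<eta> (id_fam n d) = \<eta>"
proof (intro HOL.ext)
  fix a r c
  have "amul_right Q d \<eta> (id_fam n d) a r c = (\<Sum>j<d (fst (Q!a)). if j = c then \<eta> a r c else 0)"
    unfolding amul_right_def using supported_zero[OF \<eta>] quiver_ok_nth[OF ok, of a]
    by (intro sum.cong) (auto simp: id_fam_def arrow_idx_def)
  then show "amul_right Q d \<eta> (id_fam n d) a r c = \<eta> a r c"
    using supported_zero[OF \<eta>, of a r c] by (auto simp: arrow_idx_def)
qed

text \<open>\<open>H G\<close> is the identity and so has image 0 under \<delta>; the product rule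
  leaves \<open>\<delta>(H) G = 0\<close>, and \<open>G\<close> is cancelled by
  \<open>H\<close>.\<close>

lemma rdelta_inverse:
  assumes ok: "quiver_ok n Q" and L: "supported (arrow_idx Q d d) L"
    and G: "supported (vertex_idx n d d) G" and H: "supported (vertex_idx n d d) H"
    and inv: "vmul d G H = id_fam n d" "vmul d H G = id_fam n d"
    and int: "rdelta Q d d L Y G = (\<lambda>a r c. 0)"
  shows "rdelta Q d d Y L H = (\<lambda>a r c. 0)"
proof -
  have "(\<lambda>a r c. 0) = rdelta Q d d L L (vmul d H G)"
    unfolding inv rdelta_id_fam[OF ok L L] by simp
  also have "\<dots> = amul_right Q d (rdelta Q d d Y L H) G"
    unfolding rdelta_vmul[OF G H, where N=Y] int by (simp add: amul_left_def)
  finally have "amul_right Q d (amul_right Q d (rdelta Q d d Y L H) G) H = (\<lambda>a r c. 0)"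
    by (metis (no_types, lifting) amul_right_def mult_zero_left sum.neutral)
  then show ?thesis
    unfolding amul_right_vmul inv amul_right_id[OF ok supported_rdelta] .
qed

context blocks
begin

text \<open>\<open>G\<close> carries \<open>L\<close> to a block diagonal \<open>Y\<close> over
  k[[t]]; the idempotents are the block projections of \<open>Y\<close> conjugated back by
  \<open>G\<close>. Their corners come from endomorphisms of the diagonal blocks of
  \<open>Y\<close>, which deform the bricks \<open>X j\<close> and so have only scalar
  endomorphisms.\<close>

lemma brick_idempotents_exist:
  fixes X :: "nat \<Rightarrow> 'k::field fam" and L :: "'k fps fam"
  assumes ok: "quiver_ok n Q"
    and ext: "\<And>i j. i < s \<Longrightarrow> j < s \<Longrightarrow> i \<noteq> j \<Longrightarrow> ext_zero n Q (x i) (x j) (X i) (X j)"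
    and brick: "\<And>j. j < s \<Longrightarrow> brick n Q (x j) (X j)" and ne: "\<And>j. j < s \<Longrightarrow> \<exists>v<n. 0 < x j v"
    and L: "supported (arrow_idx Q d d) L" and L0: "\<And>a r c. fps_nth (L a r c) 0 = dsum Q X a r c"
  shows "\<exists>E. brick_idempotents n Q d L s x E"
proof -
  interpret block_pair s x d ix s x d ix by (rule block_pair_self)
  obtain G Y where G: "supported (vertex_idx n d d) G" "\<And>v r c. fps_nth (G v r c) 0 = id_fam n d v r c"
    and Y: "diagonal Q Y" "\<And>a r c. fps_nth (Y a r c) 0 = dsum Q X a r c"
    and int: "rdelta Q d d L Y G = (\<lambda>a r c. 0)"
    using block_diagonalisation[OF ok ext L L0] by blast
  obtain H where H: "supported (vertex_idx n d d) H" and inv: "vmul d G H = id_fam n d" "vmul d H G = id_fam n d"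
    using fps_vertex_inverse[OF G] by blast
  have intH: "rdelta Q d d Y L H = (\<lambda>a r c. 0)" by (rule rdelta_inverse[OF ok L G(1) H inv int])
  define P :: "nat \<Rightarrow> 'k fps fam" where
    "P = (\<lambda>j v r c. if v < n \<and> r < d v \<and> r = c \<and> lab v r = j then 1 else 0)"
  have sP: "supported (vertex_idx n d d) (P j)" for j
    unfolding supported_def P_def vertex_idx_def by auto
  have sY: "supported (arrow_idx Q d d) Y" using Y unfolding diagonal_def by blast
  have leftP: "vmul d (P j) \<phi> v r c = (if lab v r = j then \<phi> v r c else 0)"
    if "supported (vertex_idx n d d) \<phi>" for j \<phi> v r c
  proof -
    have "vmul d (P j) \<phi> v r c = (\<Sum>l<d v. if l = r then (if lab v r = j then \<phi> v r c else 0) else 0)"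
      unfolding vmul_def using supported_zero[OF that] by (intro sum.cong) (auto simp: P_def vertex_idx_def)
    then show ?thesis using supported_zero[OF that, of v r c] by (auto simp: vertex_idx_def)
  qed
  have rightP: "vmul d \<phi> (P j) v r c = (if lab v c = j then \<phi> v r c else 0)"
    if "supported (vertex_idx n d d) \<phi>" for j \<phi> v r c
  proof -
    have "vmul d \<phi> (P j) v r c = (\<Sum>l<d v. if l = c then (if lab v c = j then \<phi> v r c else 0) else 0)"
      unfolding vmul_def using supported_zero[OF that] by (intro sum.cong) (auto simp: P_def vertex_idx_def)
    then show ?thesis using supported_zero[OF that, of v r c] by (auto simp: vertex_idx_def)
  qed
  have PP: "vmul d (P j) (P j) = P j" for j
    by (intro HOL.ext) (simp only: leftP[OF sP], simp add: P_def)
  have dP: "rdelta Q d d Y Y (P j) = (\<lambda>a r c. 0)" for j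
  proof (intro HOL.ext)
    fix a r c
    let ?s = "fst (Q!a)" and ?t = "snd (Q!a)"
    show "rdelta Q d d Y Y (P j) a r c = 0"
    proof (cases "(a, r, c) \<in> arrow_idx Q d d")
      case True
      then have *: "a < length Q" "r < d ?t" "c < d ?s" by (auto simp: arrow_idx_def)
      note st = quiver_ok_nth[OF ok *(1)]
      have "(\<Sum>l<d ?s. Y a r l * P j ?s l c) = (\<Sum>l<d ?s. if l = c then (if lab ?s c = j then Y a r c else 0) else 0)"
        using * st by (intro sum.cong) (auto simp: P_def)
      moreover have "(\<Sum>l<d ?t. P j ?t r l * Y a l c) = (\<Sum>l<d ?t. if l = r then (if lab ?t r = j then Y a r c else 0) else 0)"
        using * st by (intro sum.cong) (auto simp: P_def)
      moreover have "Y a r c = 0 \<or> lab ?t r = lab ?s c" using Y(1) unfolding diagonal_def by blast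
      ultimately show ?thesis using * by (auto simp: rdelta_def)
    next
      case False
      then show ?thesis using supported_zero[OF supported_rdelta] by blast
    qed
  qed
  define E where "E = (\<lambda>j. vmul d H (vmul d (P j) G))"
  have sPG: "supported (vertex_idx n d d) (vmul d (P j) G)" for j using supported_vmul[OF sP G(1)] .
  have sE: "supported (vertex_idx n d d) (E j)" for j unfolding E_def by (rule supported_vmul[OF H sPG])
  have dE: "rdelta Q d d L L (E j) = (\<lambda>a r c. 0)" for j
    unfolding E_def
    by (rule rdelta_vmul_zero[OF sPG H _ intH], rule rdelta_vmul_zero[OF G(1) sP int dP])
  have GE: "vmul d G (E j) = vmul d (P j) G" for j
  proof -
    have "vmul d G (E j) = vmul d (vmul d G H) (vmul d (P j) G)" by (simp only: E_def vmul_assoc)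
    then show ?thesis unfolding inv vmul_id_left[OF sPG] .
  qed
  have EE: "vmul d (E j) (E j) = E j" for j
  proof -
    have "vmul d (E j) (E j) = vmul d (vmul d H (vmul d (P j) G)) (E j)"
      by (simp only: E_def)
    also have "\<dots> = vmul d H (vmul d (P j) (vmul d G (E j)))" by (simp only: vmul_assoc)
    also have "\<dots> = vmul d H (vmul d (vmul d (P j) (P j)) G)" unfolding GE by (simp only: vmul_assoc)
    finally show ?thesis unfolding PP by (simp add: E_def)
  qed
  have trE: "vtrace d (E j) v = of_nat (x j v)" if j: "j < s" and v: "v < n" for j v
  proof -
    have "vtrace d (E j) v = vtrace d (vmul d (vmul d (P j) G) H) v"
      unfolding E_def by (rule vtrace_vmul_commute)
    also have "vmul d (vmul d (P j) G) H = P j"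
      unfolding vmul_assoc inv by (rule vmul_id_right[OF sP])
    also have "vtrace d (P j) v = (\<Sum>r<d v. if lab v r = j then 1 else 0)"
      unfolding vtrace_def using v by (intro sum.cong) (auto simp: P_def)
    also have "\<dots> = (\<Sum>m<x j v. if lab v (ix v (j, m)) = j then 1 else 0)"
      by (rule sum_one_block[OF j]) simp
    also have "\<dots> = of_nat (x j v)" using local.ix(2)[OF j] by simp
    finally show ?thesis .
  qed
  have one: "(\<Sum>j<s. E j v r c) = id_fam n d v r c" for v r c
  proof -
    have P1: "(\<Sum>j<s. P j v l m) = id_fam n d v l m" for l m
    proof -
      have "(\<Sum>j<s. P j v l m) = (\<Sum>j<s. if j = lab v l then id_fam n d v l m else 0)"
        by (intro sum.cong) (auto simp: P_def id_fam_def)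
      then show ?thesis using lab_pos(1)[of l v] by (auto simp: id_fam_def)
    qed
    have "(\<Sum>j<s. E j v r c) = (\<Sum>l<d v. H v r l * (\<Sum>m<d v. (\<Sum>j<s. P j v l m) * G v m c))"
      unfolding E_def vmul_def sum_distrib_left sum_distrib_right
      by (rule trans[OF sum.swap], rule sum.cong[OF refl], rule sum.swap)
    also have "\<dots> = vmul d H (vmul d (id_fam n d) G) v r c" unfolding P1 vmul_def ..
    finally show ?thesis unfolding vmul_id_left[OF G(1)] inv .
  qed
  have scalar: "\<exists>k. vmul d (E j) (vmul d \<phi> (E j)) = (\<lambda>v r c. k * E j v r c)"
    if j: "j < s" and \<phi>: "endo n Q d L \<phi>" for j \<phi>
  proof -
    define \<phi>' where "\<phi>' = vmul d G (vmul d \<phi> H)"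
    have s\<phi>: "supported (vertex_idx n d d) \<phi>" "rdelta Q d d L L \<phi> = (\<lambda>a r c. 0)" using \<phi> by (auto simp: endo_def)
    have s\<phi>H: "supported (vertex_idx n d d) (vmul d \<phi> H)" by (rule supported_vmul[OF s\<phi>(1) H])
    have s\<phi>': "supported (vertex_idx n d d) \<phi>'" unfolding \<phi>'_def by (rule supported_vmul[OF G(1) s\<phi>H])
    have d\<phi>': "rdelta Q d d Y Y \<phi>' = (\<lambda>a r c. 0)"
      unfolding \<phi>'_def
      by (rule rdelta_vmul_zero[OF s\<phi>H G(1) _ int], rule rdelta_vmul_zero[OF H s\<phi>(1) intH s\<phi>(2)])
    let ?Y = "\<lambda>j. ablk Q j j Y"
    have "rdelta Q (x j) (x j) (?Y j) (?Y j) (vblk j j \<phi>') = ablk Q j j (rdelta Q d d (dsum Q ?Y) (dsum Q ?Y) \<phi>')"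
      by (rule ablk_rdelta[OF j j, symmetric])
    also have "\<dots> = (\<lambda>a r c. 0)"
      unfolding dsum_diagonal_blocks[OF Y(1)] d\<phi>' by (simp add: ablk_def)
    finally have dz: "rdelta Q (x j) (x j) (?Y j) (?Y j) (vblk j j \<phi>') = (\<lambda>a r c. 0)" .
    have Y0: "fps_nth (ablk Q j j Y a r c) 0 = X j a r c" for a r c
    proof -
      have "supported (arrow_idx Q (x j) (x j)) (X j)" using brick[OF j] by (simp add: brick_def is_rep_iff_supported)
      then show ?thesis
        using local.ix[OF j] supported_zero[of "arrow_idx Q (x j) (x j)" "X j" a r c]
        by (auto simp: ablk_def Y(2) dsum_def arrow_idx_def)
    qed
    obtain w where w: "w < n" "0 < x j w" using ne[OF j] by blast
    obtain k where k: "vblk j j \<phi>' = (\<lambda>v r c. k * id_fam n (x j) v r c)"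
      using brick_fps_endomorphism[OF ok brick[OF j] w supported_ablk Y0 supported_vblk[OF s\<phi>' j j] dz] by blast
    have PfP: "vmul d (P j) (vmul d \<phi>' (P j)) = (\<lambda>v r c. k * P j v r c)"
    proof (intro HOL.ext)
      fix v r c
      have e: "vmul d (P j) (vmul d \<phi>' (P j)) v r c = (if lab v r = j \<and> lab v c = j then \<phi>' v r c else 0)"
        by (simp add: leftP[OF supported_vmul[OF s\<phi>' sP]] rightP[OF s\<phi>'])
      show "vmul d (P j) (vmul d \<phi>' (P j)) v r c = k * P j v r c"
      proof (cases "v < n \<and> r < d v \<and> c < d v \<and> lab v r = j \<and> lab v c = j")
        case True
        then have l: "pos v r < x j v" "ix v (j, pos v r) = r" "pos v c < x j v" "ix v (j, pos v c) = c"
          using lab_pos[of r v] lab_pos[of c v] by auto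
        have "\<phi>' v r c = vblk j j \<phi>' v (pos v r) (pos v c)" using l by (simp add: vblk_def)
        also have "\<dots> = k * id_fam n (x j) v (pos v r) (pos v c)" unfolding k ..
        also have "id_fam n (x j) v (pos v r) (pos v c) = (P j v r c :: 'k fps)"
        proof -
          have "pos v r = pos v c \<longleftrightarrow> r = c" using l by metis
          then show ?thesis using True l by (simp add: id_fam_def P_def)
        qed
        finally show ?thesis using e True by simp
      next
        case False
        then have "(lab v r = j \<and> lab v c = j \<longrightarrow> \<phi>' v r c = 0) \<and> P j v r c = 0"
          using supported_zero[OF s\<phi>', of v r c] by (auto simp: vertex_idx_def P_def)
        then show ?thesis using e by auto
      qed
    qed
    have "vmul d (E j) (vmul d \<phi> (E j)) = vmul d H (vmul d (vmul d (P j) (vmul d \<phi>' (P j))) G)"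
      unfolding E_def \<phi>'_def by (simp only: vmul_assoc)
    also have "\<dots> = (\<lambda>v r c. k * E j v r c)"
      unfolding PfP vmul_scale_left vmul_scale_right E_def ..
    finally show ?thesis by (rule exI)
  qed
  show ?thesis
    unfolding brick_idempotents_def
    by (intro exI[of _ E] conjI allI impI one EE trE scalar) (auto simp: endo_def sE dE)
qed

end

section \<open>Descent from power series to polynomials\<close>

text \<open>The extension of an injective \<open>h\<close> to fractions, through a chosen numerator
  and denominator; \<open>fract_embed_Fract\<close> shows that the choice does not matter.\<close>

definition fract_embed :: "('a::idom \<Rightarrow> 'b::field) \<Rightarrow> 'a fract \<Rightarrow> 'b" where
  "fract_embed h q = h (fst (SOME p. q = Fract (fst p) (snd p) \<and> snd p \<noteq> 0)) /
     h (snd (SOME p. q = Fract (fst p) (snd p) \<and> snd p \<noteq> 0))"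

lemma fract_embed_Fract:
  assumes "comm_ring_hom h" "\<forall>a. h a = 0 \<longrightarrow> a = 0" "b \<noteq> 0"
  shows "fract_embed h (Fract a b) = h a / h b"
proof -
  interpret comm_ring_hom h by fact
  define p where "p = (SOME p. Fract a b = Fract (fst p) (snd p) \<and> snd p \<noteq> 0)"
  have "Fract a b = Fract (fst p) (snd p) \<and> snd p \<noteq> 0"
    unfolding p_def by (rule someI[of _ "(a, b)"]) (use assms(3) in simp)
  then have "a * snd p = fst p * b" "snd p \<noteq> 0" using assms(3) by (auto simp: eq_fract)
  then have "h a * h (snd p) = h (fst p) * h b" by (metis hom_mult)
  moreover have "h b \<noteq> 0" "h (snd p) \<noteq> 0" using assms(2,3) \<open>snd p \<noteq> 0\<close> by blast+
  ultimately show ?thesis unfolding fract_embed_def p_def[symmetric] by (simp add: field_simps)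
qed

text \<open>Laurent series form a vector space over the fraction field of the domain of
  \<open>h\<close>, and a nonzero vector \<open>s\<close> is part of a basis, so some linear
  functional takes the value 1 on it.\<close>

lemma fract_functional:
  fixes h :: "'a::idom \<Rightarrow> 'k::field fps"
  assumes h: "comm_ring_hom h" and inj: "\<forall>a. h a = 0 \<longrightarrow> a = 0" and s: "s \<noteq> 0"
  shows "\<exists>lam :: 'k fps \<Rightarrow> 'a fract. (\<forall>a b. lam (a + b) = lam a + lam b) \<and> (\<forall>p a. lam (h p * a) = Fract p 1 * lam a) \<and> lam s \<noteq> 0"
proof -
  interpret h: comm_ring_hom h by fact
  define g where "g = (\<lambda>a. fps_to_fls (h a))"
  have g: "comm_ring_hom g"
    by unfold_locales (auto simp: g_def h.hom_add h.hom_mult fls_times_fps_to_fls)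
  interpret g: comm_ring_hom g by fact
  have ginj: "\<forall>a. g a = 0 \<longrightarrow> a = 0" using inj by (simp add: g_def)
  define \<iota> where "\<iota> = fract_embed g"
  have \<iota>: "\<iota> (Fract a b) = g a / g b" if "b \<noteq> 0" for a b
    unfolding \<iota>_def by (rule fract_embed_Fract[OF g ginj that])
  have g0: "g b \<noteq> 0" if "b \<noteq> 0" for b using that ginj by blast
  define sc where "sc = (\<lambda>(c::'a fract) (x::'k fls). \<iota> c * x)"
  have iadd: "\<iota> (p + q) = \<iota> p + \<iota> q" for p q
    by (cases p, cases q) (simp add: \<iota> g.hom_add g.hom_mult g0 field_simps)
  have imult: "\<iota> (p * q) = \<iota> p * \<iota> q" for p q
    by (cases p, cases q) (simp add: \<iota> g.hom_mult)
  have i1: "\<iota> 1 = 1" by (simp add: One_fract_def \<iota>)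
  interpret E: vector_space sc
    by unfold_locales (auto simp: sc_def iadd imult i1 algebra_simps)
  interpret F: vector_space "(*) :: 'a fract \<Rightarrow> 'a fract \<Rightarrow> 'a fract"
    by unfold_locales (auto simp: algebra_simps)
  interpret EF: vector_space_pair sc "(*) :: 'a fract \<Rightarrow> 'a fract \<Rightarrow> 'a fract" by unfold_locales
  have "E.independent {fps_to_fls s}" using s by simp
  from EF.linear_independent_extend[OF this, of "\<lambda>_. 1"] obtain l where
    l: "Vector_Spaces.linear sc (*) l" "l (fps_to_fls s) = 1" by auto
  interpret l: Vector_Spaces.linear sc "(*)" l by fact
  show ?thesis
  proof (intro exI[of _ "\<lambda>a. l (fps_to_fls a)"] conjI allI)
    fix p a
    have "l (sc (Fract p 1) (fps_to_fls a)) = Fract p 1 * l (fps_to_fls a)" by (rule l.scale)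
    then show "l (fps_to_fls (h p * a)) = Fract p 1 * l (fps_to_fls a)"
      by (simp add: sc_def \<iota> g_def fls_times_fps_to_fls)
  qed (use l in \<open>auto simp: l.add\<close>)
qed

lemma Fract_1_eq_iff: "Fract a 1 = Fract b 1 \<longleftrightarrow> a = (b :: 'a::idom)"
  unfolding eq_fract(1)[OF one_neq_zero one_neq_zero] by simp

lemma Fract_1_eq_0_iff: "Fract a 1 = 0 \<longleftrightarrow> a = (0 :: 'a::idom)"
  unfolding Zero_fract_def Fract_1_eq_iff ..

lemma common_denominator:
  fixes f :: "'c \<Rightarrow> 'a::idom fract"
  assumes "finite S"
  obtains q where "q \<noteq> 0" "\<And>s. s \<in> S \<Longrightarrow> \<exists>p. Fract p 1 = Fract q 1 * f s"
proof -
  have "\<exists>q. q \<noteq> 0 \<and> (\<forall>s\<in>S. \<exists>p. Fract p 1 = Fract q 1 * f s)"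
    using assms
  proof (induction S rule: finite_induct)
    case empty
    then show ?case by (intro exI[of _ 1]) simp
  next
    case (insert x S)
    then obtain q where q: "q \<noteq> 0" "\<And>s. s \<in> S \<Longrightarrow> \<exists>p. Fract p 1 = Fract q 1 * f s" by blast
    obtain a b where ab: "f x = Fract a b" "b \<noteq> 0" by (cases "f x") auto
    show ?case
    proof (rule exI[of _ "q * b"], intro conjI ballI)
      show "q * b \<noteq> 0" using q ab by simp
      fix s assume s: "s \<in> insert x S"
      show "\<exists>p. Fract p 1 = Fract (q * b) 1 * f s"
      proof (cases "s = x")
        case True
        then show ?thesis using ab by (intro exI[of _ "q * a"]) (simp add: eq_fract)
      next
        case False
        then obtain p where p: "Fract p 1 = Fract q 1 * f s" using q s by blast
        have "Fract (b * p) 1 = Fract b 1 * Fract p 1" by simp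
        also have "\<dots> = (Fract b 1 * Fract q 1) * f s" unfolding p by (rule mult.assoc[symmetric])
        also have "Fract b 1 * Fract q 1 = Fract (q * b) 1" by (simp add: mult.commute)
        finally show ?thesis by (rule exI)
      qed
    qed
  qed
  then show ?thesis using that by blast
qed

lemma comm_ring_hom_Fract: "comm_ring_hom (\<lambda>p::'a::idom. Fract p 1)"
  by unfold_locales (auto simp: One_fract_def Zero_fract_def)

text \<open>Being an endomorphism is a linear condition with coefficients in the image of
  \<open>h\<close>, so it survives the entrywise application of \<open>lam\<close>; a common
  denominator \<open>q\<close> then removes the fractions. The freedom in \<open>lam\<close> is used
  to keep one chosen scalar \<open>s\<close> nonzero.\<close>

lemma descend_endomorphism:
  fixes h :: "'a::idom \<Rightarrow> 'k::field fps"
  assumes h: "comm_ring_hom h" and inj: "\<forall>a. h a = 0 \<longrightarrow> a = 0" and s: "s \<noteq> 0"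
    and \<psi>: "endo n Q d (\<lambda>a r c. h (L a r c)) \<psi>"
  shows "\<exists>lam q p \<phi>. (\<forall>a b. lam (a + b) = lam a + lam b) \<and> (\<forall>p a. lam (h p * a) = Fract p 1 * lam a) \<and> lam s \<noteq> 0 \<and> q \<noteq> 0 \<and>
    Fract p 1 = Fract q 1 * lam 1 \<and> endo n Q d L \<phi> \<and> (\<forall>v r c. Fract (\<phi> v r c) 1 = Fract q 1 * lam (\<psi> v r c))"
proof -
  obtain lam :: "'k fps \<Rightarrow> 'a fract" where
    add: "\<And>a b. lam (a + b) = lam a + lam b" and scale: "\<And>p a. lam (h p * a) = Fract p 1 * lam a"
    and nz: "lam s \<noteq> 0" using fract_functional[OF h inj s] by blast
  have l0: "lam 0 = 0" using add[of 0 0] by (metis add.right_neutral add_left_cancel)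
  have lsum: "lam (sum f A) = (\<Sum>i\<in>A. lam (f i))" for f and A :: "nat set"
    by (induct A rule: infinite_finite_induct) (auto simp: l0 add)
  have ldiff: "lam (a - b) = lam a - lam b" for a b using add[of "a - b" b] by (simp add: algebra_simps)
  \<comment> \<open>The series 1 joins the entries so that \<open>q\<close> is a denominator of
    \<open>lam 1\<close> too; this is where \<open>p\<close> comes from.\<close>
  let ?S = "insert 1 ((\<lambda>(v, r, c). \<psi> v r c) ` vertex_idx n d d)"
  obtain q where q: "q \<noteq> 0" "\<And>s. s \<in> ?S \<Longrightarrow> \<exists>p. Fract p 1 = Fract q 1 * lam s"
    using common_denominator[of ?S lam] by (metis finite_imageI finite_insert finite_vertex_idx)
  obtain p where p: "Fract p 1 = Fract q 1 * lam 1" using q(2)[of 1] by blast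
  have s\<psi>: "supported (vertex_idx n d d) \<psi>" and d\<psi>: "rdelta Q d d (\<lambda>a r c. h (L a r c)) (\<lambda>a r c. h (L a r c)) \<psi> = (\<lambda>a r c. 0)"
    using \<psi> by (auto simp: endo_def)
  have ex: "\<exists>p. Fract p 1 = Fract q 1 * lam (\<psi> v r c)" for v r c
  proof (cases "(v, r, c) \<in> vertex_idx n d d")
    case True
    then show ?thesis by (intro q(2)) (auto intro!: rev_image_eqI)
  next
    case False
    then show ?thesis using supported_zero[OF s\<psi>] l0 by (intro exI[of _ 0]) (simp add: Fract_1_eq_0_iff)
  qed
  define \<phi> where "\<phi> = (\<lambda>v r c. SOME p. Fract p 1 = Fract q 1 * lam (\<psi> v r c))"
  have \<phi>: "Fract (\<phi> v r c) 1 = Fract q 1 * lam (\<psi> v r c)" for v r c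
    unfolding \<phi>_def by (rule someI_ex[OF ex])
  interpret F: comm_ring_hom "\<lambda>p::'a. Fract p 1" by (rule comm_ring_hom_Fract)
  have F0: "a = 0" if "Fract a 1 = (0 :: 'a fract)" for a using that unfolding Fract_1_eq_0_iff .
  have s\<phi>: "supported (vertex_idx n d d) \<phi>" unfolding supported_def
  proof (intro allI impI, rule ccontr)
    fix v r c assume "\<phi> v r c \<noteq> 0" "(v, r, c) \<notin> vertex_idx n d d"
    then show False using \<phi>[of v r c] supported_zero[OF s\<psi>, of v r c] l0 F0 by fastforce
  qed
  have "rdelta Q d d L L \<phi> a r c = 0" for a r c
  proof (rule F0)
    have 1: "Fract (f * \<phi> v r c) 1 = Fract q 1 * lam (h f * \<psi> v r c)" for f v r c
      using \<phi>[of v r c] by (simp only: F.hom_mult scale ac_simps)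
    have 2: "Fract (\<phi> v r c * f) 1 = Fract q 1 * lam (\<psi> v r c * h f)" for f v r c
      using 1[of f v r c] by (simp only: mult.commute)
    have "Fract (rdelta Q d d L L \<phi> a r c) 1 = Fract q 1 * lam (rdelta Q d d (\<lambda>a r c. h (L a r c)) (\<lambda>a r c. h (L a r c)) \<psi> a r c)"
      unfolding rdelta_def
      by (auto simp only: F.hom_minus F.hom_sum 1 2 ldiff lsum l0 F.hom_zero sum_distrib_left[symmetric]
          right_diff_distrib mult_zero_right split: if_split)
    then show "Fract (rdelta Q d d L L \<phi> a r c) 1 = 0" unfolding d\<psi> l0 by simp
  qed
  then have "endo n Q d L \<phi>" using s\<phi> by (simp add: endo_def fun_eq_iff)
  with add scale nz q(1) p \<phi> show ?thesis
    by (intro exI[of _ lam] exI[of _ q] exI[of _ p] exI[of _ \<phi>] conjI allI)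
qed

lemma endo_hom:
  assumes h: "comm_ring_hom h" and \<phi>: "endo n Q d L \<phi>"
  shows "endo n Q d (\<lambda>a r c. h (L a r c)) (\<lambda>v r c. h (\<phi> v r c))"
proof -
  interpret comm_ring_hom h by fact
  have "rdelta Q d d (\<lambda>a r c. h (L a r c)) (\<lambda>a r c. h (L a r c)) (\<lambda>v r c. h (\<phi> v r c)) a r c =
      h (rdelta Q d d L L \<phi> a r c)" for a r c
    unfolding rdelta_def by (simp add: hom_distribs)
  moreover have "supported (vertex_idx n d d) (\<lambda>v r c. h (\<phi> v r c))"
    using \<phi> unfolding endo_def supported_def by (metis hom_zero)
  ultimately show ?thesis using \<phi> by (simp add: endo_def fun_eq_iff)
qed

lemma vtrace_vmul_hom:
  assumes h: "comm_ring_hom h"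
  shows "vtrace d (vmul d (\<lambda>v r c. h (\<phi> v r c)) (\<lambda>v r c. h (\<psi> v r c))) v = h (vtrace d (vmul d \<phi> \<psi>) v)"
    "vtrace d (\<lambda>v r c. h (\<phi> v r c)) v = h (vtrace d \<phi> v)"
proof -
  interpret comm_ring_hom h by fact
  show "vtrace d (vmul d (\<lambda>v r c. h (\<phi> v r c)) (\<lambda>v r c. h (\<psi> v r c))) v = h (vtrace d (vmul d \<phi> \<psi>) v)"
    "vtrace d (\<lambda>v r c. h (\<phi> v r c)) v = h (vtrace d \<phi> v)"
    unfolding vtrace_def vmul_def by (simp_all add: hom_distribs)
qed

text \<open>\<open>lam\<close> is linear over the small ring but not multiplicative, so it is
  compatible with the trace of a product as long as one factor is defined over that ring.\<close>

lemma vtrace_vmul_functional: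
  fixes h :: "'a::idom \<Rightarrow> 'k::field fps" and lam :: "'k fps \<Rightarrow> 'a fract"
  assumes add: "\<And>a b. lam (a + b) = lam a + lam b" and scale: "\<And>p a. lam (h p * a) = Fract p 1 * lam a"
    and \<psi>': "\<And>v r c. Fract (\<psi>' v r c) 1 = Fract q 1 * lam (\<psi> v r c)"
  shows "Fract (vtrace d (vmul d \<phi> \<psi>') v) 1 = Fract q 1 * lam (vtrace d (vmul d (\<lambda>v r c. h (\<phi> v r c)) \<psi>) v)"
    "Fract (vtrace d \<psi>' v) 1 = Fract q 1 * lam (vtrace d \<psi> v)"
proof -
  have l0: "lam 0 = 0" using add[of 0 0] by (metis add.right_neutral add_left_cancel)
  have lsum: "lam (sum f A) = (\<Sum>i\<in>A. lam (f i))" for f and A :: "nat set"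
    by (induct A rule: infinite_finite_induct) (auto simp: l0 add)
  interpret F: comm_ring_hom "\<lambda>p::'a. Fract p 1" by (rule comm_ring_hom_Fract)
  have 1: "Fract (f * \<psi>' v r c) 1 = Fract q 1 * lam (h f * \<psi> v r c)" for f v r c
    using \<psi>'[of v r c] by (simp only: F.hom_mult scale ac_simps)
  show "Fract (vtrace d (vmul d \<phi> \<psi>') v) 1 = Fract q 1 * lam (vtrace d (vmul d (\<lambda>v r c. h (\<phi> v r c)) \<psi>) v)"
    unfolding vtrace_def vmul_def by (simp only: F.hom_sum 1 lsum sum_distrib_left)
  show "Fract (vtrace d \<psi>' v) 1 = Fract q 1 * lam (vtrace d \<psi> v)"
    unfolding vtrace_def by (simp only: F.hom_sum \<psi>' lsum sum_distrib_left)
qed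

text \<open>The difference of the two sides of a violated equation is a nonzero series; a functional
  that does not kill it turns the violation into one by an endomorphism over the small ring.\<close>

lemma parallel_traces_base_change:
  fixes h :: "'a::idom \<Rightarrow> 'k::field fps"
  assumes h: "comm_ring_hom h" and inj: "\<forall>a. h a = 0 \<longrightarrow> a = 0"
    and par: "\<And>\<psi>. endo n Q d L \<psi> \<Longrightarrow> of_nat a * vtrace d (vmul d \<phi> \<psi>) v = of_nat b * vtrace d (vmul d \<phi> \<psi>) u"
    and \<psi>: "endo n Q d (\<lambda>a r c. h (L a r c)) \<psi>"
  shows "of_nat a * vtrace d (vmul d (\<lambda>v r c. h (\<phi> v r c)) \<psi>) v = of_nat b * vtrace d (vmul d (\<lambda>v r c. h (\<phi> v r c)) \<psi>) u"
proof (rule ccontr)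
  let ?t = "\<lambda>v. vtrace d (vmul d (\<lambda>v r c. h (\<phi> v r c)) \<psi>) v"
  interpret h: comm_ring_hom h by fact
  interpret F: comm_ring_hom "\<lambda>p::'a. Fract p 1" by (rule comm_ring_hom_Fract)
  assume "of_nat a * ?t v \<noteq> of_nat b * ?t u"
  then have "of_nat a * ?t v - of_nat b * ?t u \<noteq> 0" by simp
  from descend_endomorphism[OF h inj this \<psi>] obtain lam q p \<psi>' where D:
    "(\<forall>a b. lam (a + b) = lam a + lam b) \<and> (\<forall>p a. lam (h p * a) = Fract p 1 * lam a) \<and> lam (of_nat a * ?t v - of_nat b * ?t u) \<noteq> 0 \<and> q \<noteq> 0 \<and>
    Fract p 1 = Fract q 1 * lam 1 \<and> endo n Q d L \<psi>' \<and> (\<forall>v r c. Fract (\<psi>' v r c) 1 = Fract q 1 * lam (\<psi> v r c))"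
    by (elim exE)
  then have add: "\<And>a b. lam (a + b) = lam a + lam b" and scale: "\<And>p a. lam (h p * a) = Fract p 1 * lam a"
    and nz: "lam (of_nat a * ?t v - of_nat b * ?t u) \<noteq> 0" "q \<noteq> 0"
    and \<psi>': "endo n Q d L \<psi>'" "\<And>v r c. Fract (\<psi>' v r c) 1 = Fract q 1 * lam (\<psi> v r c)"
    by blast+
  have ldiff: "lam (a - b) = lam a - lam b" for a b using add[of "a - b" b] by (simp add: algebra_simps)
  have sn: "lam (of_nat m * x) = Fract (of_nat m) 1 * lam x" for m x
    using scale[of "of_nat m" x] by (simp add: h.hom_of_nat)
  note T = vtrace_vmul_functional(1)[where h=h and lam=lam and \<psi>'=\<psi>' and \<psi>=\<psi> and q=q and d=d and \<phi>=\<phi>, OF add scale \<psi>'(2)]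
  have "Fract q 1 * lam (of_nat a * ?t v - of_nat b * ?t u) =
      Fract (of_nat a) 1 * (Fract q 1 * lam (?t v)) - Fract (of_nat b) 1 * (Fract q 1 * lam (?t u))"
    unfolding ldiff sn by (simp only: right_diff_distrib ac_simps)
  also have "\<dots> = Fract (of_nat a * vtrace d (vmul d \<phi> \<psi>') v - of_nat b * vtrace d (vmul d \<phi> \<psi>') u) 1"
    unfolding T[symmetric] by (simp only: F.hom_mult F.hom_minus)
  also have "\<dots> = 0" using par[OF \<psi>'(1)] by (simp add: Fract_1_eq_0_iff)
  finally show False using nz by (simp add: Fract_1_eq_0_iff)
qed

text \<open>The idempotent \<open>E i\<close> at the end \<open>h\<close> descends to
  \<open>\<phi>\<close> with trace vector \<open>p x_i\<close>, all of whose multiples have traces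
  parallel to \<open>x_i\<close>. Read at the end \<open>h'\<close>, the traces of
  \<open>\<phi>\<close> and of its square give \<open>h' p x_i = c y_j\<close> and
  \<open>(h' p)^2 x_i = c^2 y_j\<close>, which forces \<open>c = h' p\<close> and
  \<open>y_j = x_i\<close>.\<close>

lemma common_brick:
  fixes h h' :: "'a::{idom,semiring_char_0} \<Rightarrow> 'k::field_char_0 fps"
  assumes h: "comm_ring_hom h" "\<forall>a. h a = 0 \<longrightarrow> a = 0" and h': "comm_ring_hom h'" "\<forall>a. h' a = 0 \<longrightarrow> a = 0"
    and E: "brick_idempotents n Q d (\<lambda>a r c. h (L a r c)) s x E"
    and F: "brick_idempotents n Q d (\<lambda>a r c. h' (L a r c)) s' y F"
    and i: "i < s" and ne: "w < n" "0 < x i w"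
    and ux: "\<And>j. j < s \<Longrightarrow> \<forall>u<n. \<forall>v<n. x i u * x j v = x i v * x j u \<Longrightarrow> j = i"
    and uy: "\<And>j l. j < s' \<Longrightarrow> l < s' \<Longrightarrow> \<forall>u<n. \<forall>v<n. x i u * y j v = x i v * y j u \<Longrightarrow>
       \<forall>u<n. \<forall>v<n. x i u * y l v = x i v * y l u \<Longrightarrow> j = l"
  shows "\<exists>j<s'. \<forall>v<n. y j v = x i v"
proof -
  interpret h: comm_ring_hom h by fact
  interpret h': comm_ring_hom h' by fact
  interpret Fr: comm_ring_hom "\<lambda>p::'a. Fract p 1" by (rule comm_ring_hom_Fract)
  have Finj: "a = b" if "Fract a 1 = (Fract b 1 :: 'a fract)" for a b using that unfolding Fract_1_eq_iff .
  have E1: "endo n Q d (\<lambda>a r c. h (L a r c)) (E i)" "vmul d (E i) (E i) = E i" "\<And>v. v < n \<Longrightarrow> vtrace d (E i) v = of_nat (x i v)"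
    "\<And>\<phi>. endo n Q d (\<lambda>a r c. h (L a r c)) \<phi> \<Longrightarrow> \<exists>k. vmul d (E i) (vmul d \<phi> (E i)) = (\<lambda>v r c. k * E i v r c)"
    using E i unfolding brick_idempotents_def by blast+
  from descend_endomorphism[OF h one_neq_zero E1(1)] obtain lam q p \<phi> where D:
    "(\<forall>a b. lam (a + b) = lam a + lam b) \<and> (\<forall>p a. lam (h p * a) = Fract p 1 * lam a) \<and> lam 1 \<noteq> 0 \<and> q \<noteq> 0 \<and>
    Fract p 1 = Fract q 1 * lam 1 \<and> endo n Q d L \<phi> \<and> (\<forall>v r c. Fract (\<phi> v r c) 1 = Fract q 1 * lam (E i v r c))"
    by (elim exE)
  then have add: "\<And>a b. lam (a + b) = lam a + lam b" and scale: "\<And>p a. lam (h p * a) = Fract p 1 * lam a"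
    and nz: "lam 1 \<noteq> 0" "q \<noteq> 0" and p: "Fract p 1 = Fract q 1 * lam 1"
    and \<phi>: "endo n Q d L \<phi>" "\<And>v r c. Fract (\<phi> v r c) 1 = Fract q 1 * lam (E i v r c)"
    by blast+
  have p0: "p \<noteq> 0" using p nz by (metis Fract_1_eq_0_iff mult_eq_0_iff)
  have sn: "lam (of_nat m * a) = Fract (of_nat m) 1 * lam a" for m a
    using scale[of "of_nat m" a] by (simp add: h.hom_of_nat)
  have tr: "vtrace d \<phi> v = p * of_nat (x i v)" if v: "v < n" for v
  proof (rule Finj)
    have "Fract (vtrace d \<phi> v) 1 = Fract q 1 * lam (of_nat (x i v) * 1)"
      using vtrace_vmul_functional(2)[where h=h and lam=lam, OF add scale \<phi>(2)] E1(3)[OF v] by simp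
    then show "Fract (vtrace d \<phi> v) 1 = Fract (p * of_nat (x i v)) 1"
      unfolding sn Fr.hom_mult p by (simp only: ac_simps)
  qed
  \<comment> \<open>By cyclicity the trace of \<open>\<phi> \<psi>\<close> descends from the trace
    of \<open>\<psi> E_i\<close>, which is a scalar times \<open>x_i\<close>.\<close>
  have par: "of_nat (x i u) * vtrace d (vmul d \<phi> \<psi>) v = of_nat (x i v) * vtrace d (vmul d \<phi> \<psi>) u"
    if \<psi>: "endo n Q d L \<psi>" and uv: "u < n" "v < n" for \<psi> u v
  proof -
    let ?h\<psi> = "\<lambda>v r c. h (\<psi> v r c)"
    obtain k where k: "vmul d (E i) (vmul d ?h\<psi> (E i)) = (\<lambda>v r c. k * E i v r c)"
      using E1(4)[OF endo_hom[OF h(1) \<psi>]] by blast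
    have t: "Fract (vtrace d (vmul d \<phi> \<psi>) v) 1 = Fract q 1 * (Fract (of_nat (x i v)) 1 * lam k)" if "v < n" for v
    proof -
      have "Fract (vtrace d (vmul d \<phi> \<psi>) v) 1 = Fract (vtrace d (vmul d \<psi> \<phi>) v) 1"
        by (subst vtrace_vmul_commute) simp
      also have "\<dots> = Fract q 1 * lam (vtrace d (vmul d ?h\<psi> (E i)) v)"
        by (rule vtrace_vmul_functional(1)[where h=h and lam=lam, OF add scale \<phi>(2)])
      also have "vtrace d (vmul d ?h\<psi> (E i)) v = of_nat (x i v) * k"
        unfolding vtrace_idempotent_sandwich[OF E1(2)] k vtrace_scale E1(3)[OF that] by (simp add: mult.commute)
      finally show ?thesis unfolding sn .
    qed
    show ?thesis by (rule Finj) (simp only: Fr.hom_mult t[OF uv(1)] t[OF uv(2)] ac_simps)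
  qed
  have cancel: "c = a" if "a * of_nat m = c * of_nat m" "m \<noteq> 0" for a c :: "'k fps" and m
    using that by simp
  \<comment> \<open>Descent does not respect squares, so this trace is found indirectly: at the end
    \<open>h\<close> the ideal sees only brick \<open>i\<close>, comparing the traces of
    \<open>\<phi>\<close> gives \<open>c = h p\<close>, and \<open>h\<close> is injective.\<close>
  have sq: "vtrace d (vmul d \<phi> \<phi>) v = p * p * of_nat (x i v)" if v: "v < n" for v
  proof -
    let ?\<phi> = "\<lambda>v r c. h (\<phi> v r c)"
    have "(\<forall>v<n. vtrace d ?\<phi> v = 0) \<or> (\<exists>j<s. \<exists>c. (\<forall>u<n. \<forall>v<n. x i u * x j v = x i v * x j u) \<and>
       (\<forall>v<n. vtrace d ?\<phi> v = c * of_nat (x j v) \<and> vtrace d (vmul d ?\<phi> ?\<phi>) v = c * c * of_nat (x j v)))"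
    proof (rule trace_parallel_ideal[OF E endo_hom[OF h(1) \<phi>(1)]])
      fix \<psi> u v assume "endo n Q d (\<lambda>a r c. h (L a r c)) \<psi>" "u < n" "v < n"
      then show "of_nat (x i u) * vtrace d (vmul d ?\<phi> \<psi>) v = of_nat (x i v) * vtrace d (vmul d ?\<phi> \<psi>) u"
        using parallel_traces_base_change[OF h par] by blast
    next
      fix j l assume "j < s" "l < s" "\<forall>u<n. \<forall>v<n. x i u * x j v = x i v * x j u" "\<forall>u<n. \<forall>v<n. x i u * x l v = x i v * x l u"
      then show "j = l" using ux by metis
    qed
    then obtain c where c: "\<forall>v<n. vtrace d ?\<phi> v = c * of_nat (x i v) \<and> vtrace d (vmul d ?\<phi> ?\<phi>) v = c * c * of_nat (x i v)"
    proof
      assume "\<forall>v<n. vtrace d ?\<phi> v = 0"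
      then have "h (p * of_nat (x i w)) = 0" using ne(1) unfolding vtrace_vmul_hom[OF h(1)] tr[OF ne(1), symmetric] by blast
      then have "p * of_nat (x i w) = 0" using h(2) by blast
      then show ?thesis using p0 ne(2) by simp
    next
      assume "\<exists>j<s. \<exists>c. (\<forall>u<n. \<forall>v<n. x i u * x j v = x i v * x j u) \<and>
       (\<forall>v<n. vtrace d ?\<phi> v = c * of_nat (x j v) \<and> vtrace d (vmul d ?\<phi> ?\<phi>) v = c * c * of_nat (x j v))"
      then show ?thesis using that ux by blast
    qed
    have "h p * of_nat (x i w) = c * of_nat (x i w)"
      using c ne(1) unfolding vtrace_vmul_hom[OF h(1)] by (simp add: tr h.hom_mult h.hom_of_nat)
    then have "c = h p" using cancel ne(2) by blast
    then have "h (vtrace d (vmul d \<phi> \<phi>) v - p * p * of_nat (x i v)) = 0"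
      using c v unfolding vtrace_vmul_hom[OF h(1)] by (simp add: h.hom_minus h.hom_mult h.hom_of_nat)
    from h(2)[rule_format, OF this] show ?thesis by simp
  qed
  let ?\<phi> = "\<lambda>v r c. h' (\<phi> v r c)"
  have "(\<forall>v<n. vtrace d ?\<phi> v = 0) \<or> (\<exists>j<s'. \<exists>c. (\<forall>u<n. \<forall>v<n. x i u * y j v = x i v * y j u) \<and>
     (\<forall>v<n. vtrace d ?\<phi> v = c * of_nat (y j v) \<and> vtrace d (vmul d ?\<phi> ?\<phi>) v = c * c * of_nat (y j v)))"
  proof (rule trace_parallel_ideal[OF F endo_hom[OF h'(1) \<phi>(1)]])
    fix \<psi> u v assume "endo n Q d (\<lambda>a r c. h' (L a r c)) \<psi>" "u < n" "v < n"
    then show "of_nat (x i u) * vtrace d (vmul d ?\<phi> \<psi>) v = of_nat (x i v) * vtrace d (vmul d ?\<phi> \<psi>) u"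
      using parallel_traces_base_change[OF h' par] by blast
  qed (rule uy)
  then obtain j c where j: "j < s'" and c: "\<And>v. v < n \<Longrightarrow> h' p * of_nat (x i v) = c * of_nat (y j v)"
    "\<And>v. v < n \<Longrightarrow> h' p * h' p * of_nat (x i v) = c * c * of_nat (y j v)"
  proof
    assume "\<forall>v<n. vtrace d ?\<phi> v = 0"
    then have "h' (p * of_nat (x i w)) = 0" using ne(1) unfolding vtrace_vmul_hom[OF h'(1)] tr[OF ne(1), symmetric] by blast
    then have "p * of_nat (x i w) = 0" using h'(2) by blast
    then show ?thesis using p0 ne(2) by simp
  next
    assume "\<exists>j<s'. \<exists>c. (\<forall>u<n. \<forall>v<n. x i u * y j v = x i v * y j u) \<and>
     (\<forall>v<n. vtrace d ?\<phi> v = c * of_nat (y j v) \<and> vtrace d (vmul d ?\<phi> ?\<phi>) v = c * c * of_nat (y j v))"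
    then obtain j c where "j < s'" "\<forall>v<n. vtrace d ?\<phi> v = c * of_nat (y j v) \<and> vtrace d (vmul d ?\<phi> ?\<phi>) v = c * c * of_nat (y j v)"
      by blast
    then show ?thesis using that[of j c] unfolding vtrace_vmul_hom[OF h'(1)]
      by (simp add: tr sq h'.hom_mult h'.hom_of_nat)
  qed
  have hp: "h' p \<noteq> 0" using h'(2) p0 by blast
  have "h' p * (h' p * of_nat (x i w)) = c * (h' p * of_nat (x i w))"
    using c(2)[OF ne(1)] unfolding c(1)[OF ne(1)] by (simp add: mult.assoc c(1)[OF ne(1)])
  then have "h' p = c" using hp ne(2) by simp
  then have "of_nat (x i v) = (of_nat (y j v) :: 'k fps)" if "v < n" for v
    using c(1)[OF that] hp by simp
  then have "\<forall>v<n. y j v = x i v" by (simp only: of_nat_eq_iff) simp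
  then show ?thesis using j by blast
qed

section \<open>Uniqueness of imaginary summands\<close>

text \<open>On the ray of \<open>z\<close> the number \<open><w, w'>\<close> is a positive multiple
  of \<open><z, z>\<close>, hence negative, while vanishing ext would make it nonnegative.\<close>

lemma parallel_ext_nonzero:
  fixes K :: "'k::field itself"
  assumes ok: "quiver_ok n Q" and q: "card (vertex_idx n z z) < card (arrow_idx Q z z)"
    and w: "\<forall>u<n. \<forall>v<n. z u * w v = z v * w u" "\<exists>v<n. 0 < w v"
    and w': "\<forall>u<n. \<forall>v<n. z u * w' v = z v * w' u" "\<exists>v<n. 0 < w' v"
  shows "Defs.ext K n Q w w' \<noteq> 0"
proof
  assume "Defs.ext K n Q w w' = 0"
  then have le: "card (arrow_idx Q w w') \<le> card (vertex_idx n w w')" by (rule ext_zero_card)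
  have "arrow_idx Q z z \<noteq> {}" using q by auto
  then obtain a where "a < length Q" "0 < z (fst (Q!a))" unfolding arrow_idx_def by auto
  then obtain u where u: "u < n" "0 < z u" using quiver_ok_nth[OF ok] by blast
  have pos: "0 < p u" if "\<forall>u<n. \<forall>v<n. z u * p v = z v * p u" "\<exists>v<n. 0 < p v" for p :: "nat \<Rightarrow> nat"
  proof (rule ccontr)
    assume "\<not> 0 < p u"
    then show False using that u by (metis mult_0_right mult_is_0 neq0_conv)
  qed
  have wv: "z u * w v = z v * w u" "z u * w' v = z v * w' u" if "v < n" for v
    using w(1) w'(1) u(1) that by blast+
  \<comment> \<open>The factor \<open>z u * z u\<close> clears the denominators of
    \<open>w = (w u / z u) z\<close> and of its counterpart for \<open>w'\<close>.\<close>
  have "(z u * z u) * card (vertex_idx n w w') = (\<Sum>v<n. (z u * w v) * (z u * w' v))"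
    unfolding card_vertex_idx sum_distrib_left by (intro sum.cong) (auto simp: ac_simps)
  also have "\<dots> = (\<Sum>v<n. (w u * w' u) * (z v * z v))"
    by (intro sum.cong refl) (simp add: wv)
  also have "\<dots> = (w u * w' u) * card (vertex_idx n z z)"
    unfolding card_vertex_idx sum_distrib_left by simp
  also have "\<dots> < (w u * w' u) * card (arrow_idx Q z z)"
    using q pos[OF w] pos[OF w'] by simp
  also have "\<dots> = (\<Sum>a<length Q. (w u * w' u) * (z (fst (Q!a)) * z (snd (Q!a))))"
    unfolding card_arrow_idx sum_distrib_left by simp
  also have "\<dots> = (\<Sum>a<length Q. (z u * w (fst (Q!a))) * (z u * w' (snd (Q!a))))"
    using quiver_ok_nth[OF ok] by (intro sum.cong refl) (simp add: wv)
  also have "\<dots> = (z u * z u) * card (arrow_idx Q w w')"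
    unfolding card_arrow_idx sum_distrib_left by (intro sum.cong) (auto simp: ac_simps)
  finally show False using le by simp
qed

text \<open>The Taylor expansion at 1, the other end of the line.\<close>

lemma comm_ring_hom_fps_of_poly_shift:
  "comm_ring_hom (\<lambda>p :: 'a::comm_ring_1 poly. fps_of_poly (pcompose p [:1, 1:]))"
  by unfold_locales (auto simp: pcompose_add pcompose_mult fps_of_poly_add fps_of_poly_mult pcompose_1)

text \<open>The expansions of the line from \<open>A\<close> to \<open>B\<close> at its two ends
  start at the two direct sums, so each carries idempotents. Since \<open><x_i, x_i>\<close> is
  negative, ext is nonzero within the ray of \<open>x i\<close>, and orthogonality leaves room for
  at most one summand on it in either decomposition.\<close>

lemma imaginary_summand_common:
  fixes K :: "'k::field_char_0 itself" and x y :: "nat \<Rightarrow> nat \<Rightarrow> nat" and s s' :: nat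
  assumes ok: "quiver_ok n Q"
    and dx: "\<And>v. d v = (\<Sum>j<s. x j v)" and dy: "\<And>v. d v = (\<Sum>j<s'. y j v)"
    and ex: "\<And>i j. i < s \<Longrightarrow> j < s \<Longrightarrow> i \<noteq> j \<Longrightarrow> Defs.ext K n Q (x i) (x j) = 0"
    and ey: "\<And>i j. i < s' \<Longrightarrow> j < s' \<Longrightarrow> i \<noteq> j \<Longrightarrow> Defs.ext K n Q (y i) (y j) = 0"
    and bx: "\<And>j. j < s \<Longrightarrow> (\<exists>v<n. 0 < x j v) \<and> (\<exists>M::'k fam. brick n Q (x j) M)"
    and b_y: "\<And>j. j < s' \<Longrightarrow> (\<exists>v<n. 0 < y j v) \<and> (\<exists>M::'k fam. brick n Q (y j) M)"
    and i: "i < s" and q: "card (vertex_idx n (x i) (x i)) < card (arrow_idx Q (x i) (x i))"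
  shows "\<exists>j<s'. \<forall>v<n. y j v = x i v"
proof -
  have "\<exists>X :: nat \<Rightarrow> 'k fam. (\<forall>j<s. is_rep Q (x j) (X j)) \<and>
    (\<forall>(i,j)\<in>{(i,j). i < s \<and> j < s \<and> i \<noteq> j}. ext_zero n Q (x i) (x j) (X i) (X j)) \<and>
    (\<forall>j\<in>{..<s}. brick n Q (x j) (X j))"
    by (rule generic_tuple[OF ok, where K=K]) (use ex bx in auto)
  then obtain X :: "nat \<Rightarrow> 'k fam" where X0:
    "(\<forall>(i,j)\<in>{(i,j). i < s \<and> j < s \<and> i \<noteq> j}. ext_zero n Q (x i) (x j) (X i) (X j)) \<and>
    (\<forall>j\<in>{..<s}. brick n Q (x j) (X j))" by blast
  have X: "ext_zero n Q (x i) (x j) (X i) (X j)" if "i < s" "j < s" "i \<noteq> j" for i j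
    using bspec[OF X0[THEN conjunct1], of "(i, j)"] that by simp
  have X': "brick n Q (x j) (X j)" if "j < s" for j using X0 that by blast
  have "\<exists>Y :: nat \<Rightarrow> 'k fam. (\<forall>j<s'. is_rep Q (y j) (Y j)) \<and>
    (\<forall>(i,j)\<in>{(i,j). i < s' \<and> j < s' \<and> i \<noteq> j}. ext_zero n Q (y i) (y j) (Y i) (Y j)) \<and>
    (\<forall>j\<in>{..<s'}. brick n Q (y j) (Y j))"
    by (rule generic_tuple[OF ok, where K=K]) (use ey b_y in auto)
  then obtain Y :: "nat \<Rightarrow> 'k fam" where Y0:
    "(\<forall>(i,j)\<in>{(i,j). i < s' \<and> j < s' \<and> i \<noteq> j}. ext_zero n Q (y i) (y j) (Y i) (Y j)) \<and>
    (\<forall>j\<in>{..<s'}. brick n Q (y j) (Y j))" by blast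
  have Y: "ext_zero n Q (y i) (y j) (Y i) (Y j)" if "i < s'" "j < s'" "i \<noteq> j" for i j
    using bspec[OF Y0[THEN conjunct1], of "(i, j)"] that by simp
  have Y': "brick n Q (y j) (Y j)" if "j < s'" for j using Y0 that by blast
  obtain ix where ix: "blocks s x d ix" using blocks_exist[of d x s] dx by blast
  obtain iy where iy: "blocks s' y d iy" using blocks_exist[of d y s'] dy by blast
  define A where "A = blocks.dsum s x d ix Q X"
  define B where "B = blocks.dsum s' y d iy Q Y"
  define L where "L = poly_line A B"
  have sA: "supported (arrow_idx Q d d) A" unfolding A_def by (rule blocks.supported_dsum[OF ix])
  have sB: "supported (arrow_idx Q d d) B" unfolding B_def by (rule blocks.supported_dsum[OF iy])
  have sL: "L a r c = 0" if "(a, r, c) \<notin> arrow_idx Q d d" for a r c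
    using supported_zero[OF sA that] supported_zero[OF sB that] by (simp add: L_def poly_line_def)
  define h where "h = (fps_of_poly :: 'k poly \<Rightarrow> 'k fps)"
  define h' where "h' = (\<lambda>p :: 'k poly. fps_of_poly (pcompose p [:1, 1:]))"
  have h: "comm_ring_hom h" "\<forall>a. h a = 0 \<longrightarrow> a = 0"
    unfolding h_def by (rule comm_ring_hom_fps_of_poly) simp
  have h': "comm_ring_hom h'" "\<forall>a. h' a = 0 \<longrightarrow> a = 0"
    unfolding h'_def by (rule comm_ring_hom_fps_of_poly_shift) (simp add: pcompose_eq_0_iff)
  have "\<exists>E. brick_idempotents n Q d (\<lambda>a r c. h (L a r c)) s x E"
  proof (rule blocks.brick_idempotents_exist[OF ix ok X X'])
    show "supported (arrow_idx Q d d) (\<lambda>a r c. h (L a r c))"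
      unfolding supported_def h_def using sL fps_of_poly_0 by metis
    show "fps_nth (h (L a r c)) 0 = blocks.dsum s x d ix Q X a r c" for a r c
      unfolding h_def L_def poly_line_def A_def by simp
  qed (use bx in auto)
  then obtain E where E: "brick_idempotents n Q d (\<lambda>a r c. h (L a r c)) s x E" by blast
  have "\<exists>F. brick_idempotents n Q d (\<lambda>a r c. h' (L a r c)) s' y F"
  proof (rule blocks.brick_idempotents_exist[OF iy ok Y Y'])
    show "supported (arrow_idx Q d d) (\<lambda>a r c. h' (L a r c))"
      unfolding supported_def h'_def using sL fps_of_poly_0 pcompose_0 by metis
    show "fps_nth (h' (L a r c)) 0 = blocks.dsum s' y d iy Q Y a r c" for a r c
      unfolding h'_def L_def poly_line_def B_def[symmetric] by (simp add: pcompose_pCons)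
  qed (use b_y in auto)
  then obtain F where F: "brick_idempotents n Q d (\<lambda>a r c. h' (L a r c)) s' y F" by blast
  obtain w where w: "w < n" "0 < x i w" using bx[OF i] by blast
  show ?thesis
  proof (rule common_brick[OF h h' E F i w])
    fix j assume j: "j < s" "\<forall>u<n. \<forall>v<n. x i u * x j v = x i v * x j u"
    show "j = i"
    proof (rule ccontr)
      assume "j \<noteq> i"
      then have "Defs.ext K n Q (x j) (x i) = 0" using ex j(1) i by blast
      moreover have "\<forall>u<n. \<forall>v<n. x i u * x i v = x i v * x i u" by simp
      ultimately show False using parallel_ext_nonzero[OF ok q j(2) _ _ , of "x i" K] bx[OF j(1)] bx[OF i] by blast
    qed
  next
    fix j l assume jl: "j < s'" "l < s'" "\<forall>u<n. \<forall>v<n. x i u * y j v = x i v * y j u"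
      "\<forall>u<n. \<forall>v<n. x i u * y l v = x i v * y l u"
    show "j = l"
    proof (rule ccontr)
      assume "j \<noteq> l"
      then have "Defs.ext K n Q (y j) (y l) = 0" using ey jl by blast
      then show False using parallel_ext_nonzero[OF ok q jl(3) _ jl(4), of K] b_y[OF jl(1)] b_y[OF jl(2)] by blast
    qed
  qed
qed

section \<open>Generic decompositions and component clusters\<close>

abbreviation nat_vec :: "(nat \<Rightarrow> int) \<Rightarrow> nat \<Rightarrow> nat" where
  "nat_vec a \<equiv> (\<lambda>i. nat (a i))"

lemma schur_rootD:
  assumes "schur_root K n Q (a :: nat \<Rightarrow> int)"
  shows "dimvec n a" "\<And>i. 0 \<le> a i" "\<exists>v<n. 0 < nat (a v)"
proof -
  show d: "dimvec n a" and nn: "\<And>i. 0 \<le> a i" using assms by (auto simp: schur_root_def)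
  have "a \<noteq> 0" using assms by (simp add: schur_root_def)
  then obtain v where v: "a v \<noteq> 0" by (auto simp: fun_eq_iff)
  then have "v < n" using d unfolding dimvec_def by (meson not_le)
  then show "\<exists>v<n. 0 < nat (a v)" using v nn[of v] by force
qed

lemma schur_root_brick:
  fixes K :: "'k::field itself"
  assumes "quiver_ok n Q" "schur_root K n Q a"
  shows "\<exists>M :: 'k fam. brick n Q (nat_vec a) M"
proof -
  obtain M :: "'k rep" where M: "is_rep Q (nat_vec a) M" "dim_hom n Q (nat_vec a) (nat_vec a) M M = 1"
    using assms(2) unfolding schur_root_def by blast
  obtain v where "v < n" "0 < nat_vec a v" using schur_rootD(3)[OF assms(2)] by blast
  from dim_hom_eq_1_brick[OF assms(1) M(1) this M(2)] show ?thesis by blast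
qed

lemma neg_root_not_schur: "neg_root n a \<Longrightarrow> \<not> schur_root K n Q a"
proof
  assume "neg_root n a" "schur_root K n Q a"
  then obtain i where "a = - unitvec i" "0 \<le> a i" unfolding neg_root_def using schur_rootD(2) by blast
  then show False by (simp add: unitvec_def)
qed

lemma ext_orth_schur:
  "schur_root K n Q a \<Longrightarrow> schur_root K n Q b \<Longrightarrow> ext_orth K n Q a b \<longleftrightarrow>
    Defs.ext K n Q (nat_vec a) (nat_vec b) = 0 \<and> Defs.ext K n Q (nat_vec b) (nat_vec a) = 0"
  unfolding ext_orth_def by simp

lemma unitvec_inject: "unitvec i = unitvec j \<longleftrightarrow> i = j"
proof
  assume "unitvec i = unitvec j"
  from fun_cong[OF this, of i] show "i = j" by (auto simp: unitvec_def split: if_splits)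
qed simp

lemma ext_orth_neg_schur:
  assumes "i < n" "schur_root K n Q b"
  shows "ext_orth K n Q (- unitvec i) b \<longleftrightarrow> b i = 0" "ext_orth K n Q b (- unitvec i) \<longleftrightarrow> b i = 0"
proof -
  have n: "neg_root n (- unitvec i)" using assms(1) unfolding neg_root_def by blast
  have "\<not> schur_root K n Q (- unitvec i)" by (rule neg_root_not_schur[OF n])
  moreover have "\<not> neg_root n b" using neg_root_not_schur assms(2) by blast
  ultimately show "ext_orth K n Q (- unitvec i) b \<longleftrightarrow> b i = 0" "ext_orth K n Q b (- unitvec i) \<longleftrightarrow> b i = 0"
    unfolding ext_orth_def using assms n by (auto simp: unitvec_inject)
qed

lemma ext_orth_neg_neg: "neg_root n a \<Longrightarrow> neg_root n b \<Longrightarrow> ext_orth K n Q a b"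
  unfolding ext_orth_def using neg_root_not_schur[of n a K Q] neg_root_not_schur[of n b K Q] by simp

lemma ext_orth_sym: "ext_orth K n Q a b \<Longrightarrow> ext_orth K n Q b a"
  using neg_root_not_schur[of n a K Q] neg_root_not_schur[of n b K Q]
  unfolding ext_orth_def
  by (cases "schur_root K n Q a"; cases "schur_root K n Q b"; cases "neg_root n a"; cases "neg_root n b") simp_all

lemma sum_mset_fun_apply: "(sum_mset D :: nat \<Rightarrow> int) i = sum_mset (image_mset (\<lambda>a. a i) D)"
  by (induct D) auto

text \<open>If \<open>-e_i\<close> were a summand, all others would be at most 0 at \<open>i\<close>
  by orthogonality, and the sum would be negative there.\<close>

lemma generic_decomp_schur:
  assumes D: "generic_decomp K n Q d D" and d: "\<And>i. 0 \<le> d i" and a: "a \<in># D"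
  shows "schur_root K n Q a"
proof (rule ccontr)
  assume "\<not> schur_root K n Q a"
  then have na: "neg_root n a" using D a unfolding generic_decomp_def gen_schur_root_def by blast
  then obtain i where i: "i < n" "a = - unitvec i" unfolding neg_root_def by blast
  have le: "b i \<le> 0" if b: "b \<in># D - {#a#}" for b
  proof -
    have o: "ext_orth K n Q a b" using D a b unfolding generic_decomp_def by blast
    have "b \<in># D" using b by (rule in_diffD)
    then consider "schur_root K n Q b" | "neg_root n b" using D unfolding generic_decomp_def gen_schur_root_def by blast
    then show ?thesis
    proof cases
      case 1
      then show ?thesis using ext_orth_neg_schur(1)[OF i(1) 1] o i(2) by simp
    next
      case 2
      then show ?thesis unfolding neg_root_def by (auto simp: unitvec_def)
    qed
  qed
  have "D = add_mset a (D - {#a#})" using a by simp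
  then have "d i = a i + sum_mset (image_mset (\<lambda>a. a i) (D - {#a#}))"
    using D sum_mset_fun_apply[of D i] unfolding generic_decomp_def by (metis image_mset_add_mset sum_mset.add_mset)
  moreover have "sum_mset (image_mset (\<lambda>a. a i) (D - {#a#})) \<le> 0"
  proof -
    have "sum_mset (image_mset (\<lambda>a. a i) M) \<le> 0" if "\<And>b. b \<in># M \<Longrightarrow> b i \<le> 0" for M :: "(nat \<Rightarrow> int) multiset"
      using that by (induct M) (auto intro: add_nonpos_nonpos)
    then show ?thesis using le by blast
  qed
  ultimately have "d i \<le> a i" by simp
  then show False using d[of i] i by (simp add: unitvec_def)
qed

lemma mset_nth_diff:
  assumes "i < length xs" "j < length xs" "i \<noteq> j"
  shows "xs ! j \<in># mset xs - {#xs ! i#}"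
proof -
  have "mset xs = add_mset (xs ! i) (mset (take i xs @ drop (Suc i) xs))"
    using arg_cong[OF id_take_nth_drop[OF assms(1)], of mset] by simp
  moreover have "xs ! j \<in> set (take i xs @ drop (Suc i) xs)"
  proof (cases "j < i")
    case True
    then have "xs ! j = take i xs ! j" "j < length (take i xs)" using assms by auto
    then show ?thesis by (metis UnI1 nth_mem set_append)
  next
    case False
    then have "xs ! j = drop (Suc i) xs ! (j - Suc i)" "j - Suc i < length (drop (Suc i) xs)" using assms by auto
    then show ?thesis by (metis UnI2 nth_mem set_append)
  qed
  ultimately show ?thesis by simp
qed

text \<open>Indexing by positions keeps repeated summands apart; for a repeated summand a the
  condition with \<open>i \<noteq> j\<close> includes ext(a, a) = 0.\<close>

lemma generic_decomp_family:
  fixes K :: "'k::field_char_0 itself"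
  assumes ok: "quiver_ok n Q" and D: "generic_decomp K n Q d D" and d: "\<And>i. 0 \<le> d i"
  shows "\<exists>s x. set_mset D = x ` {..<s :: nat} \<and> (\<forall>j<s. schur_root K n Q (x j)) \<and>
    (\<forall>v. nat_vec d v = (\<Sum>j<s. nat_vec (x j) v)) \<and>
    (\<forall>i<s. \<forall>j<s. i \<noteq> j \<longrightarrow> Defs.ext K n Q (nat_vec (x i)) (nat_vec (x j)) = 0)"
proof -
  obtain xs where xs: "mset xs = D" using ex_mset by blast
  have s: "schur_root K n Q (xs ! j)" if "j < length xs" for j
    using generic_decomp_schur[OF D d] that xs by (metis nth_mem set_mset_mset)
  show ?thesis
  proof (intro exI[of _ "length xs"] exI[of _ "\<lambda>j. xs ! j"] conjI allI impI)
    show "set_mset D = (!) xs ` {..<length xs}"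
      unfolding xs[symmetric] by (auto simp: in_set_conv_nth)
    fix v
    have "d v = (\<Sum>j<length xs. (xs ! j) v)"
    proof -
      have "d v = sum_mset (image_mset (\<lambda>a. a v) (mset xs))"
        using D sum_mset_fun_apply[of D v] unfolding generic_decomp_def xs by simp
      also have "\<dots> = sum_list (map (\<lambda>a. a v) xs)" by (metis mset_map sum_mset_sum_list)
      also have "\<dots> = (\<Sum>j<length xs. (xs ! j) v)" by (simp add: sum_list_sum_nth atLeast0LessThan)
      finally show ?thesis .
    qed
    also have "\<dots> = (\<Sum>j<length xs. int (nat ((xs ! j) v)))"
      using schur_rootD(2)[OF s] by (intro sum.cong) auto
    finally have "d v = int (\<Sum>j<length xs. nat ((xs ! j) v))" by (simp only: of_nat_sum)
    then show "nat (d v) = (\<Sum>j<length xs. nat ((xs ! j) v))" by (simp only: nat_int)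
  next
    fix i j assume ij: "i < length xs" "j < length xs" "i \<noteq> j"
    have "ext_orth K n Q (xs ! i) (xs ! j)"
      using D mset_nth_diff[OF ij] nth_mem[OF ij(1)] unfolding generic_decomp_def xs[symmetric] by auto
    then show "Defs.ext K n Q (nat_vec (xs ! i)) (nat_vec (xs ! j)) = 0"
      using ext_orth_schur[OF s[OF ij(1)] s[OF ij(2)]] by blast
  qed (rule s)
qed

text \<open>If ext(a, a) = 0, then ext(a, d) = 0 by summing over the decomposition containing
  \<open>a\<close>, and this passes to the summand \<open>b\<close> of the other one. Otherwise
  \<open>a\<close> itself is a summand of the other decomposition, where it is orthogonal to
  \<open>b\<close>.\<close>

lemma ext_generic_decomps:
  fixes K :: "'k::field_char_0 itself"
  assumes ok: "quiver_ok n Q" and D: "generic_decomp K n Q d D" and D': "generic_decomp K n Q d D'"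
    and d: "\<And>i. 0 \<le> d i" and a: "a \<in># D" and b: "b \<in># D'" and ne: "a \<noteq> b"
  shows "Defs.ext K n Q (nat_vec a) (nat_vec b) = 0"
proof -
  obtain s x where *: "set_mset D = x ` {..<s :: nat} \<and> (\<forall>j<s. schur_root K n Q (x j)) \<and>
    (\<forall>v. nat_vec d v = (\<Sum>j<s. nat_vec (x j) v)) \<and>
    (\<forall>i<s. \<forall>j<s. i \<noteq> j \<longrightarrow> Defs.ext K n Q (nat_vec (x i)) (nat_vec (x j)) = 0)"
      using generic_decomp_family[where d=d, OF ok D d] by blast
    have x: "set_mset D = x ` {..<s}" "\<And>j. j < s \<Longrightarrow> schur_root K n Q (x j)"
      "\<And>v. nat_vec d v = (\<Sum>j<s. nat_vec (x j) v)"
      "\<And>i j. i < s \<Longrightarrow> j < s \<Longrightarrow> i \<noteq> j \<Longrightarrow> Defs.ext K n Q (nat_vec (x i)) (nat_vec (x j)) = 0"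
      using * by blast+
  obtain s' y where *: "set_mset D' = y ` {..<s' :: nat} \<and> (\<forall>j<s'. schur_root K n Q (y j)) \<and>
    (\<forall>v. nat_vec d v = (\<Sum>j<s'. nat_vec (y j) v)) \<and>
    (\<forall>i<s'. \<forall>j<s'. i \<noteq> j \<longrightarrow> Defs.ext K n Q (nat_vec (y i)) (nat_vec (y j)) = 0)"
      using generic_decomp_family[where d=d, OF ok D' d] by blast
    have y: "set_mset D' = y ` {..<s'}" "\<And>j. j < s' \<Longrightarrow> schur_root K n Q (y j)"
      "\<And>v. nat_vec d v = (\<Sum>j<s'. nat_vec (y j) v)"
      "\<And>i j. i < s' \<Longrightarrow> j < s' \<Longrightarrow> i \<noteq> j \<Longrightarrow> Defs.ext K n Q (nat_vec (y i)) (nat_vec (y j)) = 0"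
      using * by blast+
  obtain i where i: "i < s" "a = x i" using a x(1) by auto
  obtain j where j: "j < s'" "b = y j" using b y(1) by auto
  show ?thesis
  proof (cases "Defs.ext K n Q (nat_vec a) (nat_vec a) = 0")
    case True
    have "Defs.ext K n Q (nat_vec a) (nat_vec d) = 0"
    proof (rule ext_sum_right[OF ok x(3)])
      fix l assume "l < s"
      then show "Defs.ext K n Q (nat_vec a) (nat_vec (x l)) = 0"
        using True x(4)[OF i(1), of l] i(2) by (cases "l = i") auto
    qed
    from ext_summand_right[OF ok y(3) y(4) this j(1)] show ?thesis unfolding j(2) .
  next
    case False
    obtain v where v: "v < n" "0 < nat_vec a v" using schur_rootD(3)[OF x(2)[OF i(1)]] i(2) by blast
    obtain M :: "'k fam" where M: "brick n Q (nat_vec a) M"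
      using schur_root_brick[OF ok x(2)[OF i(1)]] i(2) by blast
    have q: "card (vertex_idx n (nat_vec (x i)) (nat_vec (x i))) < card (arrow_idx Q (nat_vec (x i)) (nat_vec (x i)))"
      using brick_ext_self[where K=K, OF ok M v] False unfolding i(2) by (meson not_le)
    have bx: "(\<exists>v<n. 0 < nat_vec (x j) v) \<and> (\<exists>M::'k fam. brick n Q (nat_vec (x j)) M)" if "j < s" for j
      using schur_rootD(3)[OF x(2)[OF that]] schur_root_brick[OF ok x(2)[OF that]] by blast
    have b_y: "(\<exists>v<n. 0 < nat_vec (y j) v) \<and> (\<exists>M::'k fam. brick n Q (nat_vec (y j)) M)" if "j < s'" for j
      using schur_rootD(3)[OF y(2)[OF that]] schur_root_brick[OF ok y(2)[OF that]] by blast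
    have "\<exists>l<s'. \<forall>v<n. nat_vec (y l) v = nat_vec (x i) v"
      by (rule imaginary_summand_common[where x="\<lambda>j. nat_vec (x j)" and y="\<lambda>j. nat_vec (y j)" and K=K,
            OF ok x(3) y(3) x(4) y(4) bx b_y i(1) q])
    then obtain l where l: "l < s'" "\<And>v. v < n \<Longrightarrow> nat_vec (y l) v = nat_vec (x i) v" by blast
    have "y l = x i"
    proof
      fix v
      note yl = schur_rootD[OF y(2)[OF l(1)]] and xi = schur_rootD[OF x(2)[OF i(1)]]
      show "y l v = x i v"
      proof (cases "v < n")
        case True
        then show ?thesis using l(2)[OF True] yl(2)[of v] xi(2)[of v] by simp
      next
        case False
        then show ?thesis using yl(1) xi(1) unfolding dimvec_def by simp
      qed
    qed
    then have "l \<noteq> j" using ne i(2) j(2) by auto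
    from y(4)[OF l(1) j(1) this] show ?thesis using \<open>y l = x i\<close> i(2) j(2) by simp
  qed
qed

text \<open>Orthogonality to \<open>d\<close> passes to the summands of \<open>d\<close>; for a
  negative root this is because nonnegative entries with sum zero are zero.\<close>

lemma orth_set_union_decomps:
  fixes K :: "'k::field_char_0 itself"
  assumes ok: "quiver_ok n Q" and I: "orth_set K n Q I" and d: "\<And>i. 0 \<le> d i"
    and schur: "\<And>b. b \<in> I \<Longrightarrow> schur_root K n Q b \<Longrightarrow>
      Defs.ext K n Q (nat_vec b) (nat_vec d) = 0 \<and> Defs.ext K n Q (nat_vec d) (nat_vec b) = 0"
    and neg: "\<And>j. j < n \<Longrightarrow> - unitvec j \<in> I \<Longrightarrow> d j = 0"
  shows "orth_set K n Q (I \<union> {a. \<exists>D. generic_decomp K n Q d D \<and> a \<in># D})" (is "orth_set K n Q (I \<union> ?S)")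
proof -
  have S: "schur_root K n Q a" if "a \<in> ?S" for a using that generic_decomp_schur[where d=d, OF _ d] by blast
  have SS: "ext_orth K n Q a b" if "a \<in> ?S" "b \<in> ?S" "a \<noteq> b" for a b
  proof -
    obtain D D' where D: "generic_decomp K n Q d D" "a \<in># D" and D': "generic_decomp K n Q d D'" "b \<in># D'"
      using \<open>a \<in> ?S\<close> \<open>b \<in> ?S\<close> by auto
    show ?thesis
      unfolding ext_orth_schur[OF S[OF that(1)] S[OF that(2)]]
      using ext_generic_decomps[where d=d, OF ok D(1) D'(1) d D(2) D'(2) that(3)]
        ext_generic_decomps[where d=d, OF ok D'(1) D(1) d D'(2) D(2) that(3)[symmetric]] by (rule conjI)
  qed
  have IS: "ext_orth K n Q b a" if b: "b \<in> I" and a: "a \<in> ?S" for a b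
  proof -
    obtain D where D: "generic_decomp K n Q d D" "a \<in># D" using a by blast
    obtain s x where *: "set_mset D = x ` {..<s :: nat} \<and> (\<forall>j<s. schur_root K n Q (x j)) \<and>
    (\<forall>v. nat_vec d v = (\<Sum>j<s. nat_vec (x j) v)) \<and>
    (\<forall>i<s. \<forall>j<s. i \<noteq> j \<longrightarrow> Defs.ext K n Q (nat_vec (x i)) (nat_vec (x j)) = 0)"
      using generic_decomp_family[where d=d, OF ok D(1) d] by blast
    have x: "set_mset D = x ` {..<s}" "\<And>j. j < s \<Longrightarrow> schur_root K n Q (x j)"
      "\<And>v. nat_vec d v = (\<Sum>j<s. nat_vec (x j) v)"
      "\<And>i j. i < s \<Longrightarrow> j < s \<Longrightarrow> i \<noteq> j \<Longrightarrow> Defs.ext K n Q (nat_vec (x i)) (nat_vec (x j)) = 0"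
      using * by blast+
    obtain i where i: "i < s" "a = x i" using D(2) x(1) by auto
    consider "schur_root K n Q b" | "neg_root n b" using I b unfolding orth_set_def gen_schur_root_def by blast
    then show ?thesis
    proof cases
      case 1
      note e = schur[OF b 1]
      show ?thesis unfolding ext_orth_schur[OF 1 S[OF a]] unfolding i(2)
        using ext_summand_right[OF ok x(3) x(4) e[THEN conjunct1] i(1)]
          ext_summand_left[OF ok x(3) x(4) e[THEN conjunct2] i(1)] by blast
    next
      case 2
      then obtain j where j: "j < n" "b = - unitvec j" unfolding neg_root_def by blast
      have "d j = 0" using neg j b by blast
      then have "(\<Sum>l<s. nat_vec (x l) j) = 0" using x(3)[of j] by simp
      then have "nat (a j) = 0" using i by simp
      then have "a j = 0" using schur_rootD(2)[OF S[OF a], of j] by simp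
      then show ?thesis unfolding j(2) using ext_orth_neg_schur(1)[OF j(1) S[OF a]] by blast
    qed
  qed
  have II: "ext_orth K n Q a b" if "a \<in> I" "b \<in> I" "a \<noteq> b" for a b
    using I that unfolding orth_set_def by blast
  have g: "gen_schur_root K n Q a" if "a \<in> I \<union> ?S" for a
    using that I S unfolding orth_set_def gen_schur_root_def by blast
  show ?thesis unfolding orth_set_def
  proof (intro conjI ballI impI)
    fix a b assume "a \<in> I \<union> ?S" "b \<in> I \<union> ?S" "a \<noteq> b"
    then show "ext_orth K n Q a b" using II SS IS ext_orth_sym[OF IS] by (elim UnE) blast+
  qed (rule g)
qed

text \<open>Zorn's lemma applies because orthogonality concerns pairs, and two elements of the union
  of a chain lie in one member.\<close>

lemma component_cluster_extend:
  assumes "orth_set K n Q S"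
  shows "\<exists>C. component_cluster K n Q C \<and> S \<subseteq> C"
proof -
  have "\<exists>M\<in>{C. orth_set K n Q C \<and> S \<subseteq> C}. \<forall>X\<in>{C. orth_set K n Q C \<and> S \<subseteq> C}. M \<subseteq> X \<longrightarrow> X = M"
  proof (rule subset_Zorn_nonempty)
    show "{C. orth_set K n Q C \<and> S \<subseteq> C} \<noteq> {}" using assms by blast
    fix \<C> assume ne: "\<C> \<noteq> {}" and ch: "subset.chain {C. orth_set K n Q C \<and> S \<subseteq> C} \<C>"
    have 1: "orth_set K n Q C" "S \<subseteq> C" if "C \<in> \<C>" for C using ch that unfolding subset.chain_def by auto
    have 2: "\<exists>C\<in>\<C>. a \<in> C \<and> b \<in> C" if "a \<in> \<Union>\<C>" "b \<in> \<Union>\<C>" for a b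
      using ch that unfolding subset.chain_def by blast
    have "orth_set K n Q (\<Union>\<C>)" unfolding orth_set_def
    proof (intro conjI ballI impI)
      fix a assume "a \<in> \<Union>\<C>"
      then show "gen_schur_root K n Q a" using 1 unfolding orth_set_def by blast
    next
      fix a b assume ab: "a \<in> \<Union>\<C>" "b \<in> \<Union>\<C>" "a \<noteq> b"
      then obtain C where "C \<in> \<C>" "a \<in> C" "b \<in> C" using 2 by blast
      then show "ext_orth K n Q a b" using 1[of C] ab(3) unfolding orth_set_def by blast
    qed
    then show "\<Union>\<C> \<in> {C. orth_set K n Q C \<and> S \<subseteq> C}" using 1 ne by blast
  qed
  then obtain C where C: "C \<in> {C. orth_set K n Q C \<and> S \<subseteq> C}"
    and max: "\<forall>X\<in>{C. orth_set K n Q C \<and> S \<subseteq> C}. C \<subseteq> X \<longrightarrow> X = C" by (elim bexE)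
  have "component_cluster K n Q C" unfolding component_cluster_def
  proof (intro conjI allI impI)
    show "orth_set K n Q C" using C by simp
    fix X assume X: "C \<subseteq> X \<and> orth_set K n Q X"
    then have "X \<in> {C. orth_set K n Q C \<and> S \<subseteq> C}" using C by auto
    then show "X = C" using max X by blast
  qed
  then show ?thesis using C by auto
qed

text \<open>The smaller of the two clusters loses a single root \<open>a\<close>; if the new root
  \<open>b\<close> were orthogonal to \<open>a\<close> too, it could be added to that cluster,
  against maximality.\<close>

lemma not_ext_orth_exchange:
  assumes C1: "component_cluster K n Q C1" and C2: "component_cluster K n Q C2"
    and mut: "mutation_connected C1 C2" and \<alpha>: "\<alpha> \<in> C1 - C2" and \<alpha>': "\<alpha>' \<in> C2 - C1"
  shows "\<not> ext_orth K n Q \<alpha> \<alpha>'"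
proof
  assume o: "ext_orth K n Q \<alpha> \<alpha>'"
  have max: False if A: "component_cluster K n Q A" and B: "component_cluster K n Q B"
    and card: "int (card (A \<inter> B)) = int (card A) - 1" and a: "a \<in> A - B" and b: "b \<in> B - A" and ab: "ext_orth K n Q a b"
    for A B a b
  proof -
    have oA: "orth_set K n Q A" and oB: "orth_set K n Q B" using A B by (auto simp: component_cluster_def)
    \<comment> \<open>An infinite set has cardinality 0, and the equation would then ask for a
      cardinality of -1.\<close>
    have fA: "finite A" using card by (metis card.infinite diff_0 int_ops(1) of_nat_0_le_iff neg_0_le_iff_le not_one_le_zero)
    have "insert a (A \<inter> B) = A"
    proof (rule card_subset_eq[OF fA])
      show "insert a (A \<inter> B) \<subseteq> A" using a by blast
      show "card (insert a (A \<inter> B)) = card A" using a fA card by simp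
    qed
    then have A_eq: "A = insert a (A \<inter> B)" by simp
    have bA: "ext_orth K n Q c b" if "c \<in> A" for c
    proof (cases "c = a")
      case False
      then have "c \<in> B" using that A_eq by blast
      moreover have "c \<noteq> b" using that b by blast
      ultimately show ?thesis using oB b unfolding orth_set_def by blast
    qed (use ab in simp)
    have "orth_set K n Q (insert b A)" unfolding orth_set_def
    proof (intro conjI ballI impI)
      fix c assume "c \<in> insert b A"
      then show "gen_schur_root K n Q c" using oA oB b unfolding orth_set_def by blast
    next
      fix c c' assume c: "c \<in> insert b A" "c' \<in> insert b A" "c \<noteq> c'"
      show "ext_orth K n Q c c'"
      proof (cases "c = b")
        case True
        then show ?thesis using c bA ext_orth_sym by blast
      next
        case F: False
        show ?thesis
        proof (cases "c' = b")
          case True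
          then show ?thesis using c F bA by blast
        next
          case False
          then show ?thesis using c F oA unfolding orth_set_def by blast
        qed
      qed
    qed
    then have "insert b A = A" using A unfolding component_cluster_def by blast
    then show False using b by blast
  qed
  show False
  proof (cases "card C1 \<le> card C2")
    case True
    then show ?thesis using max[OF C1 C2 _ \<alpha> \<alpha>' o] mut unfolding mutation_connected_def by simp
  next
    case False
    then have "int (card (C2 \<inter> C1)) = int (card C2) - 1"
      using mut unfolding mutation_connected_def by (simp add: Int_commute)
    then show ?thesis using max[OF C2 C1 _ \<alpha>' \<alpha> ext_orth_sym[OF o]] by blast
  qed
qed

lemma ext_nat_vec_add:
  fixes K :: "'k::field_char_0 itself"
  assumes ok: "quiver_ok n Q" and a: "\<And>i. 0 \<le> (a i :: int)" and a': "\<And>i. 0 \<le> (a' i :: int)"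
  shows "Defs.ext K n Q b (nat_vec a) = 0 \<Longrightarrow> Defs.ext K n Q b (nat_vec a') = 0 \<Longrightarrow>
      Defs.ext K n Q b (nat_vec (a + a')) = 0"
    "Defs.ext K n Q (nat_vec a) b = 0 \<Longrightarrow> Defs.ext K n Q (nat_vec a') b = 0 \<Longrightarrow>
      Defs.ext K n Q (nat_vec (a + a')) b = 0"
proof -
  define x where "x = (\<lambda>j::nat. if j = 0 then nat_vec a else nat_vec a')"
  have s: "nat_vec (a + a') v = (\<Sum>j<2. x j v)" for v
    using a[of v] a'[of v] by (simp add: x_def numeral_2_eq_2 nat_add_distrib)
  show "Defs.ext K n Q b (nat_vec (a + a')) = 0"
    if "Defs.ext K n Q b (nat_vec a) = 0" "Defs.ext K n Q b (nat_vec a') = 0"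
    by (rule ext_sum_right[OF ok s]) (use that in \<open>auto simp: x_def\<close>)
  show "Defs.ext K n Q (nat_vec (a + a')) b = 0"
    if "Defs.ext K n Q (nat_vec a) b = 0" "Defs.ext K n Q (nat_vec a') b = 0"
    by (rule ext_sum_left[OF ok s]) (use that in \<open>auto simp: x_def\<close>)
qed

lemma orth_set_exchange_sum:
  fixes K :: "'k::field_char_0 itself"
  assumes ok: "quiver_ok n Q" and I: "orth_set K n Q I"
    and \<alpha>: "\<And>b. b \<in> I \<Longrightarrow> ext_orth K n Q b \<alpha> \<and> b \<noteq> \<alpha>" and \<alpha>': "\<And>b. b \<in> I \<Longrightarrow> ext_orth K n Q b \<alpha>' \<and> b \<noteq> \<alpha>'"
    and g: "gen_schur_root K n Q \<alpha>" and s': "schur_root K n Q \<alpha>'" and no: "\<not> ext_orth K n Q \<alpha> \<alpha>'"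
  shows "orth_set K n Q (I \<union> {a. \<exists>D. generic_decomp K n Q (\<alpha> + \<alpha>') D \<and> a \<in># D})"
proof -
  note nn' = schur_rootD(2)[OF s']
  consider "schur_root K n Q \<alpha>" | "neg_root n \<alpha>" using g unfolding gen_schur_root_def by blast
  then show ?thesis
  proof cases
    case 1
    note nn = schur_rootD(2)[OF 1]
    show ?thesis
    proof (rule orth_set_union_decomps[OF ok I])
      show "0 \<le> (\<alpha> + \<alpha>') i" for i using nn[of i] nn'[of i] by simp
    next
      fix b assume b: "b \<in> I" "schur_root K n Q b"
      show "Defs.ext K n Q (nat_vec b) (nat_vec (\<alpha> + \<alpha>')) = 0 \<and> Defs.ext K n Q (nat_vec (\<alpha> + \<alpha>')) (nat_vec b) = 0"
        using \<alpha>[OF b(1)] \<alpha>'[OF b(1)] ext_nat_vec_add[where a=\<alpha> and a'=\<alpha>' and K=K, OF ok nn nn']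
        unfolding ext_orth_schur[OF b(2) 1] ext_orth_schur[OF b(2) s'] by blast
    next
      fix j assume j: "j < n" "- unitvec j \<in> I"
      then show "(\<alpha> + \<alpha>') j = 0"
        using \<alpha>[OF j(2)] \<alpha>'[OF j(2)] ext_orth_neg_schur(1)[OF j(1) 1] ext_orth_neg_schur(1)[OF j(1) s'] by simp
    qed
  next
    case 2
    then obtain i where i: "i < n" "\<alpha> = - unitvec i" unfolding neg_root_def by blast
    \<comment> \<open>Not being orthogonal to \<open>-e_i\<close>, the root \<open>\<alpha>'\<close>
      is positive at \<open>i\<close>, so the sum stays nonnegative. It differs from
      \<open>\<alpha>'\<close> only at \<open>i\<close>, where the positive members of
      \<open>I\<close> vanish.\<close>
    have "\<alpha>' i \<noteq> 0" using no ext_orth_neg_schur(1)[OF i(1) s'] unfolding i(2) by blast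
    then have pos: "1 \<le> \<alpha>' i" using nn'[of i] by simp
    have le: "nat_vec (\<alpha> + \<alpha>') v \<le> nat_vec \<alpha>' v" for v
      unfolding i(2) by (intro nat_mono) (simp add: unitvec_def)
    show ?thesis
    proof (rule orth_set_union_decomps[OF ok I])
      show "0 \<le> (\<alpha> + \<alpha>') j" for j using nn'[of j] pos unfolding i(2) by (simp add: unitvec_def)
    next
      fix b assume b: "b \<in> I" "schur_root K n Q b"
      have "b i = 0" using \<alpha>[OF b(1)] ext_orth_neg_schur(2)[OF i(1) b(2)] unfolding i(2) by blast
      then have eq: "nat_vec (\<alpha> + \<alpha>') v = nat_vec \<alpha>' v" if "nat_vec b v \<noteq> 0" for v
        using that unfolding i(2) by (auto simp: unitvec_def)
      show "Defs.ext K n Q (nat_vec b) (nat_vec (\<alpha> + \<alpha>')) = 0 \<and> Defs.ext K n Q (nat_vec (\<alpha> + \<alpha>')) (nat_vec b) = 0"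
      proof
        show "Defs.ext K n Q (nat_vec b) (nat_vec (\<alpha> + \<alpha>')) = 0"
          by (rule ext_restrict_right[OF _ le eq]) (use \<alpha>'[OF b(1)] ext_orth_schur[OF b(2) s'] in blast)
        show "Defs.ext K n Q (nat_vec (\<alpha> + \<alpha>')) (nat_vec b) = 0"
          by (rule ext_restrict_left[OF _ le eq]) (use \<alpha>'[OF b(1)] ext_orth_schur[OF b(2) s'] in blast)
      qed
    next
      fix j assume j: "j < n" "- unitvec j \<in> I"
      then have "\<alpha>' j = 0" using \<alpha>'[OF j(2)] ext_orth_neg_schur(1)[OF j(1) s'] by blast
      moreover have "j \<noteq> i" using \<alpha>[OF j(2)] i(2) by auto
      ultimately show "(\<alpha> + \<alpha>') j = 0" unfolding i(2) by (simp add: unitvec_def)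
    qed
  qed
qed

theorem mainTheorem15:
  fixes K :: "'k::field_char_0 itself" and n :: nat and Q :: quiver
    and C1 C2 :: "(nat \<Rightarrow> int) set"
  assumes "alg_closed_field K"
    and "quiver_ok n Q" and "connected_quiver n Q" and "acyclic_quiver Q"
    and "component_cluster K n Q C1" and "component_cluster K n Q C2"
    and "mutation_connected C1 C2"
  shows "\<forall>\<alpha>\<in>C1 - C2. \<forall>\<alpha>'\<in>C2 - C1. \<exists>C3. component_cluster K n Q C3 \<and> C1 \<inter> C2 \<subseteq> C3 \<and>
           (\<forall>D. generic_decomp K n Q (\<alpha> + \<alpha>') D \<longrightarrow> set_mset D \<subseteq> C3)"
proof (intro ballI)
  fix \<alpha> \<alpha>' assume \<alpha>: "\<alpha> \<in> C1 - C2" and \<alpha>': "\<alpha>' \<in> C2 - C1"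
  let ?I = "C1 \<inter> C2"
  have o: "orth_set K n Q C1" "orth_set K n Q C2" using assms(5,6) by (auto simp: component_cluster_def)
  have I: "orth_set K n Q ?I" using o(1) unfolding orth_set_def by blast
  have g: "gen_schur_root K n Q \<alpha>" "gen_schur_root K n Q \<alpha>'" using o \<alpha> \<alpha>' unfolding orth_set_def by blast+
  have no: "\<not> ext_orth K n Q \<alpha> \<alpha>'" by (rule not_ext_orth_exchange[OF assms(5-7) \<alpha> \<alpha>'])
  have I1: "ext_orth K n Q b \<alpha> \<and> b \<noteq> \<alpha>" if "b \<in> ?I" for b
  proof -
    have "b \<noteq> \<alpha>" using that \<alpha> by blast
    then show ?thesis using that \<alpha> o(1) unfolding orth_set_def by blast
  qed
  have I2: "ext_orth K n Q b \<alpha>' \<and> b \<noteq> \<alpha>'" if "b \<in> ?I" for b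
  proof -
    have "b \<noteq> \<alpha>'" using that \<alpha>' by blast
    then show ?thesis using that \<alpha>' o(2) unfolding orth_set_def by blast
  qed
  \<comment> \<open>Two negative roots are always orthogonal, so at least one root of the exchanged
    pair is positive; the situation is symmetric in the pair.\<close>
  have "schur_root K n Q \<alpha> \<or> schur_root K n Q \<alpha>'"
    using g no ext_orth_neg_neg unfolding gen_schur_root_def by blast
  then have "orth_set K n Q (?I \<union> {a. \<exists>D. generic_decomp K n Q (\<alpha> + \<alpha>') D \<and> a \<in># D})"
  proof
    assume "schur_root K n Q \<alpha>'"
    from orth_set_exchange_sum[OF assms(2) I I1 I2 g(1) this no] show ?thesis .
  next
    assume s: "schur_root K n Q \<alpha>"
    have no': "\<not> ext_orth K n Q \<alpha>' \<alpha>" using no ext_orth_sym by blast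
    show ?thesis using orth_set_exchange_sum[OF assms(2) I I2 I1 g(2) s no'] by (simp only: add.commute)
  qed
  from component_cluster_extend[OF this] obtain C3 where
    C3: "component_cluster K n Q C3" "?I \<union> {a. \<exists>D. generic_decomp K n Q (\<alpha> + \<alpha>') D \<and> a \<in># D} \<subseteq> C3" by blast
  show "\<exists>C3. component_cluster K n Q C3 \<and> ?I \<subseteq> C3 \<and>
           (\<forall>D. generic_decomp K n Q (\<alpha> + \<alpha>') D \<longrightarrow> set_mset D \<subseteq> C3)"
    by (intro exI[of _ C3] conjI C3(1)) (use C3(2) in blast)+
qed

end
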